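(* Deciding whether a pointwise linear-time computable, almost linear, Lipschitz function $f$ with $f(\mathbb{Q}\cap[0,1])\subseteq\mathbb{Q}$ is transducer (equivalently, continuous regular) is $\Sigma^0_2$-complete. Precisely: (a) for total computable functions $f\colon[0,1]\to[0,1]$ given by indices of Turing functionals computing them, the set of indices of those $f$ that are regular is $\Sigma^0_2$; and (b) for every $\Sigma^0_2$ set $S\subseteq\mathbb{N}$ there is a computable sequence $(f_z)_{z\in\mathbb{N}}$ (given by uniformly computable indices) of computable functions $f_z\colon[0,1]\to[0,1]$, each of which is Lipschitz, almost linear, pointwise linear-time computable and satisfies $f_z(\mathbb{Q}\cap[0,1])\subseteq\mathbb{Q}$, such that $z\in S$ if and only if $f_z$ is regular (equivalently, computable by a nondeterministic transducer for the standard binary representation).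
   Context: Standard binary representation: $\alpha\in\{0,1\}^\omega$ represents $\overline{\alpha}=\sum_s\alpha(s)2^{-s-1}$; for a finite string $\sigma$, $\overline{\sigma}=\sum_{s<|\sigma|}\sigma(s)2^{-s-1}$. $f\colon[0,1]\to[0,1]$ is regular if there is a nondeterministic Büchi automaton over $\{0,1\}$ accepting $\alpha(0)\beta(0)\alpha(1)\beta(1)\cdots$ iff $f(\overline\alpha)=\overline\beta$. A nondeterministic transducer with delay $D$ reads input bits one at a time, writes nothing for the first $D$ bits, then writes one output bit per input bit; it computes $f$ if on every binary representation of every $x$ there is an infinite run and every infinite run writes a binary representation of $f(x)$. Almost linear: there is a nowhere dense set $N\subseteq[0,1]$ of Lebesgue measure zero such that every point of $[0,1]\setminus N$ has a neighbourhood on which $f$ is affine. Pointwise linear-time computable: $f$ is Lipschitz, maps dyadic rationals in $[0,1]$ to rationals, and there is a function $\psi\colon\{0,1\}^{<\omega}\to\{0,1\}^{<\omega}\times\{0,1\}^{<\omega}$ computable by a multi-tape deterministic Turing machine in $O(|\sigma|)$ steps such that whenever $\psi(\sigma)=(\tau,\eta)$, the eventually periodic binary sequence $\tau\eta\eta\eta\cdots$ represents $f(\overline{\sigma})$. *)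

theory Defs
  imports "HOL-Analysis.Analysis" "HOL-Library.Nat_Bijection"
begin

section \<open>Multi-tape deterministic Turing machines\<close>

text \<open>
  A machine is a number of tapes together with a finite table of instructions
  \<open>((q, as), (q', acts))\<close>: in state \<open>q\<close> scanning the symbols \<open>as\<close> (one per tape), go to
  state \<open>q'\<close> and perform on each tape an action (symbol written, head displacement).
  The first matching instruction is executed; the machine halts when none matches.
  Tapes are infinite in both directions, the symbol 0 is the blank, the initial state is 0.
\<close>

type_synonym tm_table = "((nat \<times> nat list) \<times> nat \<times> (nat \<times> int) list) list"
type_synonym tm = "nat \<times> tm_table"
type_synonym tape = "int \<Rightarrow> nat"
type_synonym config = "nat \<times> (int \<times> tape) list"

definition tm_wf :: "tm \<Rightarrow> bool" where
  "tm_wf M \<longleftrightarrow> (\<forall>((q, as), (q', acts)) \<in> set (snd M).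
     length as = fst M \<and> length acts = fst M \<and> (\<forall>(w, d) \<in> set acts. d \<in> {-1, 0, 1}))"

definition tm_lookup :: "tm \<Rightarrow> config \<Rightarrow> (nat \<times> (nat \<times> int) list) option" where
  "tm_lookup M c = map_of (snd M) (fst c, map (\<lambda>(h, t). t h) (snd c))"

definition tm_halted :: "tm \<Rightarrow> config \<Rightarrow> bool" where
  "tm_halted M c \<longleftrightarrow> tm_lookup M c = None"

text \<open>A halted configuration is left unchanged.\<close>

definition tm_step :: "tm \<Rightarrow> config \<Rightarrow> config" where
  "tm_step M c = (case tm_lookup M c of
       None \<Rightarrow> c
     | Some (q', acts) \<Rightarrow> (q', map2 (\<lambda>(w, d) (h, t). (h + d, t(h := w))) acts (snd c)))"

definition tm_run :: "tm \<Rightarrow> nat \<Rightarrow> config \<Rightarrow> config" where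
  "tm_run M t c = (tm_step M ^^ t) c"

definition tm_init :: "tm \<Rightarrow> tape list \<Rightarrow> config" where
  "tm_init M ts = (0, map (\<lambda>i. (0, if i < length ts then ts ! i else (\<lambda>_. 0))) [0..<fst M])"

definition bit_sym :: "bool \<Rightarrow> nat" where
  "bit_sym b = (if b then 2 else 1)"

definition string_tape :: "bool list \<Rightarrow> tape" where
  "string_tape \<sigma> i = (if 0 \<le> i \<and> i < int (length \<sigma>) then bit_sym (\<sigma> ! nat i) else 0)"

definition omega_tape :: "(nat \<Rightarrow> bool) \<Rightarrow> tape" where
  "omega_tape \<alpha> i = (if 0 \<le> i then bit_sym (\<alpha> (nat i)) else 0)"

text \<open>The string on a tape is read from cell 0 up to the first blank.\<close>

definition tape_holds :: "tape \<Rightarrow> bool list \<Rightarrow> bool" where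
  "tape_holds t \<sigma> \<longleftrightarrow>
     (\<forall>i < length \<sigma>. t (int i) = bit_sym (\<sigma> ! i)) \<and> t (int (length \<sigma>)) = 0"

section \<open>Turing functionals, computable functions and \<open>\<Sigma>\<^sup>0\<^sub>2\<close> sets\<close>

definition act_decode :: "nat \<Rightarrow> nat \<times> int" where
  "act_decode = map_prod id int_decode \<circ> prod_decode"

definition instr_decode :: "nat \<Rightarrow> (nat \<times> nat list) \<times> nat \<times> (nat \<times> int) list" where
  "instr_decode = map_prod
     (map_prod id list_decode \<circ> prod_decode)
     (map_prod id (map act_decode \<circ> list_decode) \<circ> prod_decode) \<circ> prod_decode"

definition tm_decode :: "nat \<Rightarrow> tm" where
  "tm_decode = map_prod id (map instr_decode \<circ> list_decode) \<circ> prod_decode"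

text \<open>
  \<open>turing_functional e p n m\<close>: the \<open>e\<close>-th oracle machine with oracle \<open>p\<close> halts on input \<open>n\<close>
  with output \<open>m\<close>. Input and output are in unary on tape 0; the oracle tape, tape 1, carries
  the characteristic sequence of the graph of \<open>p\<close>.
\<close>

definition graph_seq :: "(nat \<Rightarrow> nat) \<Rightarrow> nat \<Rightarrow> bool" where
  "graph_seq p i \<longleftrightarrow> p (fst (prod_decode i)) = snd (prod_decode i)"

definition turing_functional :: "nat \<Rightarrow> (nat \<Rightarrow> nat) \<Rightarrow> nat \<Rightarrow> nat \<Rightarrow> bool" where
  "turing_functional e p n m \<longleftrightarrow>
     (let M = tm_decode e;
          c = tm_init M [string_tape (replicate n True), omega_tape (graph_seq p)]
      in tm_wf M \<and> 2 \<le> fst M \<and>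
         (\<exists>t. tm_halted M (tm_run M t c) \<and>
              tape_holds (snd (snd (tm_run M t c) ! 0)) (replicate m True)))"

definition computable_fun :: "(nat \<Rightarrow> nat) \<Rightarrow> bool" where
  "computable_fun g \<longleftrightarrow> (\<exists>e. \<forall>n. turing_functional e (\<lambda>_. 0) n (g n))"

definition computable_rel3 :: "(nat \<Rightarrow> nat \<Rightarrow> nat \<Rightarrow> bool) \<Rightarrow> bool" where
  "computable_rel3 R \<longleftrightarrow>
     (\<exists>g. computable_fun g \<and>
          (\<forall>z x y. g (prod_encode (z, prod_encode (x, y))) = of_bool (R z x y)))"

definition Sigma02 :: "nat set \<Rightarrow> bool" where
  "Sigma02 S \<longleftrightarrow>
     (\<exists>R. computable_rel3 R \<and> (\<forall>z. z \<in> S \<longleftrightarrow> (\<exists>x. \<forall>y. R z x y)))"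

text \<open>
  Names of points of the unit interval are fast Cauchy sequences of dyadic rationals, the
  \<open>n\<close>-th approximation being given by its numerator over \<open>2 ^ n\<close>.
\<close>

definition cauchy_name :: "(nat \<Rightarrow> nat) \<Rightarrow> real \<Rightarrow> bool" where
  "cauchy_name p x \<longleftrightarrow> (\<forall>n. \<bar>x - real (p n) / 2 ^ n\<bar> \<le> 1 / 2 ^ n)"

definition functional_computes :: "nat \<Rightarrow> (real \<Rightarrow> real) \<Rightarrow> bool" where
  "functional_computes e f \<longleftrightarrow>
     (\<forall>x \<in> {0..1}. \<forall>p. cauchy_name p x \<longrightarrow>
        (\<exists>q. cauchy_name q (f x) \<and> (\<forall>n. turing_functional e p n (q n))))"

section \<open>Binary representation, regular functions and transducers\<close>

definition bin_val :: "(nat \<Rightarrow> bool) \<Rightarrow> real" where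
  "bin_val \<alpha> = (\<Sum>s. of_bool (\<alpha> s) / 2 ^ (s + 1))"

definition bin_val_fin :: "bool list \<Rightarrow> real" where
  "bin_val_fin \<sigma> = (\<Sum>s<length \<sigma>. of_bool (\<sigma> ! s) / 2 ^ (s + 1))"

record buchi =
  b_states :: "nat set"
  b_init :: "nat set"
  b_trans :: "(nat \<times> bool \<times> nat) set"
  b_acc :: "nat set"

definition buchi_wf :: "buchi \<Rightarrow> bool" where
  "buchi_wf A \<longleftrightarrow> finite (b_states A) \<and> b_init A \<subseteq> b_states A \<and> b_acc A \<subseteq> b_states A \<and>
     b_trans A \<subseteq> b_states A \<times> UNIV \<times> b_states A"

definition buchi_accepts :: "buchi \<Rightarrow> (nat \<Rightarrow> bool) \<Rightarrow> bool" where
  "buchi_accepts A w \<longleftrightarrow>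
     (\<exists>r. r 0 \<in> b_init A \<and> (\<forall>i. (r i, w i, r (Suc i)) \<in> b_trans A) \<and>
          (\<exists>\<^sub>\<infinity>i. r i \<in> b_acc A))"

definition interleave :: "(nat \<Rightarrow> bool) \<Rightarrow> (nat \<Rightarrow> bool) \<Rightarrow> nat \<Rightarrow> bool" where
  "interleave \<alpha> \<beta> i = (if even i then \<alpha> (i div 2) else \<beta> (i div 2))"

definition regular_fun :: "(real \<Rightarrow> real) \<Rightarrow> bool" where
  "regular_fun f \<longleftrightarrow>
     (\<exists>A. buchi_wf A \<and>
          (\<forall>\<alpha> \<beta>. buchi_accepts A (interleave \<alpha> \<beta>) \<longleftrightarrow> f (bin_val \<alpha>) = bin_val \<beta>))"

text \<open>
  During the first \<open>t_delay\<close> steps a transducer uses the transitions \<open>t_wait\<close>, which produce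
  no output; afterwards it uses the transitions \<open>t_write\<close> (source, bit read, bit written, target).
\<close>

record transducer =
  t_delay :: nat
  t_states :: "nat set"
  t_init :: "nat set"
  t_wait :: "(nat \<times> bool \<times> nat) set"
  t_write :: "(nat \<times> bool \<times> bool \<times> nat) set"

definition transducer_wf :: "transducer \<Rightarrow> bool" where
  "transducer_wf T \<longleftrightarrow> finite (t_states T) \<and> t_init T \<subseteq> t_states T \<and>
     t_wait T \<subseteq> t_states T \<times> UNIV \<times> t_states T \<and>
     t_write T \<subseteq> t_states T \<times> UNIV \<times> UNIV \<times> t_states T"

definition transducer_run ::
  "transducer \<Rightarrow> (nat \<Rightarrow> bool) \<Rightarrow> (nat \<Rightarrow> nat) \<Rightarrow> (nat \<Rightarrow> bool) \<Rightarrow> bool" where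
  "transducer_run T \<alpha> r \<beta> \<longleftrightarrow> r 0 \<in> t_init T \<and>
     (\<forall>i < t_delay T. (r i, \<alpha> i, r (Suc i)) \<in> t_wait T) \<and>
     (\<forall>j. (r (t_delay T + j), \<alpha> (t_delay T + j), \<beta> j, r (Suc (t_delay T + j))) \<in> t_write T)"

definition transducer_computes :: "transducer \<Rightarrow> (real \<Rightarrow> real) \<Rightarrow> bool" where
  "transducer_computes T f \<longleftrightarrow>
     (\<forall>\<alpha>. (\<exists>r \<beta>. transducer_run T \<alpha> r \<beta>) \<and>
          (\<forall>r \<beta>. transducer_run T \<alpha> r \<beta> \<longrightarrow> bin_val \<beta> = f (bin_val \<alpha>)))"

definition transducer_fun :: "(real \<Rightarrow> real) \<Rightarrow> bool" where
  "transducer_fun f \<longleftrightarrow> (\<exists>T. transducer_wf T \<and> transducer_computes T f)"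

section \<open>Almost linear and pointwise linear-time computable functions\<close>

definition almost_linear :: "(real \<Rightarrow> real) \<Rightarrow> bool" where
  "almost_linear f \<longleftrightarrow>
     (\<exists>N \<subseteq> {0..1}. interior (closure N) = {} \<and> N \<in> null_sets lebesgue \<and>
        (\<forall>x \<in> {0..1} - N. \<exists>\<epsilon> > 0. \<exists>a b. \<forall>y \<in> ball x \<epsilon> \<inter> {0..1}. f y = a * y + b))"

definition lipschitz_unit :: "(real \<Rightarrow> real) \<Rightarrow> bool" where
  "lipschitz_unit f \<longleftrightarrow> (\<exists>L. L-lipschitz_on {0..1} f)"

definition ev_periodic :: "bool list \<Rightarrow> bool list \<Rightarrow> nat \<Rightarrow> bool" where
  "ev_periodic \<tau> \<eta> i =
     (if i < length \<tau> then \<tau> ! i else \<eta> ! ((i - length \<tau>) mod length \<eta>))"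

text \<open>
  The input is on tape 0, the two components of the output are written on tapes 1 and 2.
  Since halted configurations do not change, the time bound says that the machine has halted
  after at most that many steps.
\<close>

definition linear_time_computable :: "(bool list \<Rightarrow> bool list \<times> bool list) \<Rightarrow> bool" where
  "linear_time_computable \<psi> \<longleftrightarrow>
     (\<exists>M C. tm_wf M \<and> 3 \<le> fst M \<and>
        (\<forall>\<sigma>. let c = tm_run M (C * (length \<sigma> + 1)) (tm_init M [string_tape \<sigma>])
              in tm_halted M c \<and>
                 tape_holds (snd (snd c ! 1)) (fst (\<psi> \<sigma>)) \<and>
                 tape_holds (snd (snd c ! 2)) (snd (\<psi> \<sigma>))))"

definition pointwise_linear_time :: "(real \<Rightarrow> real) \<Rightarrow> bool" where
  "pointwise_linear_time f \<longleftrightarrow>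
     lipschitz_unit f \<and>
     (\<forall>k n :: nat. k \<le> 2 ^ n \<longrightarrow> f (real k / 2 ^ n) \<in> \<rat>) \<and>
     (\<exists>\<psi>. linear_time_computable \<psi> \<and>
        (\<forall>\<sigma> \<tau> \<eta>. \<psi> \<sigma> = (\<tau>, \<eta>) \<longrightarrow>
           \<eta> \<noteq> [] \<and> bin_val (ev_periodic \<tau> \<eta>) = f (bin_val_fin \<sigma>)))"

end

theory Submission
  imports Defs
begin

text \<open>
  Part (a). A continuous function is regular iff it is computed by a finite automaton without
  acceptance condition that reads the input and guesses the output bit by bit: the graph is closed,
  so only the states with an accepting continuation matter. Such an automaton is correct for a
  computable \<open>f\<close> iff every input prefix has a run and no lasso run (these are dense) is ever
  contradicted by the computation of \<open>f\<close>, which is a \<open>\<Pi>\<^sup>0\<^sub>1\<close> condition on the automaton.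

  Part (b). For a \<open>\<Sigma>\<^sup>0\<^sub>2\<close> set there is a machine, uniform in \<open>z\<close>, that enters a fixed state infinitely often iff
  \<open>z\<close> is not in the set. Let \<open>f\<^sub>z\<close> have a tent of slope \<open>2\<^sup>-\<^sup>n\<close> on \<open>[2\<^sup>-\<^sup>n\<^sup>-\<^sup>1, 2\<^sup>-\<^sup>n]\<close>
  if the machine is in that state after \<open>n\<close> steps, and vanish otherwise. A finite automaton can
  produce only finitely many slopes, so \<open>f\<^sub>z\<close> is regular iff there are finitely many tents. At a dyadic
  point with \<open>n\<close> leading zeros, \<open>f\<^sub>z\<close> is evaluated by running the machine while reading these zeros.
\<close>

section \<open>Primitive recursive functions\<close>

text \<open>The obstacle is that every computability claim refers to concrete multi-tape machines
  given by finite tables. Primitive recursion is the interface in both directions: primitive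
  recursive functions compile to machines whose index depends primitive recursively on a parameter,
  and bounded runs of machines are simulated primitive recursively. Unbounded search then survives
  only as a quantifier, as a stage counter, or as the search for one oracle value. Lasso runs enter
  the refutation test because they are finite data, so that the oracle given by their input is
  itself computable. The slopes \<open>2^-n\<close> serve two ends: infinitely many events force
  infinitely many slopes, and the total stays 1-Lipschitz, so that a single oracle value with two
  extra bits of precision yields each approximation of the result. The event machine only has to
  reach its state infinitely often, no matter how slowly. This permits evaluation in linear time,
  one simulated step per leading zero, although nothing bounds the time at which events
  happen.\<close>

inductive prec :: "(nat \<Rightarrow> nat) \<Rightarrow> bool" where
  prec_zero: "prec (\<lambda>_. 0)"
| prec_Suc: "prec Suc"
| prec_id: "prec (\<lambda>x. x)"
| prec_fst: "prec (\<lambda>x. fst (prod_decode x))"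
| prec_snd: "prec (\<lambda>x. snd (prod_decode x))"
| prec_comp: "prec f \<Longrightarrow> prec g \<Longrightarrow> prec (\<lambda>x. f (g x))"
| prec_pair: "prec f \<Longrightarrow> prec g \<Longrightarrow> prec (\<lambda>x. prod_encode (f x, g x))"
| prec_iter: "prec f \<Longrightarrow> prec (\<lambda>x. (f ^^ fst (prod_decode x)) (snd (prod_decode x)))"

lemma prec_const: "prec (\<lambda>_. c)"
  by (induction c) (auto intro: prec_zero prec_comp[OF prec_Suc])

section \<open>Numerical codes of data types, and primitive recursiveness with respect to
  them\<close>

class coded =
  fixes enc :: "'a \<Rightarrow> nat"
  assumes enc_inj: "enc x = enc y \<Longrightarrow> x = y"

text \<open>Surjectivity makes \<open>dcd\<close> a two-sided inverse of \<open>enc\<close>, so that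
  quantifying over numbers amounts to quantifying over objects. Booleans have only the codes 0 and 1
  and stay outside; automata are therefore described by lists of numbers later on.\<close>

class coded_full = coded +
  assumes enc_surj: "\<exists>x. enc x = n"

instantiation nat :: coded_full
begin
definition enc_nat :: "nat \<Rightarrow> nat" where [simp]: "enc_nat n = n"
instance by standard auto
end

instantiation bool :: coded
begin
definition enc_bool :: "bool \<Rightarrow> nat" where "enc_bool b = of_bool b"
instance
proof
  show "x = y" if "enc x = enc y" for x y :: bool
    using that by (cases x; cases y) (simp_all add: enc_bool_def)
qed
end

instantiation int :: coded_full
begin
definition enc_int :: "int \<Rightarrow> nat" where "enc_int = int_encode"
instance by standard (auto simp: enc_int_def int_encode_eq intro: exI[of _ "int_decode _"])
end

instantiation prod :: (coded, coded) coded
begin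
definition enc_prod :: "'a \<times> 'b \<Rightarrow> nat" where
  "enc_prod p = prod_encode (enc (fst p), enc (snd p))"
instance by standard (auto simp: enc_prod_def prod_eq_iff intro: enc_inj)
end

instance prod :: (coded_full, coded_full) coded_full
proof
  fix n
  obtain x :: 'a where x: "enc x = fst (prod_decode n)" using enc_surj by blast
  obtain y :: 'b where y: "enc y = snd (prod_decode n)" using enc_surj by blast
  show "\<exists>p :: 'a \<times> 'b. enc p = n"
    by (rule exI[of _ "(x, y)"]) (simp add: enc_prod_def x y)
qed

instantiation list :: (coded) coded
begin
definition enc_list :: "'a list \<Rightarrow> nat" where "enc_list xs = list_encode (map enc xs)"
instance
proof
  fix xs ys :: "'a list"
  assume "enc xs = enc ys"
  then have "map enc xs = map enc ys" by (simp add: enc_list_def list_encode_eq)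
  then show "xs = ys" by (rule map_injective) (auto intro!: injI enc_inj)
qed
end

instance list :: (coded_full) coded_full
proof
  fix n
  have "\<exists>ys :: 'a list. map enc ys = xs" for xs
  proof (induction xs)
    case (Cons x xs)
    then obtain ys :: "'a list" where "map enc ys = xs" by blast
    moreover obtain y :: 'a where "enc y = x" using enc_surj by blast
    ultimately have "map enc (y # ys) = x # xs" by simp
    then show ?case ..
  qed simp
  then obtain ys :: "'a list" where "map enc ys = list_decode n" by blast
  then have "enc ys = n" by (simp add: enc_list_def)
  then show "\<exists>ys :: 'a list. enc ys = n" ..
qed

instantiation option :: (coded) coded
begin
definition enc_option :: "'a option \<Rightarrow> nat" where
  "enc_option z = (case z of None \<Rightarrow> 0 | Some x \<Rightarrow> Suc (enc x))"
instance by standard (auto simp: enc_option_def split: option.splits intro: enc_inj)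
end

definition dcd :: "nat \<Rightarrow> 'a :: coded_full" where "dcd n = (SOME x. enc x = n)"

lemma enc_dcd [simp]: "enc (dcd n) = n"
  unfolding dcd_def using enc_surj by (rule someI_ex)

lemma dcd_enc [simp]: "dcd (enc x) = x"
  by (rule enc_inj) simp

text \<open>The function on codes is constrained only on the range of \<open>enc\<close>. With this
  notion primitive recursiveness is proved by following the syntax of a term with the
  \<open>pr\<close> rules, codes being visible only in the basic cases.\<close>

definition prim :: "('a :: coded \<Rightarrow> 'b :: coded) \<Rightarrow> bool" where
  "prim f \<longleftrightarrow> (\<exists>g. prec g \<and> (\<forall>x. g (enc x) = enc (f x)))"

named_theorems pr

lemma primI: "prec g \<Longrightarrow> (\<And>x. g (enc x) = enc (f x)) \<Longrightarrow> prim f"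
  unfolding prim_def by blast

lemma prim_id [pr]: "prim (\<lambda>x. x)"
  by (rule primI[OF prec_id]) simp

lemma prim_const [pr]: "prim (\<lambda>_. c)"
  by (rule primI[OF prec_const]) simp

lemma prim_comp: assumes "prim f" "prim g" shows "prim (\<lambda>x. f (g x))"
proof -
  obtain f' g' where "prec f'" "\<forall>x. f' (enc x) = enc (f x)" "prec g'" "\<forall>x. g' (enc x) = enc (g x)"
    using assms unfolding prim_def by blast
  then show ?thesis by (intro primI[OF prec_comp[of f' g']]) auto
qed

lemma prim_Pair [pr]: assumes "prim f" "prim g" shows "prim (\<lambda>x. (f x, g x))"
proof -
  obtain f' g' where "prec f'" "\<forall>x. f' (enc x) = enc (f x)" "prec g'" "\<forall>x. g' (enc x) = enc (g x)"
    using assms unfolding prim_def by blast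
  then show ?thesis by (intro primI[OF prec_pair[of f' g']]) (auto simp: enc_prod_def)
qed

lemma prim_comp2:
  assumes "prim (\<lambda>p. h (fst p) (snd p))" "prim f" "prim g"
  shows "prim (\<lambda>x. h (f x) (g x))"
  using prim_comp[OF assms(1) prim_Pair[OF assms(2,3)]] by simp

lemma prod_decode_enc: "prod_decode (enc p) = (enc (fst p), enc (snd p))"
  by (simp add: enc_prod_def)

lemma prim_fst [pr]: "prim f \<Longrightarrow> prim (\<lambda>x. fst (f x))"
  by (rule prim_comp[of fst]) (rule primI[OF prec_fst], simp add: enc_prod_def)

lemma prim_snd [pr]: "prim f \<Longrightarrow> prim (\<lambda>x. snd (f x))"
  by (rule prim_comp[of snd]) (rule primI[OF prec_snd], simp add: enc_prod_def)

lemma prim_dcd [pr]: "prim f \<Longrightarrow> prim (\<lambda>x. dcd (f x))"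
  by (rule prim_comp[of dcd]) (rule primI[OF prec_id], simp)

lemma prim_enc [pr]: "prim f \<Longrightarrow> prim (\<lambda>x. enc (f x))"
  by (rule prim_comp[of enc]) (rule primI[OF prec_id], simp)

lemma prim_prod_encode [pr]: "prim f \<Longrightarrow> prim (\<lambda>x. prod_encode (f x))"
  by (rule prim_comp[of prod_encode]) (rule primI[OF prec_id], simp add: enc_prod_def)

lemma prim_prod_decode [pr]: "prim f \<Longrightarrow> prim (\<lambda>x. prod_decode (f x))"
  by (rule prim_comp[of prod_decode]) (rule primI[OF prec_id], simp add: enc_prod_def)

lemma prim_Suc [pr]: "prim f \<Longrightarrow> prim (\<lambda>x. Suc (f x))"
  by (rule prim_comp[of Suc]) (rule primI[OF prec_Suc], simp)

lemma funpow_pair: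
  fixes F :: "'a \<Rightarrow> 's \<Rightarrow> 's"
  shows "((\<lambda>p. (fst p, F (fst p) (snd p))) ^^ n) (x, s) = (x, (F x ^^ n) s)"
  by (induction n) auto

text \<open>The basic scheme iterates a function without parameters, so \<open>x\<close> is carried
  along unchanged in the first component of the state.\<close>

lemma prim_iter [pr]:
  fixes F :: "'a :: coded \<Rightarrow> 's :: coded \<Rightarrow> 's"
  assumes "prim (\<lambda>p. F (fst p) (snd p))" "prim n" "prim a"
  shows "prim (\<lambda>x. (F x ^^ n x) (a x))"
proof -
  define G where "G = (\<lambda>p. (fst p, F (fst p) (snd p)))"
  have "prim G" unfolding G_def by (intro pr assms)
  then obtain g where g: "prec g" "\<And>x. g (enc x) = enc (G x)" unfolding prim_def by blast
  have it: "(g ^^ n) (enc p) = enc ((G ^^ n) p)" for n and p :: "'a \<times> 's"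
    by (induction n) (auto simp: g)
  have "prim (\<lambda>q. (G ^^ fst q) (snd q))"
    by (rule primI[OF prec_iter[OF g(1)]]) (simp add: prod_decode_enc it)
  from prim_comp[OF this prim_Pair[OF assms(2) prim_Pair[OF prim_id assms(3)]]]
  have "prim (\<lambda>x. snd ((G ^^ n x) (x, a x)))" by (intro pr) simp
  then show ?thesis by (simp add: G_def funpow_pair)
qed

lemma prim_of_bool_nat [pr]: "prim P \<Longrightarrow> prim (\<lambda>x. of_bool (P x) :: nat)"
  by (rule prim_comp[of of_bool]) (rule primI[OF prec_id], simp add: enc_bool_def)

text \<open>A case distinction is an iteration: the constant function with value \<open>f x\<close>,
  applied once or not at all to \<open>g x\<close>.\<close>

lemma prim_if [pr]:
  assumes "prim P" "prim f" "prim g"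
  shows "prim (\<lambda>x. if P x then f x else g x)"
proof -
  have "prim (\<lambda>x. ((\<lambda>_. f x) ^^ of_bool (P x)) (g x))"
    by (intro pr assms prim_comp[OF assms(2)])
  moreover have "((\<lambda>_. f x) ^^ of_bool (P x)) (g x) = (if P x then f x else g x)" for x
    by auto
  ultimately show ?thesis by simp
qed

text \<open>The iterated pair keeps a counter together with its previous value; starting it at
  \<open>(0, 0)\<close> makes the predecessor of 0 equal to 0.\<close>

lemma prim_pred: "prim f \<Longrightarrow> prim (\<lambda>x. f x - Suc 0)"
proof (rule prim_comp[of "\<lambda>n. n - Suc 0"])
  have "((\<lambda>p. (Suc (fst p), fst p)) ^^ n) (0 :: nat, 0 :: nat) = (n, n - Suc 0)" for n :: nat
    by (induction n) auto
  then have "(\<lambda>n. n - Suc 0) = (\<lambda>n. snd (((\<lambda>p. (Suc (fst p), fst p)) ^^ n) (0 :: nat, 0 :: nat)))"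
    by simp
  then show "prim (\<lambda>n :: nat. n - Suc 0)" by (simp only:) (intro pr)
qed

lemma prim_add [pr]: assumes "prim f" "prim g" shows "prim (\<lambda>x. f x + g x :: nat)"
proof -
  have "(Suc ^^ n) m = m + n" for n m by (induction n) auto
  moreover have "prim (\<lambda>x. (Suc ^^ g x) (f x))" by (intro pr assms)
  ultimately show ?thesis by (simp only:)
qed

lemma prim_diff [pr]: assumes "prim f" "prim g" shows "prim (\<lambda>x. f x - g x :: nat)"
proof -
  have "((\<lambda>k. k - Suc 0) ^^ n) m = m - n" for n m :: nat by (induction n) auto
  moreover have "prim (\<lambda>x. ((\<lambda>k. k - Suc 0) ^^ g x) (f x))" by (intro pr prim_pred assms)
  ultimately show ?thesis by simp
qed

lemma prim_mult [pr]: assumes "prim f" "prim g" shows "prim (\<lambda>x. f x * g x :: nat)"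
proof -
  have "((\<lambda>k. m + k) ^^ n) 0 = m * n" for n m :: nat by (induction n) auto
  moreover have "prim (\<lambda>x. ((\<lambda>k. f x + k) ^^ g x) 0)" by (intro pr assms prim_comp[OF assms(1)])
  ultimately show ?thesis by simp
qed

lemma prim_power [pr]: assumes "prim f" "prim g" shows "prim (\<lambda>x. f x ^ g x :: nat)"
proof -
  have "((\<lambda>k. m * k) ^^ n) 1 = m ^ n" for n m :: nat by (induction n) auto
  moreover have "prim (\<lambda>x. ((\<lambda>k. f x * k) ^^ g x) 1)" by (intro pr assms prim_comp[OF assms(1)])
  ultimately show ?thesis by simp
qed

lemma prim_not [pr]: assumes "prim P" shows "prim (\<lambda>x. \<not> P x)"
proof -
  have "prim (\<lambda>x. if P x then False else True)" by (intro pr assms)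
  then show ?thesis by (rule back_subst[of prim]) auto
qed

lemma prim_conj [pr]: assumes "prim P" "prim Q" shows "prim (\<lambda>x. P x \<and> Q x)"
proof -
  have "prim (\<lambda>x. if P x then Q x else False)" by (intro pr assms)
  then show ?thesis by (rule back_subst[of prim]) auto
qed

lemma prim_disj [pr]: assumes "prim P" "prim Q" shows "prim (\<lambda>x. P x \<or> Q x)"
proof -
  have "prim (\<lambda>x. if P x then True else Q x)" by (intro pr assms)
  then show ?thesis by (rule back_subst[of prim]) auto
qed

lemma prim_imp [pr]: assumes "prim P" "prim Q" shows "prim (\<lambda>x. P x \<longrightarrow> Q x)"
  by (subst imp_conv_disj) (intro prim_disj prim_not assms)

lemma prim_less_nat [pr]: assumes "prim f" "prim g" shows "prim (\<lambda>x. f x < (g x :: nat))"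
proof -
  have "prim (\<lambda>n :: nat. 0 < n)"
  proof (rule primI)
    \<comment> \<open>Iterating the constant 1 on the start value 0 yields 0 or 1, which are exactly
      the codes of the truth values of \<open>0 < n\<close>.\<close>
    show "prec (\<lambda>n. ((\<lambda>_. Suc 0) ^^ fst (prod_decode (prod_encode (n, 0))))
        (snd (prod_decode (prod_encode (n, 0)))))"
      by (rule prec_comp[OF prec_iter[OF prec_const] prec_pair[OF prec_id prec_zero]])
    show "((\<lambda>_. Suc 0) ^^ fst (prod_decode (prod_encode (enc n, 0))))
        (snd (prod_decode (prod_encode (enc n, 0)))) = enc (0 < n)" for n :: nat
      by (cases n) (auto simp: enc_bool_def)
  qed
  then have "prim (\<lambda>x. 0 < g x - f x)" by (rule prim_comp) (intro pr assms)
  then show ?thesis by simp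
qed

lemma prim_le_nat [pr]: assumes "prim f" "prim g" shows "prim (\<lambda>x. f x \<le> (g x :: nat))"
proof -
  have "prim (\<lambda>x. \<not> g x < f x)" by (intro pr assms)
  then show ?thesis by (simp add: not_less)
qed

lemma prim_eq [pr]: assumes "prim f" "prim g" shows "prim (\<lambda>x. f x = g x)"
proof -
  have "prim (\<lambda>x. enc (f x) \<le> enc (g x) \<and> enc (g x) \<le> enc (f x))" by (intro pr assms)
  moreover have "enc a \<le> enc b \<and> enc b \<le> enc a \<longleftrightarrow> a = b" for a b :: 'b
    using enc_inj[of a b] by auto
  ultimately show ?thesis by (simp only:)
qed

lemma prim_min [pr]: "prim f \<Longrightarrow> prim g \<Longrightarrow> prim (\<lambda>x. min (f x) (g x) :: nat)"
  unfolding min_def by (intro pr)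

lemma prim_divmod:
  assumes "prim f" "prim g"
  shows "prim (\<lambda>x. (f x div g x, f x mod g x :: nat))"
proof -
  \<comment> \<open>The remainder is reset when it would reach the divisor. For \<open>m = 0\<close>
    this never happens, in accordance with \<open>n div 0 = 0\<close> and
    \<open>n mod 0 = n\<close>.\<close>
  have "((\<lambda>p. if Suc (snd p) = m then (Suc (fst p), 0) else (fst p, Suc (snd p))) ^^ n) (0, 0)
      = (n div m, n mod m)" for n m :: nat
    by (induction n) (auto simp: div_Suc mod_Suc)
  moreover have "prim (\<lambda>x. ((\<lambda>p. if Suc (snd p) = g x then (Suc (fst p), 0)
      else (fst p, Suc (snd p))) ^^ f x) (0 :: nat, 0))"
    by (intro pr assms prim_comp[OF assms(2)])
  ultimately show ?thesis by simp
qed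

lemma prim_div [pr]: "prim f \<Longrightarrow> prim g \<Longrightarrow> prim (\<lambda>x. f x div g x :: nat)"
  using prim_fst[OF prim_divmod[of f g]] by simp

lemma prim_mod [pr]: "prim f \<Longrightarrow> prim g \<Longrightarrow> prim (\<lambda>x. f x mod g x :: nat)"
  using prim_snd[OF prim_divmod[of f g]] by simp

lemma funpow_sum: "((\<lambda>p. (Suc (fst p), snd p + h (fst p))) ^^ n) (0 :: nat, 0 :: nat) = (n, \<Sum>i<n. h i)"
  by (induction n) auto

lemma prim_sum [pr]:
  fixes F :: "'a :: coded \<Rightarrow> nat \<Rightarrow> nat"
  assumes "prim (\<lambda>p. F (fst p) (snd p))" "prim n"
  shows "prim (\<lambda>x. \<Sum>i<n x. F x i :: nat)"
proof -
  have "prim (\<lambda>x. snd (((\<lambda>p. (Suc (fst p), snd p + F x (fst p))) ^^ n x) (0, 0)))"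
    by (intro pr assms prim_comp2[OF assms(1)])
  then show ?thesis by (simp add: funpow_sum)
qed

subsection \<open>Integers\<close>

lemma prim_int_diff [pr]:
  assumes "prim f" "prim g" shows "prim (\<lambda>x. int (f x) - int (g x))"
proof -
  \<comment> \<open>\<open>int_encode\<close> uses the even codes for nonnegative and the odd codes
    for negative integers; the two branches are these codes of the difference.\<close>
  have "prim (\<lambda>x. dcd (if g x \<le> f x then 2 * (f x - g x) else Suc (2 * (g x - f x - 1))) :: int)"
    by (intro pr assms)
  moreover have "dcd (if n \<le> m then 2 * (m - n) else Suc (2 * (n - m - 1))) = int m - int n" for m n
  proof -
    have "nat (int m - int n) = m - n" "nat (- (int m - int n) - 1) = n - m - 1" by linarith+
    then have "enc (int m - int n) = (if n \<le> m then 2 * (m - n) else Suc (2 * (n - m - 1)))"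
      by (simp add: enc_int_def int_encode_def sum_encode_def)
    then show ?thesis by (metis dcd_enc)
  qed
  ultimately show ?thesis by simp
qed

lemma prim_int [pr]: "prim f \<Longrightarrow> prim (\<lambda>x. int (f x))"
  using prim_int_diff[OF _ prim_const[of 0]] by simp

lemma prim_nat [pr]: assumes "prim f" shows "prim (\<lambda>x. nat (f x))"
proof -
  have "prim (\<lambda>x. if enc (f x) mod 2 = 0 then enc (f x) div 2 else 0)"
    by (intro pr assms)
  moreover have "(if enc i mod 2 = 0 then enc i div 2 else 0) = nat i" for i :: int
    by (auto simp: enc_int_def int_encode_def sum_encode_def)
  ultimately show ?thesis by simp
qed

lemma prim_nat_neg: assumes "prim f" shows "prim (\<lambda>x. nat (- f x))"
proof -
  have "prim (\<lambda>x. if enc (f x) mod 2 = 0 then 0 else Suc (enc (f x) div 2))"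
    by (intro pr assms)
  moreover have "(if enc i mod 2 = 0 then 0 else Suc (enc i div 2)) = nat (- i)" for i :: int
    by (auto simp: enc_int_def int_encode_def sum_encode_def)
  ultimately show ?thesis by simp
qed

lemma prim_int_add [pr]: assumes "prim f" "prim g" shows "prim (\<lambda>x. f x + g x :: int)"
proof -
  have "prim (\<lambda>x. int (nat (f x) + nat (g x)) - int (nat (- f x) + nat (- g x)))"
    by (intro pr assms prim_nat_neg)
  then show ?thesis by (rule back_subst[of prim]) auto
qed

lemma prim_int_le [pr]: assumes "prim f" "prim g" shows "prim (\<lambda>x. f x \<le> (g x :: int))"
proof -
  have "prim (\<lambda>x. nat (f x) + nat (- g x) \<le> nat (g x) + nat (- f x))"
    by (intro pr assms prim_nat_neg)
  then show ?thesis by (rule back_subst[of prim]) auto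
qed

lemma prim_int_less [pr]: assumes "prim f" "prim g" shows "prim (\<lambda>x. f x < (g x :: int))"
proof -
  have "prim (\<lambda>x. \<not> g x \<le> f x)" by (intro pr assms)
  then show ?thesis by (simp add: not_le)
qed

subsection \<open>Lists and options\<close>

lemma enc_Cons: "enc (x # xs) = Suc (enc (x, xs))"
  by (simp add: enc_list_def enc_prod_def)

lemma enc_Nil [simp]: "enc [] = 0"
  by (simp add: enc_list_def)

lemma prim_Cons [pr]: assumes "prim f" "prim g" shows "prim (\<lambda>x. f x # g x)"
proof -
  have "prim (\<lambda>p :: 'b \<times> 'b list. fst p # snd p)"
    by (rule primI[OF prec_Suc]) (simp add: enc_Cons)
  from prim_comp2[OF this assms] show ?thesis .
qed

text \<open>A nonempty list has as its code the successor of the code of the pair of head and tail,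
  so taking it apart is the predecessor function; the code 0 of the empty list is sent to a
  default.\<close>

lemma prim_uncons:
  fixes d :: "'a :: coded"
  shows "prim (\<lambda>xs. case xs of [] \<Rightarrow> (d, []) | x # xs \<Rightarrow> (x, xs))"
proof -
  have "prim (\<lambda>n :: nat. if n = 0 then enc (d, [] :: 'a list) else n - Suc 0)" by (intro pr)
  then obtain g where "prec g" "\<And>n. g (enc n) = enc (if n = 0 then enc (d, [] :: 'a list) else n - Suc 0)"
    unfolding prim_def by blast
  then show ?thesis by (intro primI[of g]) (auto split: list.splits simp: enc_Cons)
qed

lemma prim_hd [pr]: assumes "prim f" shows "prim (\<lambda>x. hd (f x))"
proof -
  \<comment> \<open>The default is the unspecified value \<open>hd []\<close> itself, so that the
    equation holds for the empty list too.\<close>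
  have "prim (\<lambda>x. fst (case f x of [] \<Rightarrow> (hd [], []) | y # ys \<Rightarrow> (y, ys)))"
    by (intro pr prim_comp[OF prim_uncons] assms)
  then show ?thesis by (rule back_subst[of prim]) (auto split: list.splits)
qed

lemma prim_tl [pr]: assumes "prim f" shows "prim (\<lambda>x. tl (f x))"
proof -
  have "prim (\<lambda>x. snd (case f x of [] \<Rightarrow> (hd [], []) | y # ys \<Rightarrow> (y, ys)))"
    by (intro pr prim_comp[OF prim_uncons] assms)
  then show ?thesis by (rule back_subst[of prim]) (auto split: list.splits)
qed

text \<open>An iteration must know its number of rounds in advance, and the code of a list is a
  computable bound for its length. The surplus rounds in \<open>funpow_fold\<close> leave the state
  unchanged.\<close>

lemma length_le_enc: "length xs \<le> enc xs"
proof (induction xs)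
  case (Cons x xs)
  have "enc xs \<le> enc (x, xs)" by (simp add: enc_prod_def le_prod_encode_2)
  with Cons show ?case by (simp add: enc_Cons)
qed simp

lemma funpow_fold:
  assumes "length xs \<le> n"
  shows "((\<lambda>p. if fst p = [] then p else (tl (fst p), F (hd (fst p)) (snd p))) ^^ n) (xs, s)
    = ([], fold F xs s)"
  using assms
proof (induction n arbitrary: xs s)
  case (Suc n)
  show ?case
  proof (cases xs)
    case Nil
    then show ?thesis using Suc.IH[of "[]" s] by simp
  next
    case (Cons y ys)
    then show ?thesis using Suc.IH[of ys "F y s"] Suc.prems by (simp add: funpow_Suc_right del: funpow.simps)
  qed
qed simp

lemma prim_fold [pr]:
  assumes "prim (\<lambda>p. F (fst p) (fst (snd p)) (snd (snd p)))" "prim l" "prim a"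
  shows "prim (\<lambda>x. fold (F x) (l x) (a x))"
proof -
  have F: "prim (\<lambda>x. F (u x) (v x) (w x))" if "prim u" "prim v" "prim w" for u v w
    using prim_comp[OF assms(1) prim_Pair[OF that(1) prim_Pair[OF that(2,3)]]] by simp
  have "prim (\<lambda>x. snd (((\<lambda>p. if fst p = [] then p
      else (tl (fst p), F x (hd (fst p)) (snd p))) ^^ enc (l x)) (l x, a x)))"
    by (intro pr F assms)
  then show ?thesis by (simp add: funpow_fold[OF length_le_enc])
qed

lemma prim_rev [pr]: assumes "prim l" shows "prim (\<lambda>x. rev (l x))"
proof -
  have "prim (\<lambda>x. fold (#) (l x) [])" by (intro pr assms)
  then show ?thesis by (simp add: fold_Cons_rev)
qed

lemma prim_append [pr]: assumes "prim f" "prim g" shows "prim (\<lambda>x. f x @ g x)"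
proof -
  have "prim (\<lambda>x. fold (#) (rev (f x)) (g x))" by (intro pr assms)
  then show ?thesis by (simp add: fold_Cons_rev)
qed

lemma prim_map [pr]:
  assumes "prim (\<lambda>p. F (fst p) (snd p))" "prim l"
  shows "prim (\<lambda>x. map (F x) (l x))"
proof -
  have "fold (\<lambda>y ys. F x y # ys) l ys = rev (map (F x) l) @ ys" for x l ys
    by (induction l arbitrary: ys) auto
  moreover have "prim (\<lambda>x. rev (fold (\<lambda>y ys. F x y # ys) (l x) []))"
    by (intro pr assms prim_comp2[OF assms(1)])
  ultimately show ?thesis by simp
qed

lemma prim_filter [pr]:
  assumes "prim (\<lambda>p. P (fst p) (snd p))" "prim l"
  shows "prim (\<lambda>x. filter (P x) (l x))"
proof -
  have "fold (\<lambda>y ys. if P x y then y # ys else ys) l ys = rev (filter (P x) l) @ ys" for x l ys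
    by (induction l arbitrary: ys) auto
  moreover have "prim (\<lambda>x. rev (fold (\<lambda>y ys. if P x y then y # ys else ys) (l x) []))"
    by (intro pr assms prim_comp2[OF assms(1)])
  ultimately show ?thesis by simp
qed

lemma prim_concat [pr]: assumes "prim l" shows "prim (\<lambda>x. concat (l x))"
proof -
  have "fold (\<lambda>y ys. ys @ y) l ys = ys @ concat l" for l and ys :: "'b list"
    by (induction l arbitrary: ys) auto
  moreover have "prim (\<lambda>x. fold (\<lambda>y ys. ys @ y) (l x) [])" by (intro pr assms)
  ultimately show ?thesis by simp
qed

lemma prim_member [pr]: assumes "prim f" "prim l" shows "prim (\<lambda>x. f x \<in> set (l x))"
proof -
  have "fold (\<lambda>y b. b \<or> y = a) l b \<longleftrightarrow> b \<or> a \<in> set l" for l b and a :: 'b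
    by (induction l arbitrary: b) auto
  moreover have "prim (\<lambda>x. fold (\<lambda>y b. b \<or> y = f x) (l x) False)"
    by (intro pr assms prim_comp[OF assms(1)])
  ultimately show ?thesis by (simp only: simp_thms)
qed

lemma prim_length [pr]: assumes "prim l" shows "prim (\<lambda>x. length (l x))"
proof -
  have "fold (\<lambda>_. Suc) l n = length l + n" for l :: "'b list" and n by (induction l arbitrary: n) auto
  moreover have "prim (\<lambda>x. fold (\<lambda>_. Suc) (l x) 0)" by (intro pr assms)
  ultimately show ?thesis by simp
qed

lemma prim_drop [pr]: assumes "prim l" "prim n" shows "prim (\<lambda>x. drop (n x) (l x))"
proof -
  have "(tl ^^ n) l = drop n l" for n and l :: "'b list"
    by (induction n) (auto simp: drop_Suc tl_drop)
  moreover have "prim (\<lambda>x. (tl ^^ n x) (l x))" by (intro pr assms)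
  ultimately show ?thesis by simp
qed

lemma prim_upt [pr]: assumes "prim n" shows "prim (\<lambda>x. [0..<n x])"
proof -
  have "((\<lambda>p. (Suc (fst p), snd p @ [fst p])) ^^ n) (0, []) = (n, [0..<n])" for n
    by (induction n) auto
  moreover have "prim (\<lambda>x. snd (((\<lambda>p. (Suc (fst p), snd p @ [fst p])) ^^ n x) (0 :: nat, [])))"
    by (intro pr assms)
  ultimately show ?thesis by simp
qed

lemma prim_Some [pr]: assumes "prim f" shows "prim (\<lambda>x. Some (f x))"
  by (rule prim_comp[of Some, OF _ assms]) (rule primI[OF prec_Suc], simp add: enc_option_def)

lemma prim_case_option [pr]:
  assumes "prim a" "prim (\<lambda>p. F (fst p) (snd p))" "prim z"
  shows "prim (\<lambda>x. case z x of None \<Rightarrow> a x | Some y \<Rightarrow> F x y)"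
proof -
  have "prim (\<lambda>n :: nat. if n = 0 then enc (undefined :: 'c) else n - Suc 0)" by (intro pr)
  then obtain g where "prec g" "\<And>n. g (enc n) = enc (if n = 0 then enc (undefined :: 'c) else n - Suc 0)"
    unfolding prim_def by blast
  then have u: "prim (\<lambda>z :: 'c option. case z of None \<Rightarrow> undefined | Some y \<Rightarrow> y)"
    by (intro primI[of g]) (auto split: option.splits simp: enc_option_def)
  have "prim (\<lambda>x. if z x = None then a x else F x (case z x of None \<Rightarrow> undefined | Some y \<Rightarrow> y))"
    by (intro pr prim_comp2[OF assms(2)] assms prim_comp[OF u])
  then show ?thesis by (rule back_subst[of prim]) (auto split: option.splits)
qed

lemma prim_map_of [pr]: assumes "prim l" "prim f" shows "prim (\<lambda>x. map_of (l x) (f x))"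
proof -
  \<comment> \<open>In the reversed list a later match overwrites an earlier one, hence the first
    match of the original list wins, as \<open>map_of\<close> demands.\<close>
  have "fold (\<lambda>y z. if fst y = a then Some (snd y) else z) (rev l) None = map_of l a" for l :: "('b \<times> 'c) list" and a
    by (induction l) (auto simp: fold_append)
  moreover have "prim (\<lambda>x. fold (\<lambda>y z. if fst y = f x then Some (snd y) else z) (rev (l x)) None)"
    by (intro pr assms prim_comp[OF assms(2)])
  ultimately show ?thesis by simp
qed

section \<open>A structured tape language and its compilation to Turing machines\<close>

datatype com =
    Move nat int
  | Write nat nat
  | Then com com (infixr \<open>;;\<close> 60)
  | Loop nat nat com
  | Branch nat nat com com

definition cur :: "(nat \<Rightarrow> int \<times> tape) \<Rightarrow> nat \<Rightarrow> nat" where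
  "cur g j = snd (g j) (fst (g j))"

text \<open>An execution is a finite derivation, so induction along it also proves termination of
  the compiled code. The never-ending loop of the event machine has no execution and is treated one
  round at a time.\<close>

inductive exec :: "com \<Rightarrow> (nat \<Rightarrow> int \<times> tape) \<Rightarrow> (nat \<Rightarrow> int \<times> tape) \<Rightarrow> bool" where
  ex_Move: "exec (Move j d) g (g(j := (fst (g j) + d, snd (g j))))"
| ex_Write: "exec (Write j w) g (g(j := (fst (g j), (snd (g j))(fst (g j) := w))))"
| ex_Then: "exec c g g' \<Longrightarrow> exec c' g' g'' \<Longrightarrow> exec (c ;; c') g g''"
| ex_LoopF: "cur g j \<noteq> a \<Longrightarrow> exec (Loop j a c) g g"
| ex_LoopT: "cur g j = a \<Longrightarrow> exec c g g' \<Longrightarrow> exec (Loop j a c) g' g'' \<Longrightarrow> exec (Loop j a c) g g''"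
| ex_BranchT: "cur g j = a \<Longrightarrow> exec c g g' \<Longrightarrow> exec (Branch j a c c') g g'"
| ex_BranchF: "cur g j \<noteq> a \<Longrightarrow> exec c' g g' \<Longrightarrow> exec (Branch j a c c') g g'"

primrec wfc :: "nat \<Rightarrow> com \<Rightarrow> bool" where
  "wfc k (Move j d) \<longleftrightarrow> j < k \<and> d \<in> {-1, 0, 1}"
| "wfc k (Write j w) \<longleftrightarrow> j < k \<and> w < 4"
| "wfc k (c ;; c') \<longleftrightarrow> wfc k c \<and> wfc k c'"
| "wfc k (Loop j a c) \<longleftrightarrow> j < k \<and> wfc k c"
| "wfc k (Branch j a c c') \<longleftrightarrow> j < k \<and> wfc k c \<and> wfc k c'"

lemma wfc_mono: "wfc k c \<Longrightarrow> k \<le> k' \<Longrightarrow> wfc k' c"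
  by (induction c) auto

primrec len :: "com \<Rightarrow> nat" where
  "len (Move j d) = 1"
| "len (Write j w) = 1"
| "len (c ;; c') = len c + len c'"
| "len (Loop j a c) = len c + 2"
| "len (Branch j a c c') = len c + len c' + 2"

text \<open>An instruction matches one exact tuple of scanned symbols, so a state needs a row for
  each tuple over the alphabet: 0 is the blank, 1 and 2 are the bits, 3 marks cell 0 of a register
  tape.\<close>

definition state_rows :: "nat \<Rightarrow> nat \<Rightarrow> (nat list \<Rightarrow> nat \<times> (nat \<times> int) list) \<Rightarrow> tm_table" where
  "state_rows k b F = map (\<lambda>as. ((b, as), F as)) (List.n_lists k [0..<4])"

definition goto :: "nat \<Rightarrow> nat \<Rightarrow> nat list \<Rightarrow> nat \<times> (nat \<times> int) list" where
  "goto k q as = (q, map (\<lambda>i. (as ! i, 0)) [0..<k])"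

text \<open>States are addresses: the code of \<open>c\<close> occupies \<open>b\<close> up to
  \<open>b + len c\<close> and leaves to \<open>b + len c\<close>, so that sequencing is
  concatenation. \<open>Loop\<close> and \<open>Branch\<close> spend one state on the test and one
  on a jump, back to the test or over the alternative.\<close>

primrec compile :: "nat \<Rightarrow> com \<Rightarrow> nat \<Rightarrow> tm_table" where
  "compile k (Move j d) b =
     state_rows k b (\<lambda>as. (b + 1, map (\<lambda>i. (as ! i, if i = j then d else 0)) [0..<k]))"
| "compile k (Write j w) b =
     state_rows k b (\<lambda>as. (b + 1, map (\<lambda>i. (if i = j then w else as ! i, 0)) [0..<k]))"
| "compile k (c ;; c') b = compile k c b @ compile k c' (b + len c)"
| "compile k (Loop j a c) b =
     state_rows k b (\<lambda>as. goto k (if as ! j = a then b + 1 else b + len c + 2) as) @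
     compile k c (b + 1) @ state_rows k (b + 1 + len c) (goto k b)"
| "compile k (Branch j a c c') b =
     state_rows k b (\<lambda>as. goto k (if as ! j = a then b + 1 else b + len c + 2) as) @
     compile k c (b + 1) @ state_rows k (b + 1 + len c) (goto k (b + len c + len c' + 2)) @
     compile k c' (b + len c + 2)"

lemma compile_states: "e \<in> set (compile k c b) \<Longrightarrow> b \<le> fst (fst e) \<and> fst (fst e) < b + len c"
proof (induction c arbitrary: b)
  case (Then c c')
  show ?case using Then.prems Then.IH(1)[of b] Then.IH(2)[of "b + len c"] by auto
next
  case (Loop j a c)
  show ?case using Loop.prems Loop.IH[of "b + 1"] by (auto simp: state_rows_def)
next
  case (Branch j a c c')
  show ?case using Branch.prems Branch.IH(1)[of "b + 1"] Branch.IH(2)[of "b + len c + 2"]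
    by (auto simp: state_rows_def)
qed (auto simp: state_rows_def)

lemma compile_None: "q < b \<or> b + len c \<le> q \<Longrightarrow> map_of (compile k c b) (q, as) = None"
  using compile_states[of _ k c b] by (fastforce simp: map_of_eq_None_iff)

lemma state_rows_None: "q \<noteq> b \<Longrightarrow> map_of (state_rows k b F) (q, as) = None"
  by (auto simp: map_of_eq_None_iff state_rows_def)

lemma state_rows_Some:
  assumes "length as = k" "set as \<subseteq> {..<4}"
  shows "map_of (state_rows k b F) (b, as) = Some (F as)"
proof -
  have "as \<in> set l \<Longrightarrow> map_of (map (\<lambda>as. ((b, as), F as)) l) (b, as) = Some (F as)" for l
    by (induction l) auto
  moreover have "as \<in> set (List.n_lists k [0..<4])" using assms by (auto simp: set_n_lists)
  ultimately show ?thesis unfolding state_rows_def by blast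
qed

text \<open>Agreement is required only on the states of the block, so that correctness applies to
  code sitting anywhere inside a larger table.\<close>

definition holds_at :: "tm \<Rightarrow> nat \<Rightarrow> com \<Rightarrow> nat \<Rightarrow> bool" where
  "holds_at M k c b \<longleftrightarrow>
     (\<forall>q as. b \<le> q \<and> q < b + len c \<longrightarrow> map_of (snd M) (q, as) = map_of (compile k c b) (q, as))"

lemma holds_at_Then:
  assumes "holds_at M k (c ;; c') b"
  shows "holds_at M k c b" "holds_at M k c' (b + len c)"
  using assms by (auto simp: holds_at_def map_add_def compile_None split: option.splits)

lemma holds_at_Loop:
  assumes "holds_at M k (Loop j a c) b"
  shows "holds_at M k c (b + 1)"
    and "length as = k \<Longrightarrow> set as \<subseteq> {..<4} \<Longrightarrow>
      map_of (snd M) (b, as) = Some (goto k (if as ! j = a then b + 1 else b + len c + 2) as)"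
    and "length as = k \<Longrightarrow> set as \<subseteq> {..<4} \<Longrightarrow>
      map_of (snd M) (b + 1 + len c, as) = Some (goto k b as)"
  using assms
  by (auto simp: holds_at_def map_add_def compile_None state_rows_None state_rows_Some split: option.splits)

lemma holds_at_Branch:
  assumes "holds_at M k (Branch j a c c') b"
  shows "holds_at M k c (b + 1)" "holds_at M k c' (b + len c + 2)"
    and "length as = k \<Longrightarrow> set as \<subseteq> {..<4} \<Longrightarrow>
      map_of (snd M) (b, as) = Some (goto k (if as ! j = a then b + 1 else b + len c + 2) as)"
    and "length as = k \<Longrightarrow> set as \<subseteq> {..<4} \<Longrightarrow>
      map_of (snd M) (b + 1 + len c, as) = Some (goto k (b + len c + len c' + 2) as)"
  using assms
  by (auto simp: holds_at_def map_add_def compile_None state_rows_None state_rows_Some split: option.splits)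

text \<open>Besides the final configuration, the states passed before it are controlled. The event
  machine depends on this: one has to know that its event state is avoided elsewhere in a
  round.\<close>

definition reach :: "tm \<Rightarrow> nat set \<Rightarrow> config \<Rightarrow> config \<Rightarrow> bool" where
  "reach M Q c c' \<longleftrightarrow> (\<exists>t. tm_run M t c = c' \<and> (\<forall>s<t. fst (tm_run M s c) \<in> Q))"

lemma tm_run_add: "tm_run M (s + t) c = tm_run M t (tm_run M s c)"
  by (simp add: tm_run_def funpow_add add.commute[of s t])

lemma tm_run_0 [simp]: "tm_run M 0 c = c"
  by (simp add: tm_run_def)

lemma tm_run_Suc: "tm_run M (Suc t) c = tm_step M (tm_run M t c)"
  by (simp add: tm_run_def)

lemma reach_trans:
  assumes "reach M Q c c'" "reach M Q c' c''"
  shows "reach M Q c c''"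
proof -
  obtain s where s: "tm_run M s c = c'" "\<forall>i<s. fst (tm_run M i c) \<in> Q"
    using assms(1) unfolding reach_def by blast
  obtain t where t: "tm_run M t c' = c''" "\<forall>i<t. fst (tm_run M i c') \<in> Q"
    using assms(2) unfolding reach_def by blast
  have "fst (tm_run M i c) \<in> Q" if "i < s + t" for i
  proof (cases "i < s")
    case False
    then have "tm_run M i c = tm_run M (i - s) c'" using s(1) tm_run_add[of M s "i - s" c] by simp
    then show ?thesis using t(2) that False by simp
  qed (use s in blast)
  then show ?thesis unfolding reach_def using s(1) t(1) tm_run_add by metis
qed

lemma reach_mono: "reach M Q c c' \<Longrightarrow> Q \<subseteq> Q' \<Longrightarrow> reach M Q' c c'"
  unfolding reach_def by blast

lemma reach_step: "fst c \<in> Q \<Longrightarrow> tm_step M c = c' \<Longrightarrow> reach M Q c c'"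
  unfolding reach_def by (intro exI[of _ 1]) (simp add: tm_run_def)

definition syms :: "nat \<Rightarrow> (nat \<Rightarrow> int \<times> tape) \<Rightarrow> bool" where
  "syms k g \<longleftrightarrow> (\<forall>i<k. \<forall>p. snd (g i) p < 4)"

lemma tm_step_map:
  assumes "map_of (snd M) (q, map (cur g) [0..<k]) = Some (q', map act [0..<k])"
  shows "tm_step M (q, map g [0..<k]) =
    (q', map (\<lambda>i. (fst (g i) + snd (act i), (snd (g i))(fst (g i) := fst (act i)))) [0..<k])"
proof -
  have "map (\<lambda>(h, t). t h) (map g [0..<k]) = map (cur g) [0..<k]"
    by (simp add: cur_def case_prod_unfold)
  then have "tm_lookup M (q, map g [0..<k]) = Some (q', map act [0..<k])"
    using assms by (simp only: tm_lookup_def fst_conv snd_conv)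
  then have "tm_step M (q, map g [0..<k]) =
      (q', map2 (\<lambda>(w, d) (h, t). (h + d, t(h := w))) (map act [0..<k]) (map g [0..<k]))"
    by (simp add: tm_step_def)
  also have "map2 (\<lambda>(w, d) (h, t). (h + d, t(h := w))) (map act [0..<k]) (map g [0..<k]) =
      map (\<lambda>i. (fst (g i) + snd (act i), (snd (g i))(fst (g i) := fst (act i)))) [0..<k]"
    by (rule nth_equalityI) (auto simp: case_prod_unfold)
  finally show ?thesis .
qed

lemma tm_step_goto:
  assumes "map_of (snd M) (q, map (cur g) [0..<k]) = Some (goto k q' (map (cur g) [0..<k]))"
  shows "tm_step M (q, map g [0..<k]) = (q', map g [0..<k])"
proof -
  have "goto k q' (map (cur g) [0..<k]) = (q', map (\<lambda>i. (cur g i, 0)) [0..<k])"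
    by (simp add: goto_def)
  from tm_step_map[OF assms[unfolded this]] show ?thesis by (simp add: cur_def)
qed

text \<open>Induction along the execution. The invariant \<open>syms\<close> guarantees a matching
  row for whatever is scanned; it persists because \<open>wfc\<close> restricts writing to symbols
  below 4.\<close>

lemma compile_correct:
  assumes "exec c g g'" "wfc k c" "syms k g" "holds_at M k c b"
  shows "syms k g' \<and> reach M {b..<b + len c} (b, map g [0..<k]) (b + len c, map g' [0..<k])"
  using assms
proof (induction arbitrary: b rule: exec.induct)
  case (ex_Move j d g)
  have s: "set (map (cur g) [0..<k]) \<subseteq> {..<4}" using ex_Move.prems by (auto simp: cur_def syms_def)
  have "map_of (snd M) (b, map (cur g) [0..<k]) =
      Some (b + 1, map (\<lambda>i. (cur g i, if i = j then d else 0)) [0..<k])"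
    using ex_Move.prems(3) by (simp add: holds_at_def state_rows_Some[OF _ s])
  from tm_step_map[OF this] have "tm_step M (b, map g [0..<k]) =
      (b + 1, map (g(j := (fst (g j) + d, snd (g j)))) [0..<k])"
    by (auto simp: cur_def)
  then show ?case using ex_Move.prems by (auto intro!: reach_step simp: syms_def)
next
  case (ex_Write j w g)
  have s: "set (map (cur g) [0..<k]) \<subseteq> {..<4}" using ex_Write.prems by (auto simp: cur_def syms_def)
  have "map_of (snd M) (b, map (cur g) [0..<k]) =
      Some (b + 1, map (\<lambda>i. (if i = j then w else cur g i, 0)) [0..<k])"
    using ex_Write.prems(3) by (simp add: holds_at_def state_rows_Some[OF _ s] cong: if_cong)
  from tm_step_map[OF this] have "tm_step M (b, map g [0..<k]) =
      (b + 1, map (g(j := (fst (g j), (snd (g j))(fst (g j) := w)))) [0..<k])"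
    by (auto simp: cur_def)
  then show ?case using ex_Write.prems by (auto intro!: reach_step simp: syms_def)
next
  case (ex_Then c g g' c' g'')
  note h = holds_at_Then[OF ex_Then.prems(3)]
  from ex_Then.IH(1)[of b] ex_Then.prems h have 1: "syms k g'"
    "reach M {b..<b + len c} (b, map g [0..<k]) (b + len c, map g' [0..<k])" by auto
  from ex_Then.IH(2)[of "b + len c"] ex_Then.prems h 1 have 2: "syms k g''"
    "reach M {b + len c..<b + len c + len c'} (b + len c, map g' [0..<k]) (b + len c + len c', map g'' [0..<k])"
    by auto
  have "reach M {b..<b + len c + len c'} (b, map g [0..<k]) (b + len c + len c', map g'' [0..<k])"
    by (rule reach_trans[OF reach_mono[OF 1(2)] reach_mono[OF 2(2)]]) auto
  then show ?case using 2 by (simp add: add.assoc)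
next
  case (ex_LoopF g j a c)
  have s: "set (map (cur g) [0..<k]) \<subseteq> {..<4}" using ex_LoopF.prems by (auto simp: cur_def syms_def)
  have "map_of (snd M) (b, map (cur g) [0..<k]) = Some (goto k (b + len c + 2) (map (cur g) [0..<k]))"
    using holds_at_Loop(2)[OF ex_LoopF.prems(3) _ s] ex_LoopF by simp
  from tm_step_goto[OF this] show ?case using ex_LoopF.prems by (auto intro!: reach_step)
next
  case (ex_LoopT g j a c g' g'')
  have s: "set (map (cur g) [0..<k]) \<subseteq> {..<4}" using ex_LoopT.prems by (auto simp: cur_def syms_def)
  have "map_of (snd M) (b, map (cur g) [0..<k]) = Some (goto k (b + 1) (map (cur g) [0..<k]))"
    using holds_at_Loop(2)[OF ex_LoopT.prems(3) _ s] ex_LoopT by simp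
  from tm_step_goto[OF this] have 0: "tm_step M (b, map g [0..<k]) = (b + 1, map g [0..<k])" .
  from ex_LoopT.IH(1)[of "b + 1"] ex_LoopT.prems holds_at_Loop(1)[OF ex_LoopT.prems(3)]
  have 1: "syms k g'"
    "reach M {b + 1..<b + 1 + len c} (b + 1, map g [0..<k]) (b + 1 + len c, map g' [0..<k])" by auto
  have s': "set (map (cur g') [0..<k]) \<subseteq> {..<4}" using 1 by (auto simp: cur_def syms_def)
  have "map_of (snd M) (b + 1 + len c, map (cur g') [0..<k]) = Some (goto k b (map (cur g') [0..<k]))"
    using holds_at_Loop(3)[OF ex_LoopT.prems(3) _ s'] by simp
  from tm_step_goto[OF this]
  have 2: "tm_step M (b + 1 + len c, map g' [0..<k]) = (b, map g' [0..<k])" .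
  let ?Q = "{b..<b + len (Loop j a c)}"
  from ex_LoopT.IH(2)[of b] ex_LoopT.prems 1
  have 3: "syms k g''" "reach M ?Q (b, map g' [0..<k]) (b + len (Loop j a c), map g'' [0..<k])" by auto
  have "reach M ?Q (b, map g [0..<k]) (b + 1, map g [0..<k])" by (rule reach_step[OF _ 0]) auto
  also have "reach M ?Q (b + 1, map g [0..<k]) (b + 1 + len c, map g' [0..<k])"
    by (rule reach_mono[OF 1(2)]) auto
  also (reach_trans) have "reach M ?Q (b + 1 + len c, map g' [0..<k]) (b, map g' [0..<k])"
    by (rule reach_step[OF _ 2]) auto
  also (reach_trans) note 3(2)
  finally (reach_trans) show ?case using 3 by simp
next
  case (ex_BranchT g j a c g' c')
  have s: "set (map (cur g) [0..<k]) \<subseteq> {..<4}" using ex_BranchT.prems by (auto simp: cur_def syms_def)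
  have "map_of (snd M) (b, map (cur g) [0..<k]) = Some (goto k (b + 1) (map (cur g) [0..<k]))"
    using holds_at_Branch(3)[OF ex_BranchT.prems(3) _ s] ex_BranchT by simp
  from tm_step_goto[OF this] have 0: "tm_step M (b, map g [0..<k]) = (b + 1, map g [0..<k])" .
  from ex_BranchT.IH[of "b + 1"] ex_BranchT.prems holds_at_Branch(1)[OF ex_BranchT.prems(3)]
  have 1: "syms k g'"
    "reach M {b + 1..<b + 1 + len c} (b + 1, map g [0..<k]) (b + 1 + len c, map g' [0..<k])" by auto
  have s': "set (map (cur g') [0..<k]) \<subseteq> {..<4}" using 1 by (auto simp: cur_def syms_def)
  have "map_of (snd M) (b + 1 + len c, map (cur g') [0..<k]) =
      Some (goto k (b + len c + len c' + 2) (map (cur g') [0..<k]))"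
    using holds_at_Branch(4)[OF ex_BranchT.prems(3) _ s'] by simp
  from tm_step_goto[OF this] have 2: "tm_step M (b + 1 + len c, map g' [0..<k]) =
      (b + len c + len c' + 2, map g' [0..<k])" .
  let ?Q = "{b..<b + len (Branch j a c c')}"
  have "reach M ?Q (b, map g [0..<k]) (b + 1, map g [0..<k])" by (rule reach_step[OF _ 0]) auto
  also have "reach M ?Q (b + 1, map g [0..<k]) (b + 1 + len c, map g' [0..<k])"
    by (rule reach_mono[OF 1(2)]) auto
  also (reach_trans) have "reach M ?Q (b + 1 + len c, map g' [0..<k]) (b + len c + len c' + 2, map g' [0..<k])"
    by (rule reach_step[OF _ 2]) auto
  finally (reach_trans) show ?case using 1 by (simp add: add.assoc)
next
  case (ex_BranchF g j a c' g' c)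
  have s: "set (map (cur g) [0..<k]) \<subseteq> {..<4}" using ex_BranchF.prems by (auto simp: cur_def syms_def)
  have "map_of (snd M) (b, map (cur g) [0..<k]) = Some (goto k (b + len c + 2) (map (cur g) [0..<k]))"
    using holds_at_Branch(3)[OF ex_BranchF.prems(3) _ s] ex_BranchF by simp
  from tm_step_goto[OF this]
  have 0: "tm_step M (b, map g [0..<k]) = (b + len c + 2, map g [0..<k])" .
  from ex_BranchF.IH[of "b + len c + 2"] ex_BranchF.prems holds_at_Branch(2)[OF ex_BranchF.prems(3)]
  have 1: "syms k g'"
    "reach M {b + len c + 2..<b + len c + 2 + len c'} (b + len c + 2, map g [0..<k])
      (b + len c + 2 + len c', map g' [0..<k])" by auto
  let ?Q = "{b..<b + len (Branch j a c c')}"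
  have "reach M ?Q (b, map g [0..<k]) (b + len c + 2, map g [0..<k])"
    by (rule reach_step[OF _ 0]) auto
  also have "reach M ?Q (b + len c + 2, map g [0..<k]) (b + len c + 2 + len c', map g' [0..<k])"
    by (rule reach_mono[OF 1(2)]) auto
  finally (reach_trans) show ?case using 1 by (simp add: algebra_simps)
qed

lemma holds_at_compile: "holds_at (k, compile k c b) k c b"
  by (simp add: holds_at_def)

lemma compile_entry:
  "e \<in> set (compile k c b) \<Longrightarrow> wfc k c \<Longrightarrow> length (snd (fst e)) = k \<and>
    length (snd (snd e)) = k \<and> snd ` set (snd (snd e)) \<subseteq> {-1, 0, 1}"
  by (induction c arbitrary: b) (auto simp: state_rows_def goto_def set_n_lists image_image split: if_splits)

lemma tm_wf_compile: "wfc k c \<Longrightarrow> tm_wf (k, compile k c b)"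
  unfolding tm_wf_def using compile_entry[of _ k c b] by fastforce

definition shift :: "nat \<Rightarrow> (nat \<times> nat list) \<times> nat \<times> (nat \<times> int) list \<Rightarrow>
    (nat \<times> nat list) \<times> nat \<times> (nat \<times> int) list" where
  "shift d e = ((fst (fst e) + d, snd (fst e)), fst (snd e) + d, snd (snd e))"

lemma state_rows_shift: "state_rows k (b + d) F' = map (shift d) (state_rows k b F)"
  if "\<And>as. F' as = (fst (F as) + d, snd (F as))"
  using that by (simp add: state_rows_def shift_def)

lemma compile_shift: "compile k c (b + d) = map (shift d) (compile k c b)"
proof (induction c arbitrary: b)
  case (Move j w)
  show ?case unfolding compile.simps by (rule state_rows_shift) simp
next
  case (Write j w)
  show ?case unfolding compile.simps by (rule state_rows_shift) simp
next
  case (Then c c')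
  have "b + d + len c = b + len c + d" by simp
  then show ?case using Then.IH by (simp only: compile.simps map_append)
next
  case (Loop j a c)
  have e: "b + d + 1 = b + 1 + d" "b + 1 + d + len c = b + 1 + len c + d" by simp_all
  show ?case unfolding compile.simps map_append e Loop.IH
    by (intro arg_cong2[of _ _ _ _ append] refl state_rows_shift) (simp_all add: goto_def)
next
  case (Branch j a c c')
  have e: "b + d + 1 = b + 1 + d" "b + 1 + d + len c = b + 1 + len c + d"
    "b + d + len c + 2 = b + len c + 2 + d" by simp_all
  show ?case unfolding compile.simps map_append e Branch.IH
    by (intro arg_cong2[of _ _ _ _ append] refl state_rows_shift) (simp_all add: goto_def)
qed

text \<open>The head position on tape 2 is the value of register 0, so \<open>z\<close> moves store
  the parameter. This is the only place where the program depends on \<open>z\<close>.\<close>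

primrec repeated_move :: "nat \<Rightarrow> com \<Rightarrow> com" where
  "repeated_move 0 c = c"
| "repeated_move (Suc z) c = Move 2 1 ;; repeated_move z c"

text \<open>An explicit s-m-n theorem: the shifted tables are constants and only the number of
  copies and the shifts depend on \<open>z\<close>. Each move has length 1, hence the offset
  \<open>b + i\<close>.\<close>

lemma compile_repeated_move:
  "compile k (repeated_move z c) b =
    concat (map (\<lambda>i. map (shift (b + i)) (compile k (Move 2 1) 0)) [0..<z]) @
    map (shift (b + z)) (compile k c 0)"
proof (induction z arbitrary: b)
  case 0
  show ?case using compile_shift[of k c 0 b] by simp
next
  case (Suc z)
  have "compile k (Move 2 1) b = map (shift b) (compile k (Move 2 1) 0)"
    using compile_shift[of k "Move 2 1" 0 b] by simp
  with Suc.IH[of "Suc b"] show ?case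
    by (simp add: upt_conv_Cons map_Suc_upt[symmetric] comp_def del: upt.simps compile.simps(1))
qed

lemma prim_shift [pr]: "prim f \<Longrightarrow> prim g \<Longrightarrow> prim (\<lambda>x. shift (f x) (g x))"
  unfolding shift_def by (intro pr)

lemma prim_compile_repeated_move [pr]:
  assumes "prim f" shows "prim (\<lambda>x. compile k (c ;; repeated_move (f x) c') 0)"
  unfolding compile_repeated_move compile.simps(3) by (intro pr assms prim_comp[OF assms])

text \<open>Both codings are assembled from the same pairing, list and integer codes, so
  \<open>enc\<close> of a machine is an index of it.\<close>

lemma tm_decode_enc: "tm_decode (enc M) = M"
proof -
  have n: "map enc xs = xs" for xs :: "nat list" by (induction xs) auto
  have a: "act_decode (enc a) = a" for a
    by (simp add: act_decode_def enc_prod_def enc_int_def)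
  have i: "instr_decode (enc i) = i" for i
    by (simp add: instr_decode_def prod_decode_enc enc_list_def a n comp_def)
  show ?thesis
    by (simp add: tm_decode_def prod_decode_enc enc_list_def i comp_def)
qed

lemma enc_tm_decode: "enc (tm_decode n) = n"
  by (metis tm_decode_enc enc_dcd)

section \<open>Register programs\<close>

text \<open>The value of a register is the head position on a tape whose only symbol marks cell 0.\<close>

definition reg :: "nat \<Rightarrow> int \<times> tape" where
  "reg n = (int n, \<lambda>i. if i = 0 then 3 else 0)"

definition rstate :: "int \<times> tape \<Rightarrow> int \<times> tape \<Rightarrow> (nat \<Rightarrow> nat) \<Rightarrow> nat \<Rightarrow> int \<times> tape" where
  "rstate io orc v i = (if i = 0 then io else if i = 1 then orc else reg (v (i - 2)))"

abbreviation inc :: "nat \<Rightarrow> com" where "inc r \<equiv> Move (r + 2) 1"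
abbreviation decr :: "nat \<Rightarrow> com" where "decr r \<equiv> Move (r + 2) (-1)"
text \<open>Only cell 0 of a register tape is marked, so scanning a blank means that the register is
  nonzero.\<close>

abbreviation loop :: "nat \<Rightarrow> com \<Rightarrow> com" where "loop r c \<equiv> Loop (r + 2) 0 c"

lemma exec_Move': "g' = g(j := (fst (g j) + d, snd (g j))) \<Longrightarrow> exec (Move j d) g g'"
  by (simp add: ex_Move)

lemma exec_Write': "g' = g(j := (fst (g j), (snd (g j))(fst (g j) := w))) \<Longrightarrow> exec (Write j w) g g'"
  by (simp add: ex_Write)

lemma exec_inc: "exec (inc r) (rstate io orc v) (rstate io orc (v(r := Suc (v r))))"
  by (rule exec_Move') (auto simp: fun_eq_iff rstate_def reg_def)

lemma exec_decr: "v r = Suc n \<Longrightarrow> exec (decr r) (rstate io orc v) (rstate io orc (v(r := n)))"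
  by (rule exec_Move') (auto simp: fun_eq_iff rstate_def reg_def)

lemma cur_rstate: "cur (rstate io orc v) (r + 2) = (if v r = 0 then 3 else 0)"
  by (simp add: cur_def rstate_def reg_def)

text \<open>\<open>G n\<close> is the state in which \<open>n\<close> rounds remain. A loop is thus
  verified by writing down its state as a function of the remaining rounds.\<close>

lemma exec_Loop:
  assumes "\<And>n. n < m \<Longrightarrow> exec c (G (Suc n)) (G n)" "\<And>n. n < m \<Longrightarrow> cur (G (Suc n)) j = a" "cur (G 0) j \<noteq> a"
  shows "exec (Loop j a c) (G m) (G 0)"
  using assms(1,2)
proof (induction m)
  case 0
  show ?case by (rule ex_LoopF) (rule assms)
next
  case (Suc m)
  show ?case by (rule ex_LoopT[of _ _ _ _ "G m"]) (use Suc in auto)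
qed

definition rexec :: "com \<Rightarrow> (nat \<Rightarrow> nat) \<Rightarrow> (nat \<Rightarrow> nat) \<Rightarrow> bool" where
  "rexec c v v' \<longleftrightarrow> (\<forall>io orc. exec c (rstate io orc v) (rstate io orc v'))"

lemma rexec_eq: "rexec c v v' \<Longrightarrow> v' = v'' \<Longrightarrow> rexec c v v''"
  by simp

lemma rexec_Then: "rexec c v v' \<Longrightarrow> rexec c' v' v'' \<Longrightarrow> rexec (c ;; c') v v''"
  unfolding rexec_def by (blast intro: ex_Then)

lemma rexec_inc: "rexec (inc r) v (v(r := Suc (v r)))"
  unfolding rexec_def using exec_inc by blast

lemma rexec_decr: "v r = Suc n \<Longrightarrow> rexec (decr r) v (v(r := n))"
  unfolding rexec_def using exec_decr by blast

lemma rexec_loop: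
  assumes "\<And>n. n < m \<Longrightarrow> rexec c (V (Suc n)) (V n)" "\<And>n. V n r = n"
  shows "rexec (loop r c) (V m) (V 0)"
  unfolding rexec_def
proof (intro allI)
  fix io orc
  show "exec (loop r c) (rstate io orc (V m)) (rstate io orc (V 0))"
  proof (rule exec_Loop[of m c "\<lambda>n. rstate io orc (V n)"])
    show "exec c (rstate io orc (V (Suc n))) (rstate io orc (V n))" if "n < m" for n
      using assms(1)[OF that] unfolding rexec_def by blast
  qed (simp_all only: cur_rstate assms(2), simp_all)
qed

definition clear :: "nat \<Rightarrow> com" where "clear r = loop r (decr r)"

lemma rexec_clear: "rexec (clear r) v (v(r := 0))"
proof -
  have "rexec (loop r (decr r)) (v(r := v r)) (v(r := 0))"
  proof (rule rexec_loop[where V = "\<lambda>n. v(r := n)"])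
    show "rexec (decr r) (v(r := Suc n)) (v(r := n))" for n
      by (rule rexec_eq[OF rexec_decr[of _ _ n]]) simp_all
  qed simp
  then show ?thesis by (simp add: clear_def)
qed

text \<open>A register can be read only by draining it. Copying is therefore done by draining into
  two registers and then pouring one of them back with \<open>addto\<close>.\<close>

definition addto2 :: "nat \<Rightarrow> nat \<Rightarrow> nat \<Rightarrow> com" where
  "addto2 a b c = loop a (decr a ;; inc b ;; inc c)"

lemma rexec_addto2:
  assumes "a \<noteq> b" "a \<noteq> c" "b \<noteq> c"
  shows "rexec (addto2 a b c) v (v(a := 0, b := v b + v a, c := v c + v a))"
proof -
  let ?V = "\<lambda>n. v(a := n, b := v b + (v a - n), c := v c + (v a - n))"
  have "rexec (loop a (decr a ;; inc b ;; inc c)) (?V (v a)) (?V 0)"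
  proof (rule rexec_loop)
    fix n assume n: "n < v a"
    show "rexec (decr a ;; inc b ;; inc c) (?V (Suc n)) (?V n)"
      by (rule rexec_Then[OF rexec_decr[of _ _ n] rexec_Then[OF rexec_inc rexec_eq[OF rexec_inc]]])
        (use n assms in \<open>auto simp: fun_eq_iff\<close>)
  qed (use assms in auto)
  then show ?thesis using assms by (simp add: addto2_def)
qed

definition addto :: "nat \<Rightarrow> nat \<Rightarrow> com" where
  "addto a b = loop a (decr a ;; inc b)"

lemma rexec_addto:
  assumes "a \<noteq> b"
  shows "rexec (addto a b) v (v(a := 0, b := v b + v a))"
proof -
  let ?V = "\<lambda>n. v(a := n, b := v b + (v a - n))"
  have "rexec (loop a (decr a ;; inc b)) (?V (v a)) (?V 0)"
  proof (rule rexec_loop)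
    fix n assume n: "n < v a"
    show "rexec (decr a ;; inc b) (?V (Suc n)) (?V n)"
      by (rule rexec_Then[OF rexec_decr[of _ _ n] rexec_eq[OF rexec_inc]])
        (use n assms in \<open>auto simp: fun_eq_iff\<close>)
  qed (use assms in auto)
  then show ?thesis using assms by (simp add: addto_def)
qed

text \<open>The pairing runs through each diagonal \<open>m + n = s\<close> by increasing first
  component and then enters the next diagonal.\<close>

lemma prod_decode_Suc:
  "prod_decode (Suc x) = (case prod_decode x of (m, 0) \<Rightarrow> (0, Suc m) | (m, Suc n) \<Rightarrow> (Suc m, n))"
proof -
  obtain m n where p: "prod_decode x = (m, n)" by force
  then have x: "x = prod_encode (m, n)" by (metis prod_decode_inverse)
  have "Suc x = prod_encode (case n of 0 \<Rightarrow> (0, Suc m) | Suc n \<Rightarrow> (Suc m, n))"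
    by (cases n) (simp_all add: x prod_encode_def)
  then show ?thesis by (cases n) (simp_all add: p)
qed

definition nextpair :: "nat \<Rightarrow> nat \<Rightarrow> com" where
  "nextpair b c = Branch (c + 2) 0 (decr c ;; inc b) (addto b c ;; inc c)"

lemma rexec_nextpair:
  assumes "b \<noteq> c" "v b = fst (prod_decode x)" "v c = snd (prod_decode x)"
  shows "rexec (nextpair b c) v (v(b := fst (prod_decode (Suc x)), c := snd (prod_decode (Suc x))))"
proof (cases "v c")
  case 0
  have "rexec (addto b c ;; inc c) v (v(b := 0, c := Suc (v b)))"
    by (rule rexec_eq[OF rexec_Then[OF rexec_addto rexec_inc]]) (use assms 0 in auto)
  moreover have "cur (rstate io orc v) (c + 2) \<noteq> 0" for io orc using 0 by (simp only: cur_rstate) simp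
  moreover have "v(b := fst (prod_decode (Suc x)), c := snd (prod_decode (Suc x))) = v(b := 0, c := Suc (v b))"
    using assms 0 by (simp add: prod_decode_Suc case_prod_unfold)
  ultimately show ?thesis unfolding nextpair_def rexec_def by (simp only:) (blast intro: ex_BranchF)
next
  case (Suc n)
  have "rexec (decr c ;; inc b) v (v(b := Suc (v b), c := n))"
    by (rule rexec_eq[OF rexec_Then[OF rexec_decr[of v c n] rexec_inc]])
      (use assms Suc in \<open>auto simp: fun_eq_iff\<close>)
  moreover have "cur (rstate io orc v) (c + 2) = 0" for io orc using Suc by (simp only: cur_rstate) simp
  moreover have "v(b := fst (prod_decode (Suc x)), c := snd (prod_decode (Suc x))) = v(b := Suc (v b), c := n)"
    using assms(2) trans[OF assms(3)[symmetric] Suc] by (simp add: prod_decode_Suc case_prod_unfold)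
  ultimately show ?thesis unfolding nextpair_def rexec_def by (simp only:) (blast intro: ex_BranchT)
qed

text \<open>Decoding without arithmetic: the enumeration of pairs is followed from
  \<open>(0, 0)\<close> for as many steps as the code indicates.\<close>

definition unpair :: "nat \<Rightarrow> com" where
  "unpair a = loop a (decr a ;; nextpair (a + 1) (a + 2))"

lemma rexec_unpair:
  assumes "v (a + 1) = 0" "v (a + 2) = 0"
  shows "rexec (unpair a) v
    (v(a := 0, a + 1 := fst (prod_decode (v a)), a + 2 := snd (prod_decode (v a))))"
proof -
  let ?V = "\<lambda>n. v(a := n, a + 1 := fst (prod_decode (v a - n)), a + 2 := snd (prod_decode (v a - n)))"
  have "rexec (loop a (decr a ;; nextpair (a + 1) (a + 2))) (?V (v a)) (?V 0)"
  proof (rule rexec_loop)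
    fix n assume n: "n < v a"
    then have s: "v a - n = Suc (v a - Suc n)" by simp
    show "rexec (decr a ;; nextpair (a + 1) (a + 2)) (?V (Suc n)) (?V n)"
      unfolding s by (rule rexec_Then[OF rexec_decr[of _ _ n]
          rexec_eq[OF rexec_nextpair[of _ _ _ "v a - Suc n"]]]) (auto simp: fun_eq_iff)
  qed auto
  moreover have "prod_decode 0 = (0, 0)" by (simp add: prod_decode_def prod_decode_aux.simps)
  then have "?V (v a) = v" using assms by (simp add: fun_eq_iff)
  ultimately show ?thesis by (simp add: unpair_def)
qed

text \<open>The code of \<open>(b, c)\<close> is \<open>triangle (b + c) + b\<close>. The first
  command puts \<open>b\<close> into \<open>a\<close> and turns \<open>c\<close> into the sum
  \<open>b + c\<close>; the loop then adds this sum and all smaller positive numbers to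
  \<open>a\<close>, with \<open>b\<close> as temporary storage.\<close>

definition pairup :: "nat \<Rightarrow> nat \<Rightarrow> nat \<Rightarrow> com" where
  "pairup a b c = addto2 b a c ;; loop c (addto2 c a b ;; addto b c ;; decr c)"

lemma triangle_mono: "m \<le> n \<Longrightarrow> triangle m \<le> triangle n"
  by (induction n arbitrary: m) (auto simp: le_Suc_eq intro: trans_le_add1)

lemma rexec_pairup:
  assumes "a \<noteq> b" "a \<noteq> c" "b \<noteq> c" "v a = 0"
  shows "rexec (pairup a b c) v (v(b := 0, c := 0, a := prod_encode (v b, v c)))"
proof -
  let ?s = "v b + v c"
  let ?V = "\<lambda>k. v(b := 0, c := k, a := v b + (triangle ?s - triangle k))"
  have 1: "rexec (addto2 b a c) v (?V ?s)"
    by (rule rexec_eq[OF rexec_addto2]) (use assms in \<open>auto simp: fun_eq_iff\<close>)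
  have 2: "rexec (loop c (addto2 c a b ;; addto b c ;; decr c)) (?V ?s) (?V 0)"
  proof (rule rexec_loop)
    fix n assume n: "n < ?s"
    have t: "triangle n + Suc n \<le> triangle ?s" using triangle_mono[of "Suc n" ?s] n by simp
    show "rexec (addto2 c a b ;; addto b c ;; decr c) (?V (Suc n)) (?V n)"
      by (rule rexec_Then[OF rexec_addto2 rexec_Then[OF rexec_addto rexec_eq[OF rexec_decr[of _ _ n]]]])
        (use t assms in \<open>auto simp: fun_eq_iff\<close>)
  qed (use assms in auto)
  show ?thesis unfolding pairup_def
    by (rule rexec_eq[OF rexec_Then[OF 1 2]]) (auto simp: prod_encode_def add.commute)
qed

text \<open>A stack discipline: the program for address \<open>a\<close> finds its argument in
  register \<open>a\<close> and may use the zero registers above it as scratch, leaving them zero,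
  while those below keep their values. Having a program for each address allows subprograms to be
  run higher up on the stack.\<close>

definition implemented :: "(nat \<Rightarrow> nat) \<Rightarrow> bool" where
  "implemented f \<longleftrightarrow> (\<exists>P m. \<forall>a. wfc (a + m) (P a) \<and>
     (\<forall>v. (\<forall>i>a. v i = 0) \<longrightarrow> rexec (P a) v (v(a := f (v a)))))"

lemmas program_defs = clear_def addto_def addto2_def nextpair_def unpair_def pairup_def

lemma implementedI:
  assumes "\<And>a. wfc (a + m) (P a)" "\<And>a v. \<forall>i>a. v i = 0 \<Longrightarrow> rexec (P a) v (v(a := f (v a)))"
  shows "implemented f"
  unfolding implemented_def by (rule exI[of _ P], rule exI[of _ m]) (use assms in blast)

lemma implemented_zero: "implemented (\<lambda>_. 0)"
proof (rule implementedI)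
  show "wfc (a + 3) (clear a)" for a by (simp add: clear_def)
  show "rexec (clear a) v (v(a := 0))" for a v by (rule rexec_clear)
qed

lemma implemented_Suc: "implemented Suc"
proof (rule implementedI)
  show "wfc (a + 3) (inc a)" for a by simp
  show "rexec (inc a) v (v(a := Suc (v a)))" for a v by (rule rexec_inc)
qed

lemma implemented_id: "implemented (\<lambda>x. x)"
proof (rule implementedI)
  show "wfc (a + 3) (inc a ;; decr a)" for a by simp
  show "rexec (inc a ;; decr a) v (v(a := v a))" for a v
    by (rule rexec_eq[OF rexec_Then[OF rexec_inc rexec_decr[of _ _ "v a"]]]) auto
qed

lemma implemented_fst: "implemented (\<lambda>x. fst (prod_decode x))"
proof (rule implementedI)
  show "wfc (a + 5) (unpair a ;; clear (a + 2) ;; addto (a + 1) a)" for a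
    by (simp add: program_defs)
  show "rexec (unpair a ;; clear (a + 2) ;; addto (a + 1) a) v (v(a := fst (prod_decode (v a))))"
    if "\<forall>i>a. v i = 0" for a v
    by (rule rexec_eq[OF rexec_Then[OF rexec_unpair rexec_Then[OF rexec_clear rexec_addto]]])
      (use that in \<open>auto simp: fun_eq_iff\<close>)
qed

lemma implemented_snd: "implemented (\<lambda>x. snd (prod_decode x))"
proof (rule implementedI)
  show "wfc (a + 5) (unpair a ;; clear (a + 1) ;; addto (a + 2) a)" for a
    by (simp add: program_defs)
  show "rexec (unpair a ;; clear (a + 1) ;; addto (a + 2) a) v (v(a := snd (prod_decode (v a))))"
    if "\<forall>i>a. v i = 0" for a v
    by (rule rexec_eq[OF rexec_Then[OF rexec_unpair rexec_Then[OF rexec_clear rexec_addto]]])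
      (use that in \<open>auto simp: fun_eq_iff\<close>)
qed

lemma implemented_comp:
  assumes "implemented f" "implemented g"
  shows "implemented (\<lambda>x. f (g x))"
proof -
  obtain P m where P: "\<And>a. wfc (a + m) (P a)"
    "\<And>a v. \<forall>i>a. v i = 0 \<Longrightarrow> rexec (P a) v (v(a := f (v a)))"
    using assms(1) unfolding implemented_def by blast
  obtain P' m' where P': "\<And>a. wfc (a + m') (P' a)"
    "\<And>a v. \<forall>i>a. v i = 0 \<Longrightarrow> rexec (P' a) v (v(a := g (v a)))"
    using assms(2) unfolding implemented_def by blast
  show ?thesis
  proof (rule implementedI)
    show "wfc (a + (m + m')) (P' a ;; P a)" for a
      by (auto intro: wfc_mono[OF P(1)[of a]] wfc_mono[OF P'(1)[of a]])
    show "rexec (P' a ;; P a) v (v(a := f (g (v a))))" if "\<forall>i>a. v i = 0" for a v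
      by (rule rexec_eq[OF rexec_Then[OF P'(2) P(2)]]) (use that in auto)
  qed
qed

lemma implemented_pair:
  assumes "implemented f" "implemented g"
  shows "implemented (\<lambda>x. prod_encode (f x, g x))"
proof -
  obtain P m where P: "\<And>a. wfc (a + m) (P a)"
    "\<And>a v. \<forall>i>a. v i = 0 \<Longrightarrow> rexec (P a) v (v(a := f (v a)))"
    using assms(1) unfolding implemented_def by blast
  obtain P' m' where P': "\<And>a. wfc (a + m') (P' a)"
    "\<And>a v. \<forall>i>a. v i = 0 \<Longrightarrow> rexec (P' a) v (v(a := g (v a)))"
    using assms(2) unfolding implemented_def by blast
  \<comment> \<open>The copy for \<open>g\<close> lies on top, where its scratch space is clear. Its
    result is parked in register \<open>a\<close>, below the scratch space of \<open>f\<close>, and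
    fetched back for the pairing.\<close>
  let ?R = "\<lambda>a. addto2 a (a + 1) (a + 2) ;; P' (a + 2) ;; addto (a + 2) a ;; P (a + 1) ;;
    addto a (a + 2) ;; pairup a (a + 1) (a + 2)"
  show ?thesis
  proof (rule implementedI)
    show "wfc (a + (m + m' + 5)) (?R a)" for a
      using wfc_mono[OF P(1)[of "a + 1"], of "a + (m + m' + 5)"]
        wfc_mono[OF P'(1)[of "a + 2"], of "a + (m + m' + 5)"]
      by (simp add: program_defs)
  next
    fix a :: nat and v :: "nat \<Rightarrow> nat" assume z: "\<forall>i>a. v i = 0"
    show "rexec (?R a) v (v(a := prod_encode (f (v a), g (v a))))"
      by (rule rexec_eq[OF rexec_Then[OF rexec_addto2 rexec_Then[OF P'(2) rexec_Then[OF rexec_addto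
        rexec_Then[OF P(2) rexec_Then[OF rexec_addto rexec_pairup]]]]]])
        (use z in \<open>auto simp: fun_eq_iff\<close>)
  qed
qed

lemma implemented_iter:
  assumes "implemented f"
  shows "implemented (\<lambda>x. (f ^^ fst (prod_decode x)) (snd (prod_decode x)))"
proof -
  obtain P m where P: "\<And>a. wfc (a + m) (P a)"
    "\<And>a v. \<forall>i>a. v i = 0 \<Longrightarrow> rexec (P a) v (v(a := f (v a)))"
    using assms unfolding implemented_def by blast
  let ?R = "\<lambda>a. unpair a ;; loop (a + 1) (decr (a + 1) ;; P (a + 2)) ;; addto (a + 2) a"
  show ?thesis
  proof (rule implementedI)
    show "wfc (a + (m + 5)) (?R a)" for a
      using wfc_mono[OF P(1)[of "a + 2"], of "a + (m + 5)"] by (simp add: program_defs)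
  next
    fix a :: nat and v :: "nat \<Rightarrow> nat" assume z: "\<forall>i>a. v i = 0"
    obtain n x where p: "prod_decode (v a) = (n, x)" by force
    let ?V = "\<lambda>k. v(a := 0, a + 1 := k, a + 2 := (f ^^ (n - k)) x)"
    have 1: "rexec (unpair a) v (?V n)"
      by (rule rexec_eq[OF rexec_unpair]) (use z p in auto)
    have 2: "rexec (loop (a + 1) (decr (a + 1) ;; P (a + 2))) (?V n) (?V 0)"
    proof (rule rexec_loop)
      fix k assume k: "k < n"
      then have s: "n - k = Suc (n - Suc k)" by simp
      show "rexec (decr (a + 1) ;; P (a + 2)) (?V (Suc k)) (?V k)"
        unfolding s by (rule rexec_eq[OF rexec_Then[OF rexec_decr[of _ _ k] P(2)]])
          (use z in \<open>auto simp: fun_eq_iff\<close>)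
    qed auto
    show "rexec (?R a) v (v(a := (f ^^ fst (prod_decode (v a))) (snd (prod_decode (v a)))))"
      by (rule rexec_eq[OF rexec_Then[OF 1 rexec_Then[OF 2 rexec_addto]]])
        (use z p in \<open>auto simp: fun_eq_iff\<close>)
  qed
qed

lemma prec_implemented: "prec f \<Longrightarrow> implemented f"
proof (induction rule: prec.induct)
  case (prec_comp f g)
  from prec_comp.IH show ?case by (rule implemented_comp)
next
  case (prec_pair f g)
  from prec_pair.IH show ?case by (rule implemented_pair)
next
  case (prec_iter f)
  from prec_iter.IH show ?case by (rule implemented_iter)
qed (rule implemented_zero implemented_Suc implemented_id implemented_fst implemented_snd)+

section \<open>Uniform families of machines\<close>

text \<open>Tape 2 is excluded because it is marked before its head moves to \<open>z\<close>; a
  later mark would hit cell \<open>z\<close> instead of cell 0.\<close>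

primrec marks :: "nat \<Rightarrow> com" where
  "marks 0 = Move 0 0"
| "marks (Suc n) = marks n ;; Write (n + 3) 3"

lemma wfc_marks: "n + 3 \<le> k \<Longrightarrow> wfc k (marks n)"
  by (induction n) auto

lemma exec_marks:
  "exec (marks n) g (\<lambda>i. if 3 \<le> i \<and> i < n + 3
     then (fst (g i), (snd (g i))(fst (g i) := 3)) else g i)"
proof (induction n)
  case 0
  show ?case unfolding marks.simps by (rule exec_Move') (auto simp: fun_eq_iff)
next
  case (Suc n)
  show ?case unfolding marks.simps
    by (rule ex_Then[OF Suc], rule exec_Write') (auto simp: fun_eq_iff)
qed

lemma exec_eq: "exec c g g' \<Longrightarrow> g' = g'' \<Longrightarrow> exec c g g''"
  by simp

lemma exec_eq_init: "exec c g g' \<Longrightarrow> g = g'' \<Longrightarrow> exec c g'' g'"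
  by simp

lemma exec_repeated_move:
  "exec c (g(2 := (fst (g 2) + int z, snd (g 2)))) g' \<Longrightarrow> exec (repeated_move z c) g g'"
proof (induction z arbitrary: g)
  case (Suc z)
  show ?case unfolding repeated_move.simps
    by (rule ex_Then[OF ex_Move], rule Suc.IH, rule exec_eq_init[OF Suc.prems]) (auto simp: fun_eq_iff)
qed simp

lemma wfc_repeated_move: "wfc k c \<Longrightarrow> 3 \<le> k \<Longrightarrow> wfc k (repeated_move z c)"
  by (induction z) auto

lemma len_repeated_move [simp]: "len (repeated_move z c) = z + len c"
  by (induction z) auto

text \<open>Concatenation of tables is associative, so the grouping of commands does not affect the
  code. This exposes the main loop of the event machine as a block of its own.\<close>

lemma compile_repeated_move_Then:
  "compile k (repeated_move z (c ;; c')) b = compile k (repeated_move z c ;; c') b"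
  by (induction z arbitrary: b) (simp_all add: add.assoc)

text \<open>Tapes beyond the actual ones are taken as already marked, so that marking the first
  \<open>k\<close> tapes makes every register available.\<close>

definition blank_state :: "nat \<Rightarrow> int \<times> tape \<Rightarrow> int \<times> tape \<Rightarrow> nat \<Rightarrow> int \<times> tape" where
  "blank_state k io orc i = (if i = 0 then io else if i = 1 then orc else if i < k then (0, \<lambda>_. 0) else reg 0)"

lemma exec_setup:
  assumes "3 \<le> k" "exec c (rstate io orc ((\<lambda>_. 0)(0 := z))) g'"
  shows "exec (Write 2 3 ;; repeated_move z (marks (k - 3) ;; c)) (blank_state k io orc) g'"
  by (rule ex_Then[OF ex_Write], rule exec_repeated_move, rule ex_Then[OF exec_marks],
      rule exec_eq_init[OF assms(2)])
    (use assms(1) in \<open>auto simp: fun_eq_iff rstate_def reg_def blank_state_def\<close>)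

lemma tm_init_blank:
  "2 \<le> k \<Longrightarrow> tm_init (k, T) [t0, t1] = (0, map (blank_state k (0, t0) (0, t1)) [0..<k])"
  by (auto simp: tm_init_def blank_state_def less_Suc_eq nth_Cons split: nat.splits)

lemma tm_init_blank0:
  "tm_init (k, T) [] = (0, map (blank_state k (0, \<lambda>_. 0) (0, \<lambda>_. 0)) [0..<k])"
  by (auto simp: tm_init_def blank_state_def)

subsection \<open>The oracle machine\<close>

text \<open>Registers: 0 holds the parameter \<open>z\<close>, 1 the input \<open>n\<close>, 2 the candidate for \<open>p (n + 2)\<close>,
  3 a flag that is cleared when the oracle confirms the candidate; the others are scratch.\<close>

definition read_input :: com where
  "read_input = Loop 0 2 (Write 0 0 ;; Move 0 1 ;; inc 1 ;; inc 4) ;; loop 4 (decr 4 ;; Move 0 (-1))"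

text \<open>The code of \<open>(n + 2, candidate)\<close> is produced twice: register 4 drives the
  walk to the oracle cell and register 5 the way back. The shift by 2 stands for the two extra bits
  of precision taken from the input.\<close>

definition query_index :: com where
  "query_index = addto2 1 4 5 ;; addto 5 1 ;; addto2 2 5 6 ;; addto 6 2 ;; inc 4 ;; inc 4 ;;
     pairup 6 4 5 ;; addto2 6 4 5"

definition query :: com where
  "query = query_index ;; loop 4 (decr 4 ;; Move 1 1) ;; Branch 1 2 (decr 3) (inc 2) ;;
     loop 5 (decr 5 ;; Move 1 (-1))"

definition write_output :: com where
  "write_output = loop 4 (decr 4 ;; Write 0 2 ;; Move 0 1)"

definition oracle_prog :: "com \<Rightarrow> com" where
  "oracle_prog P = read_input ;; inc 3 ;; loop 3 query ;; pairup 4 1 2 ;; addto 4 1 ;; pairup 4 0 1 ;;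
     P ;; write_output"

definition unary_tape :: "nat \<Rightarrow> nat \<Rightarrow> tape" where
  "unary_tape m n i = (if int m \<le> i \<and> i < int n then 2 else 0)"

lemma string_tape_replicate: "string_tape (replicate n True) = unary_tape 0 n"
  by (auto simp: fun_eq_iff string_tape_def unary_tape_def bit_sym_def)

lemma exec_io_move: "exec (Move 0 d) (rstate (h, t) orc v) (rstate (h + d, t) orc v)"
  by (rule exec_Move') (auto simp: fun_eq_iff rstate_def)

lemma exec_io_write: "exec (Write 0 w) (rstate (h, t) orc v) (rstate (h, t(h := w)) orc v)"
  by (rule exec_Write') (auto simp: fun_eq_iff rstate_def)

lemma exec_oracle_move: "exec (Move 1 d) (rstate io (h, t) v) (rstate io (h + d, t) v)"
  by (rule exec_Move') (auto simp: fun_eq_iff rstate_def)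

lemma exec_read_input:
  assumes "v 1 = 0" "v 4 = 0"
  shows "exec read_input (rstate (0, unary_tape 0 n) orc v) (rstate (0, \<lambda>_. 0) orc (v(1 := n)))"
proof -
  let ?G = "\<lambda>k. rstate (int (n - k), unary_tape (n - k) n) orc (v(1 := n - k, 4 := n - k))"
  have "exec (Loop 0 2 (Write 0 0 ;; Move 0 1 ;; inc 1 ;; inc 4)) (?G n) (?G 0)"
  proof (rule exec_Loop)
    fix k assume k: "k < n"
    show "cur (?G (Suc k)) 0 = 2" using k by (simp add: cur_def rstate_def unary_tape_def)
    have t: "(unary_tape (n - Suc k) n)(int (n - Suc k) := 0) = unary_tape (n - k) n"
      using k by (auto simp: fun_eq_iff unary_tape_def)
    have v: "(v(1 := n - Suc k, 4 := n - Suc k))(1 := Suc (n - Suc k), 4 := Suc (n - Suc k)) =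
        v(1 := n - k, 4 := n - k)" using k by (auto simp: fun_eq_iff)
    have h: "int (n - Suc k) + 1 = int (n - k)" using k by simp
    show "exec (Write 0 0 ;; Move 0 1 ;; inc 1 ;; inc 4) (?G (Suc k)) (?G k)"
      by (rule ex_Then[OF exec_io_write ex_Then[OF exec_io_move ex_Then[OF exec_inc exec_eq[OF exec_inc]]]])
        (use t v h in simp)
  qed (simp add: cur_def rstate_def unary_tape_def)
  moreover have "?G n = rstate (0, unary_tape 0 n) orc v" using assms by (simp add: fun_upd_idem)
  moreover have "exec (loop 4 (decr 4 ;; Move 0 (-1))) (rstate (int n, unary_tape n n) orc (v(1 := n, 4 := n)))
      (rstate (int 0, unary_tape n n) orc (v(1 := n, 4 := 0)))"
  proof (rule exec_Loop[where G = "\<lambda>k. rstate (int k, unary_tape n n) orc (v(1 := n, 4 := k))"])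
    fix k
    show "exec (decr 4 ;; Move 0 (-1)) (rstate (int (Suc k), unary_tape n n) orc (v(1 := n, 4 := Suc k)))
       (rstate (int k, unary_tape n n) orc (v(1 := n, 4 := k)))"
      by (rule ex_Then[OF exec_decr[of _ _ k] exec_eq[OF exec_io_move]]) simp_all
  qed (simp_all only: cur_rstate, simp_all)
  ultimately have "exec read_input (rstate (0, unary_tape 0 n) orc v)
      (rstate (int 0, unary_tape n n) orc (v(1 := n, 4 := 0)))"
    unfolding read_input_def using ex_Then by fastforce
  moreover have "unary_tape n n = (\<lambda>_. 0)" by (auto simp: unary_tape_def)
  moreover have "v(1 := n, 4 := 0) = v(1 := n)" using assms by auto
  ultimately show ?thesis by simp
qed

lemma exec_write_output:
  assumes "v 4 = m"
  shows "exec write_output (rstate (0, \<lambda>_. 0) orc v) (rstate (int m, unary_tape 0 m) orc (v(4 := 0)))"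
proof -
  let ?G = "\<lambda>k. rstate (int (m - k), unary_tape 0 (m - k)) orc (v(4 := k))"
  have "exec (loop 4 (decr 4 ;; Write 0 2 ;; Move 0 1)) (?G m) (?G 0)"
  proof (rule exec_Loop)
    fix k assume k: "k < m"
    have t: "(unary_tape 0 (m - Suc k))(int (m - Suc k) := 2) = unary_tape 0 (m - k)"
      using k by (auto simp: fun_eq_iff unary_tape_def)
    have h: "int (m - Suc k) + 1 = int (m - k)" using k by simp
    show "exec (decr 4 ;; Write 0 2 ;; Move 0 1) (?G (Suc k)) (?G k)"
      by (rule ex_Then[OF exec_decr[of _ _ k] ex_Then[OF exec_io_write exec_eq[OF exec_io_move]]])
        (use t h in simp_all)
  qed (simp_all only: cur_rstate, simp_all)
  moreover have "unary_tape 0 0 = (\<lambda>_. 0)" by (auto simp: unary_tape_def)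
  moreover have "v(4 := m) = v" using assms by auto
  ultimately show ?thesis unfolding write_output_def by simp
qed

lemma exec_rexec: "rexec c v v' \<Longrightarrow> exec c (rstate io orc v) (rstate io orc v')"
  unfolding rexec_def by blast

lemma exec_oracle_forth:
  "exec (loop 4 (decr 4 ;; Move 1 1)) (rstate io (0, t) v) (rstate io (int (v 4), t) (v(4 := 0)))"
proof -
  let ?G = "\<lambda>k. rstate io (int (v 4 - k), t) (v(4 := k))"
  have "exec (loop 4 (decr 4 ;; Move 1 1)) (?G (v 4)) (?G 0)"
  proof (rule exec_Loop)
    fix k assume k: "k < v 4"
    have h: "int (v 4 - Suc k) + 1 = int (v 4 - k)" using k by simp
    show "exec (decr 4 ;; Move 1 1) (?G (Suc k)) (?G k)"
      by (rule ex_Then[OF exec_decr[of _ _ k] exec_eq[OF exec_oracle_move]]) (use h in simp_all)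
  qed (simp_all only: cur_rstate, simp_all)
  then show ?thesis by simp
qed

lemma exec_oracle_back:
  "exec (loop 5 (decr 5 ;; Move 1 (-1))) (rstate io (int (v 5), t) v) (rstate io (0, t) (v(5 := 0)))"
proof -
  let ?G = "\<lambda>k. rstate io (int k, t) (v(5 := k))"
  have "exec (loop 5 (decr 5 ;; Move 1 (-1))) (?G (v 5)) (?G 0)"
  proof (rule exec_Loop)
    fix k
    show "exec (decr 5 ;; Move 1 (-1)) (?G (Suc k)) (?G k)"
      by (rule ex_Then[OF exec_decr[of _ _ k] exec_eq[OF exec_oracle_move]]) simp_all
  qed (simp_all only: cur_rstate, simp_all)
  then show ?thesis by simp
qed

lemma exec_query:
  assumes "\<forall>i\<ge>4. v i = 0" "v 3 = 1"
  shows "exec query (rstate io (0, omega_tape (graph_seq p)) v)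
    (rstate io (0, omega_tape (graph_seq p)) (if v 2 = p (v 1 + 2) then v(3 := 0) else v(2 := Suc (v 2))))"
proof -
  let ?t = "omega_tape (graph_seq p)"
  let ?i = "prod_encode (v 1 + 2, v 2)"
  have 1: "rexec query_index v (v(4 := ?i, 5 := ?i))"
    unfolding query_index_def
    by (rule rexec_eq[OF rexec_Then[OF rexec_addto2 rexec_Then[OF rexec_addto
      rexec_Then[OF rexec_addto2 rexec_Then[OF rexec_addto rexec_Then[OF rexec_inc
      rexec_Then[OF rexec_inc rexec_Then[OF rexec_pairup rexec_addto2]]]]]]]])
      (use assms in \<open>auto simp: fun_eq_iff\<close>)
  let ?w = "v(4 := 0, 5 := ?i)"
  let ?u = "if v 2 = p (v 1 + 2) then ?w(3 := 0) else ?w(2 := Suc (v 2))"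
  have 2: "exec (loop 4 (decr 4 ;; Move 1 1)) (rstate io (0, ?t) (v(4 := ?i, 5 := ?i)))
      (rstate io (int ?i, ?t) ?w)"
    by (rule exec_eq[OF exec_oracle_forth]) (simp add: fun_upd_twist)
  have c: "cur (rstate io (int ?i, ?t) ?w) 1 = 2 \<longleftrightarrow> v 2 = p (v 1 + 2)"
    by (auto simp: cur_def rstate_def omega_tape_def bit_sym_def graph_seq_def)
  have 3: "exec (Branch 1 2 (decr 3) (inc 2)) (rstate io (int ?i, ?t) ?w) (rstate io (int ?i, ?t) ?u)"
  proof (cases "v 2 = p (v 1 + 2)")
    case True
    have "exec (decr 3) (rstate io (int ?i, ?t) ?w) (rstate io (int ?i, ?t) (?w(3 := 0)))"
      by (rule exec_decr) (use assms in simp)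
    then show ?thesis using True c by (intro ex_BranchT) auto
  next
    case False
    have "exec (inc 2) (rstate io (int ?i, ?t) ?w) (rstate io (int ?i, ?t) (?w(2 := Suc (v 2))))"
      by (rule exec_eq[OF exec_inc]) simp
    then show ?thesis using False c by (intro ex_BranchF) auto
  qed
  have "?u 5 = ?i" by simp
  then have 4: "exec (loop 5 (decr 5 ;; Move 1 (-1))) (rstate io (int ?i, ?t) ?u) (rstate io (0, ?t) (?u(5 := 0)))"
    using exec_oracle_back[of io ?u ?t] by simp
  have "?u(5 := 0) = (if v 2 = p (v 1 + 2) then v(3 := 0) else v(2 := Suc (v 2)))"
    using assms by (auto simp: fun_eq_iff)
  with ex_Then[OF exec_rexec[OF 1] ex_Then[OF 2 ex_Then[OF 3 4]]] show ?thesis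
    unfolding query_def by simp
qed

text \<open>Induction on the distance of the candidate from the oracle value. The search ends
  because the oracle is the graph of a total function.\<close>

lemma exec_search:
  assumes "\<forall>i\<ge>4. v i = 0" "v 3 = 1" "v 2 \<le> p (v 1 + 2)"
  shows "exec (loop 3 query) (rstate io (0, omega_tape (graph_seq p)) v)
    (rstate io (0, omega_tape (graph_seq p)) (v(2 := p (v 1 + 2), 3 := 0)))"
  using assms
proof (induction "p (v 1 + 2) - v 2" arbitrary: v)
  case 0
  let ?t = "omega_tape (graph_seq p)"
  have e: "v 2 = p (v 1 + 2)" using 0 by simp
  have "exec query (rstate io (0, ?t) v) (rstate io (0, ?t) (v(3 := 0)))"
    using exec_query[OF 0(2,3), of io p] e by simp
  moreover have "cur (rstate io (0, ?t) v) (3 + 2) = 0" "cur (rstate io (0, ?t) (v(3 := 0))) (3 + 2) \<noteq> 0"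
    by (simp_all only: cur_rstate 0(3)) simp_all
  ultimately have "exec (loop 3 query) (rstate io (0, ?t) v) (rstate io (0, ?t) (v(3 := 0)))"
    by (blast intro: ex_LoopT ex_LoopF)
  moreover have "v(2 := p (v 1 + 2), 3 := 0) = v(3 := 0)" using e by auto
  ultimately show ?case by (simp only:)
next
  case (Suc d)
  let ?t = "omega_tape (graph_seq p)"
  let ?v = "v(2 := Suc (v 2))"
  have "exec query (rstate io (0, ?t) v) (rstate io (0, ?t) ?v)"
    using exec_query[OF Suc(3,4), of io p] Suc(2) by (simp split: if_splits)
  moreover have "cur (rstate io (0, ?t) v) (3 + 2) = 0"
    by (simp only: cur_rstate Suc(4)) simp
  moreover have "exec (loop 3 query) (rstate io (0, ?t) ?v) (rstate io (0, ?t) (?v(2 := p (?v 1 + 2), 3 := 0)))"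
    by (rule Suc.hyps(1)) (use Suc in auto)
  ultimately show ?case by (auto intro: ex_LoopT)
qed

lemma exec_oracle_prog:
  assumes "\<And>v. \<forall>i>4. v i = 0 \<Longrightarrow> rexec P v (v(4 := Q (v 4)))"
  defines "m \<equiv> \<lambda>z n p. Q (prod_encode (z, prod_encode (n, p (n + 2))))"
  shows "exec (oracle_prog P)
    (rstate (0, unary_tape 0 n) (0, omega_tape (graph_seq p)) ((\<lambda>_. 0)(0 := z)))
    (rstate (int (m z n p), unary_tape 0 (m z n p)) (0, omega_tape (graph_seq p)) (\<lambda>_. 0))"
proof -
  let ?t = "omega_tape (graph_seq p)" and ?b = "(0, \<lambda>_. 0)"
  let ?v = "(\<lambda>_. 0)(0 := z) :: nat \<Rightarrow> nat"
  let ?w = "?v(1 := n, 2 := p (n + 2))"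
  let ?x = "(\<lambda>_. 0)(4 := prod_encode (z, prod_encode (n, p (n + 2)))) :: nat \<Rightarrow> nat"
  have 1: "exec read_input (rstate (0, unary_tape 0 n) (0, ?t) ?v) (rstate ?b (0, ?t) (?v(1 := n)))"
    by (rule exec_read_input) simp_all
  have 2: "exec (inc 3) (rstate ?b (0, ?t) (?v(1 := n))) (rstate ?b (0, ?t) (?v(1 := n, 3 := 1)))"
    by (rule exec_eq[OF exec_inc]) simp
  have 3: "exec (loop 3 query) (rstate ?b (0, ?t) (?v(1 := n, 3 := 1))) (rstate ?b (0, ?t) ?w)"
    by (rule exec_eq[OF exec_search], simp, simp, simp, rule arg_cong[of _ _ "rstate ?b (0, ?t)"])
      (auto simp: fun_eq_iff)
  have 4: "rexec (pairup 4 1 2) ?w (?v(4 := prod_encode (n, p (n + 2))))"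
    by (rule rexec_eq[OF rexec_pairup]) (auto simp: fun_eq_iff)
  have 5: "rexec (addto 4 1) (?v(4 := prod_encode (n, p (n + 2)))) (?v(1 := prod_encode (n, p (n + 2))))"
    by (rule rexec_eq[OF rexec_addto]) (auto simp: fun_eq_iff)
  have 6: "rexec (pairup 4 0 1) (?v(1 := prod_encode (n, p (n + 2)))) ?x"
    by (rule rexec_eq[OF rexec_pairup]) (auto simp: fun_eq_iff)
  have 7: "rexec P ?x (?x(4 := m z n p))"
    using assms(1)[of ?x] by (simp add: m_def)
  have 8: "exec write_output (rstate ?b (0, ?t) (?x(4 := m z n p)))
      (rstate (int (m z n p), unary_tape 0 (m z n p)) (0, ?t) (\<lambda>_. 0))"
    by (rule exec_eq[OF exec_write_output]) (auto simp: fun_upd_idem)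
  show ?thesis unfolding oracle_prog_def
    by (rule ex_Then[OF 1 ex_Then[OF 2 ex_Then[OF 3 ex_Then[OF exec_rexec[OF 4]
      ex_Then[OF exec_rexec[OF 5] ex_Then[OF exec_rexec[OF 6] ex_Then[OF exec_rexec[OF 7] 8]]]]]]])
qed

lemma prec_iff_prim: "prec f \<longleftrightarrow> prim f"
proof
  assume "prim f"
  then obtain g where "prec g" "\<forall>x. g x = f x" by (auto simp: prim_def)
  moreover then have "g = f" by auto
  ultimately show "prec f" by simp
qed (auto simp: prim_def)

lemma reach_final: "reach M Q c c' \<Longrightarrow> \<exists>t. tm_run M t c = c'"
  by (auto simp: reach_def)

text \<open>The restricted functionals that part (b) calls for: the result depends on the input and
  on one oracle value, at \<open>n + 2\<close>, and the index is primitive recursive in the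
  parameter \<open>z\<close>.\<close>

theorem oracle_machine:
  assumes "prec Q"
  shows "\<exists>g. prec g \<and> (\<forall>z p n.
    turing_functional (g z) p n (Q (prod_encode (z, prod_encode (n, p (n + 2))))))"
proof -
  obtain P m where P: "\<And>a. wfc (a + m) (P a)"
    "\<And>a v. \<forall>i>a. v i = 0 \<Longrightarrow> rexec (P a) v (v(a := Q (v a)))"
    using prec_implemented[OF assms] unfolding implemented_def by blast
  define k where "k = m + 9"
  define C where "C = (\<lambda>z. Write 2 3 ;; repeated_move z (marks (k - 3) ;; oracle_prog (P 4)))"
  define g where "g = (\<lambda>z. enc (k, compile k (C z) 0))"
  have "prec g" unfolding prec_iff_prim g_def C_def by (intro pr)
  moreover have "turing_functional (g z) p n (Q (prod_encode (z, prod_encode (n, p (n + 2)))))" for z p n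
  proof -
    let ?M = "(k, compile k (C z) 0)" and ?q = "Q (prod_encode (z, prod_encode (n, p (n + 2))))"
    let ?g = "blank_state k (0, unary_tape 0 n) (0, omega_tape (graph_seq p))"
    let ?h = "rstate (int ?q, unary_tape 0 ?q) (0, omega_tape (graph_seq p)) (\<lambda>_. 0)"
    have wf: "wfc k (C z)" unfolding C_def
      using wfc_mono[OF P(1)[of 4], of k]
      by (auto simp: k_def oracle_prog_def read_input_def query_def query_index_def write_output_def
          program_defs intro!: wfc_repeated_move wfc_marks)
    have ex: "exec (C z) ?g ?h"
      unfolding C_def by (rule exec_setup[OF _ exec_oracle_prog]) (auto simp: k_def P(2))
    have sy: "syms k ?g"
      by (auto simp: syms_def blank_state_def unary_tape_def omega_tape_def bit_sym_def reg_def)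
    obtain t where t: "tm_run ?M t (0, map ?g [0..<k]) = (len (C z), map ?h [0..<k])"
      using compile_correct[OF ex wf sy holds_at_compile[where b = 0]] reach_final by fastforce
    have init: "tm_init ?M [string_tape (replicate n True), omega_tape (graph_seq p)] = (0, map ?g [0..<k])"
      by (simp add: string_tape_replicate tm_init_blank k_def)
    have "tm_halted ?M (len (C z), map ?h [0..<k])"
      by (simp add: tm_halted_def tm_lookup_def compile_None)
    moreover have "tape_holds (snd (map ?h [0..<k] ! 0)) (replicate ?q True)"
      by (simp add: k_def rstate_def tape_holds_def unary_tape_def bit_sym_def)
    ultimately show ?thesis
      unfolding turing_functional_def g_def tm_decode_enc Let_def init
      using t tm_wf_compile[OF wf] by (auto simp: k_def intro!: exI[of _ t])
  qed
  ultimately show ?thesis by blast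
qed

lemma computable_fun_prec: assumes "prec f" shows "computable_fun f"
proof -
  \<comment> \<open>The projection selects the input \<open>n\<close> from
    \<open>(z, (n, p (n + 2)))\<close>, so parameter and oracle have no influence on the
    result.\<close>
  have "prec (\<lambda>x. f (fst (prod_decode (snd (prod_decode x)))))"
    by (intro prec_comp[OF assms] prec_comp[OF prec_fst] prec_snd)
  from oracle_machine[OF this] show ?thesis unfolding computable_fun_def by auto
qed

subsection \<open>The event machine\<close>

text \<open>Registers: 0 holds the parameter \<open>z\<close>, 1 the stage \<open>s\<close>, 2 is constantly 1 and drives the
  infinite loop; the others are scratch.\<close>

definition event_arg :: com where
  "event_arg = addto2 0 3 4 ;; addto 4 0 ;; addto2 1 4 5 ;; addto 5 1 ;; pairup 5 3 4 ;; addto 5 3"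

text \<open>The times \<open>t s\<close> cut the numbers from \<open>t 0\<close> on into finite
  blocks. Infinitely many hits cannot lie in finitely many blocks, and each block with
  \<open>E s\<close> contributes a hit.\<close>

lemma infinite_blocks:
  fixes t :: "nat \<Rightarrow> nat"
  assumes t: "strict_mono t" and E: "\<And>s. (\<exists>n. t s \<le> n \<and> n < t (Suc s) \<and> P n) \<longleftrightarrow> E s"
  shows "(\<exists>\<^sub>\<infinity>n. P n) \<longleftrightarrow> (\<exists>\<^sub>\<infinity>s. E s)"
proof
  assume "\<exists>\<^sub>\<infinity>s. E s"
  show "\<exists>\<^sub>\<infinity>n. P n" unfolding INFM_nat_le
  proof
    fix m
    obtain s where "m \<le> s" "E s" using \<open>\<exists>\<^sub>\<infinity>s. E s\<close> unfolding INFM_nat_le by blast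
    then obtain n where "t s \<le> n" "P n" using E by blast
    moreover have "m \<le> t s" using strict_mono_imp_increasing[OF t, of s] \<open>m \<le> s\<close> by linarith
    ultimately show "\<exists>n\<ge>m. P n" by (meson le_trans)
  qed
next
  assume inf: "\<exists>\<^sub>\<infinity>n. P n"
  show "\<exists>\<^sub>\<infinity>s. E s" unfolding INFM_nat_le
  proof
    fix m
    obtain n where n: "t m \<le> n" "P n" using inf unfolding INFM_nat_le by blast
    define s where "s = (GREATEST s. t s \<le> n)"
    have b: "s' \<le> n" if "t s' \<le> n" for s'
      using strict_mono_imp_increasing[OF t, of s'] that by linarith
    have s: "t s \<le> n"
      unfolding s_def by (rule GreatestI_nat[of "\<lambda>s. t s \<le> n", OF n(1) b])
    have le: "s' \<le> s" if "t s' \<le> n" for s'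
      unfolding s_def by (rule Greatest_le_nat[of "\<lambda>s. t s \<le> n", OF that b])
    have "\<not> t (Suc s) \<le> n" using le[of "Suc s"] by auto
    then have "E s" using E s n(2) by (meson not_le)
    then show "\<exists>s\<ge>m. E s" using le[OF n(1)] by blast
  qed
qed

text \<open>The machine runs through the stages \<open>s\<close> in an endless loop and passes
  through the state \<open>qe z\<close> in round \<open>s\<close> exactly if the stage is an event.
  The length of the rounds is irrelevant for infinitude.\<close>

theorem event_machine:
  assumes "prec E"
  shows "\<exists>k T qe. prim T \<and> prim qe \<and> (\<forall>z. tm_wf (k, T z) \<and>
    ((\<exists>\<^sub>\<infinity>n. fst (tm_run (k, T z) n (tm_init (k, T z) [])) = qe z) \<longleftrightarrow>
     (\<exists>\<^sub>\<infinity>s. E (prod_encode (z, s)) \<noteq> 0)))"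
proof -
  obtain P m where P: "\<And>a. wfc (a + m) (P a)"
    "\<And>a v. \<forall>i>a. v i = 0 \<Longrightarrow> rexec (P a) v (v(a := E (v a)))"
    using prec_implemented[OF assms] unfolding implemented_def by blast
  define k where "k = m + 8"
  define A where "A = event_arg ;; P 3"
  define B where "B = clear 3 ;; inc 1"
  \<comment> \<open>Tape 5 is register 3, which holds the value of \<open>E\<close>. Both branches
    do nothing; they only make the truth value visible as a state of the machine.\<close>
  define D where "D = Branch 5 0 (Move 0 0) (Move 0 0)"
  define L where "L = Loop 4 0 (A ;; D ;; B)"
  define T where "T = (\<lambda>z. compile k (Write 2 3 ;; repeated_move z ((marks (k - 3) ;; inc 2) ;; L)) 0)"
  define h where "h = (\<lambda>z. z + (len (marks (k - 3)) + 2))"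
  \<comment> \<open>From the start \<open>h z\<close> of the loop one state is its test,
    \<open>len A\<close> states belong to \<open>A\<close>, and one is the test of \<open>D\<close>;
    the next state begins the branch for nonzero values.\<close>
  define qe where "qe = (\<lambda>z. h z + (len A + 2))"
  have T: "prim T" unfolding T_def by (intro pr)
  have q: "prim qe" unfolding qe_def h_def by (intro pr)
  have wL: "wfc k L" "wfc k A" "wfc k B" "wfc k D" "wfc k (Move 0 0)"
    using wfc_mono[OF P(1)[of 3], of k]
    by (auto simp: k_def L_def A_def B_def D_def event_arg_def program_defs)
  have "tm_wf (k, T z) \<and> ((\<exists>\<^sub>\<infinity>n. fst (tm_run (k, T z) n (tm_init (k, T z) [])) = qe z) \<longleftrightarrow>
     (\<exists>\<^sub>\<infinity>s. E (prod_encode (z, s)) \<noteq> 0))" for z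
  proof
    let ?M = "(k, T z)"
    define C where "C = (Write 2 3 ;; repeated_move z (marks (k - 3) ;; inc 2)) ;; L"
    have TC: "T z = compile k C 0"
      by (simp add: T_def C_def compile_repeated_move_Then del: repeated_move.simps)
    have wC: "wfc k C" unfolding C_def using wL(1)
      by (auto simp: k_def intro!: wfc_repeated_move wfc_marks)
    show "tm_wf ?M" unfolding TC by (rule tm_wf_compile[OF wC])
    have hC: "holds_at ?M k C 0" unfolding TC by (rule holds_at_compile)
    have lenC: "len (Write 2 3 ;; repeated_move z (marks (k - 3) ;; inc 2)) = h z"
      by (simp add: h_def)
    have hL: "holds_at ?M k L (h z)"
      using holds_at_Then(2)[OF hC[unfolded C_def]] unfolding lenC by simp
    have hABD: "holds_at ?M k (A ;; D ;; B) (h z + 1)" by (rule holds_at_Loop(1)[OF hL[unfolded L_def]])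
    note hA = holds_at_Then(1)[OF hABD]
    note hDB = holds_at_Then(2)[OF hABD]
    note hD = holds_at_Then(1)[OF hDB]
    have lenD: "len D = 4" by (simp add: D_def)
    define d where "d = h z + 1 + len A"
    have hB: "holds_at ?M k B (d + 4)" using holds_at_Then(2)[OF hDB] by (simp add: lenD d_def)
    have hD: "holds_at ?M k (Branch 5 0 (Move 0 0) (Move 0 0)) d" using hD by (simp add: D_def d_def)
    have qe: "qe z = d + 1" by (simp add: qe_def d_def)
    let ?io = "(0, \<lambda>_. 0) :: int \<times> tape"
    define v where "v = (\<lambda>s. (\<lambda>_. 0)(0 := z, 1 := s, 2 := 1) :: nat \<Rightarrow> nat)"
    define g where "g = (\<lambda>s. rstate ?io ?io (v s))"
    define H where "H = (\<lambda>s. (h z, map (g s) [0..<k]))"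
    have sy: "syms k (rstate ?io ?io w)" for w
      by (auto simp: syms_def rstate_def reg_def)
    have sy': "set (map (cur (rstate ?io ?io w)) [0..<k]) \<subseteq> {..<4}" for w
      using sy[of w] by (auto simp: syms_def cur_def)
    have start: "\<exists>t. tm_run ?M t (tm_init ?M []) = H 0"
    proof -
      have "exec (inc 2) (rstate ?io ?io ((\<lambda>_. 0)(0 := z))) (g 0)"
        unfolding g_def by (rule exec_eq[OF exec_inc], rule arg_cong[of _ _ "rstate ?io ?io"])
          (auto simp: v_def)
      then have "exec (Write 2 3 ;; repeated_move z (marks (k - 3) ;; inc 2)) (blank_state k ?io ?io) (g 0)"
        by (rule exec_setup[rotated]) (simp add: k_def)
      moreover have "wfc k (Write 2 3 ;; repeated_move z (marks (k - 3) ;; inc 2))"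
        using wC by (simp add: C_def)
      moreover have "syms k (blank_state k ?io ?io)"
        by (auto simp: syms_def blank_state_def reg_def)
      ultimately have "reach ?M {0..<0 + h z} (0, map (blank_state k ?io ?io) [0..<k]) (0 + h z, map (g 0) [0..<k])"
        using compile_correct[OF _ _ _ holds_at_Then(1)[OF hC[unfolded C_def]]] unfolding lenC by blast
      then show ?thesis unfolding tm_init_blank0 H_def by (auto dest: reach_final)
    qed
    have block: "\<exists>n>0. tm_run ?M n (H s) = H (Suc s) \<and>
        ((\<exists>i<n. fst (tm_run ?M i (H s)) = qe z) \<longleftrightarrow> E (prod_encode (z, s)) \<noteq> 0)" for s
    proof -
      define e where "e = E (prod_encode (z, s))"
      define w where "w = (v s)(3 := e)"
      let ?w = "rstate ?io ?io w"
      have "rexec event_arg (v s) ((v s)(3 := prod_encode (z, s)))"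
        unfolding event_arg_def
        by (rule rexec_eq[OF rexec_Then[OF rexec_addto2 rexec_Then[OF rexec_addto rexec_Then[OF rexec_addto2
          rexec_Then[OF rexec_addto rexec_Then[OF rexec_pairup rexec_addto]]]]]])
          (auto simp: v_def fun_eq_iff)
      moreover have "rexec (P 3) ((v s)(3 := prod_encode (z, s))) w"
        by (rule rexec_eq[OF P(2)]) (auto simp: w_def v_def e_def)
      ultimately have "exec A (g s) ?w" unfolding A_def g_def by (intro exec_rexec rexec_Then)
      then have rA: "reach ?M {h z + 1..<d} (h z + 1, map (g s) [0..<k]) (d, map ?w [0..<k])"
        using compile_correct[OF _ wL(2) sy[of "v s"] hA] unfolding g_def d_def by blast
      have "rexec B w (v (Suc s))" unfolding B_def
        by (rule rexec_eq[OF rexec_Then[OF rexec_clear rexec_inc]]) (auto simp: w_def v_def fun_eq_iff)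
      then have "exec B ?w (g (Suc s))" unfolding g_def by (rule exec_rexec)
      then have rB: "reach ?M {d + 4..<d + 4 + len B} (d + 4, map ?w [0..<k]) (d + 4 + len B, map (g (Suc s)) [0..<k])"
        using compile_correct[OF _ wL(3) sy hB] by blast
      have c4: "cur (g s) 4 = 0" using cur_rstate[of ?io ?io "v s" 2] by (simp add: g_def v_def)
      have s1: "tm_step ?M (h z, map (g s) [0..<k]) = (h z + 1, map (g s) [0..<k])"
        by (rule tm_step_goto, subst holds_at_Loop(2)[OF hL[unfolded L_def]])
          (use sy'[of "v s"] c4 in \<open>simp_all add: g_def k_def\<close>)
      have s2: "tm_step ?M (d + 4 + len B, map (g (Suc s)) [0..<k]) = H (Suc s)"
        unfolding H_def
      proof (rule tm_step_goto)
        have e: "h z + 1 + len (A ;; D ;; B) = d + 4 + len B" by (simp add: d_def lenD)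
        show "map_of (snd ?M) (d + 4 + len B, map (cur (g (Suc s))) [0..<k]) =
            Some (goto k (h z) (map (cur (g (Suc s))) [0..<k]))"
          using holds_at_Loop(3)[OF hL[unfolded L_def], of "map (cur (g (Suc s))) [0..<k]"]
            sy'[of "v (Suc s)"] unfolding e by (simp add: g_def)
      qed
      have c5: "cur ?w 5 = (if e = 0 then 3 else 0)"
        using cur_rstate[of ?io ?io w 3] by (simp add: w_def)
      have nop: "exec (Move 0 0) ?w ?w" by (rule exec_Move') (auto simp: fun_eq_iff)
      \<comment> \<open>The stage differs in the two configurations, so a round takes at least one
        step; this makes the starting times of the rounds strictly increasing.\<close>
      have neq: "H s \<noteq> H (Suc s)"
      proof
        assume "H s = H (Suc s)"
        then have "g s 3 = g (Suc s) 3" by (simp add: H_def k_def)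
        then show False by (simp add: g_def rstate_def v_def reg_def)
      qed
      let ?Q = "- {qe z}"
      have pre: "reach ?M ?Q (H s) (d, map ?w [0..<k])"
        using reach_trans[OF reach_step[OF _ s1] reach_mono[OF rA]] unfolding H_def
        by (auto simp: qe d_def)
      have post: "reach ?M ?Q (d + 4, map ?w [0..<k]) (H (Suc s))"
        using reach_trans[OF reach_mono[OF rB] reach_step[OF _ s2]] by (auto simp: qe)
      show ?thesis
      proof (cases "e = 0")
        case True
        have s3: "tm_step ?M (d, map ?w [0..<k]) = (d + 3, map ?w [0..<k])"
          by (rule tm_step_goto, subst holds_at_Branch(3)[OF hD])
            (use sy'[of w] c5 True in \<open>simp_all add: k_def numeral_3_eq_3\<close>)
        have "holds_at ?M k (Move 0 0) (d + 3)" using holds_at_Branch(2)[OF hD] by (simp add: numeral_3_eq_3)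
        from compile_correct[OF nop wL(5) sy this]
        have s4: "reach ?M {d + 3..<d + 4} (d + 3, map ?w [0..<k]) (d + 4, map ?w [0..<k])"
          by (simp add: add.commute)
        have "reach ?M ?Q (d, map ?w [0..<k]) (d + 4, map ?w [0..<k])"
          using reach_trans[OF reach_step[OF _ s3] reach_mono[OF s4]] by (auto simp: qe)
        from reach_trans[OF pre reach_trans[OF this post]]
        obtain n where n: "tm_run ?M n (H s) = H (Suc s)" "\<forall>i<n. fst (tm_run ?M i (H s)) \<noteq> qe z"
          unfolding reach_def by auto
        moreover have "n > 0" using n(1) neq by (cases n) auto
        ultimately show ?thesis using True by (auto simp: e_def)
      next
        case False
        have s3: "tm_step ?M (d, map ?w [0..<k]) = (d + 1, map ?w [0..<k])"
          by (rule tm_step_goto, subst holds_at_Branch(3)[OF hD])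
            (use sy'[of w] c5 False in \<open>simp_all add: k_def\<close>)
        have "holds_at ?M k (Move 0 0) (d + 1)" by (rule holds_at_Branch(1)[OF hD])
        from compile_correct[OF nop wL(5) sy this]
        have s4: "reach ?M {d + 1..<d + 2} (d + 1, map ?w [0..<k]) (d + 2, map ?w [0..<k])"
          by simp
        have s5: "tm_step ?M (d + 2, map ?w [0..<k]) = (d + 4, map ?w [0..<k])"
        proof (rule tm_step_goto)
          show "map_of (snd ?M) (d + 2, map (cur ?w) [0..<k]) =
              Some (goto k (d + 4) (map (cur ?w) [0..<k]))"
            using holds_at_Branch(4)[OF hD, of "map (cur ?w) [0..<k]"] sy'[of w] by (simp add: eval_nat_numeral)
        qed
        have "reach ?M UNIV (H s) (d + 1, map ?w [0..<k])"
          using reach_trans[OF reach_mono[OF pre] reach_step[OF _ s3]] by auto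
        then obtain n1 where n1: "tm_run ?M n1 (H s) = (d + 1, map ?w [0..<k])"
          using reach_final by blast
        have "reach ?M UNIV (d + 1, map ?w [0..<k]) (H (Suc s))"
          using reach_trans[OF reach_mono[OF s4] reach_trans[OF reach_step[OF _ s5] reach_mono[OF post]]]
          by auto
        then obtain n2 where n2: "tm_run ?M n2 (d + 1, map ?w [0..<k]) = H (Suc s)"
          using reach_final by blast
        have "n2 > 0" using n2 by (cases n2) (auto simp: H_def d_def)
        moreover have "tm_run ?M (n1 + n2) (H s) = H (Suc s)" using n1 n2 by (simp add: tm_run_add)
        moreover have "fst (tm_run ?M n1 (H s)) = qe z" using n1 by (simp add: qe)
        ultimately show ?thesis using False
          by (intro exI[of _ "n1 + n2"]) (auto simp: e_def intro!: exI[of _ n1])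
      qed
    qed
    obtain t0 where t0: "tm_run ?M t0 (tm_init ?M []) = H 0" using start by blast
    obtain \<delta> where \<delta>: "\<And>s. \<delta> s > 0" "\<And>s. tm_run ?M (\<delta> s) (H s) = H (Suc s)"
      "\<And>s. (\<exists>i<\<delta> s. fst (tm_run ?M i (H s)) = qe z) \<longleftrightarrow> E (prod_encode (z, s)) \<noteq> 0"
      using block by metis
    define t where "t = (\<lambda>s. t0 + (\<Sum>i<s. \<delta> i))"
    have tS: "t (Suc s) = t s + \<delta> s" for s by (simp add: t_def)
    have run: "tm_run ?M (t s) (tm_init ?M []) = H s" for s
    proof (induction s)
      case 0
      then show ?case using t0 by (simp add: t_def)
    next
      case (Suc s)
      then show ?case by (simp add: tS tm_run_add \<delta>)
    qed
    show "(\<exists>\<^sub>\<infinity>n. fst (tm_run ?M n (tm_init ?M [])) = qe z) \<longleftrightarrow> (\<exists>\<^sub>\<infinity>s. E (prod_encode (z, s)) \<noteq> 0)"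
    proof (rule infinite_blocks)
      show "strict_mono t" by (rule strict_mono_Suc_iff[THEN iffD2]) (simp add: tS \<delta>)
      fix s
      have "(\<exists>n. t s \<le> n \<and> n < t (Suc s) \<and> fst (tm_run ?M n (tm_init ?M [])) = qe z) \<longleftrightarrow>
          (\<exists>i<\<delta> s. fst (tm_run ?M (t s + i) (tm_init ?M [])) = qe z)"
        unfolding tS by (metis add_less_cancel_left le_Suc_ex le_add1)
      then show "(\<exists>n. t s \<le> n \<and> n < t (Suc s) \<and> fst (tm_run ?M n (tm_init ?M [])) = qe z) \<longleftrightarrow>
          E (prod_encode (z, s)) \<noteq> 0"
        by (simp only: tm_run_add run \<delta>)
    qed
  qed
  then show ?thesis using T q by blast
qed

section \<open>Simulating Turing machines by primitive recursion\<close>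

lemma prim_zip [pr]: assumes "prim f" "prim g" shows "prim (\<lambda>x. zip (f x) (g x))"
proof -
  let ?F = "\<lambda>a p. if fst p = [] then p else (tl (fst p), (a, hd (fst p)) # snd p)"
  have nil: "fold ?F xs ([], acc) = ([], acc)" for xs :: "'b list" and acc :: "('b \<times> 'c) list"
    by (induction xs) auto
  have "snd (fold ?F xs (ys, acc)) = rev (zip xs ys) @ acc"
    for xs :: "'b list" and ys :: "'c list" and acc
  proof (induction xs arbitrary: ys acc)
    case (Cons x xs)
    then show ?case by (cases ys) (simp_all add: nil)
  qed simp
  moreover have "prim (\<lambda>x. rev (snd (fold ?F (f x) (g x, []))))" by (intro pr assms)
  ultimately show ?thesis by simp
qed

lemma prim_comp3:
  assumes "prim (\<lambda>p. h (fst p) (fst (snd p)) (snd (snd p)))" "prim f" "prim g" "prim k"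
  shows "prim (\<lambda>x. h (f x) (g x) (k x))"
  using prim_comp[OF assms(1) prim_Pair[OF assms(2) prim_Pair[OF assms(3,4)]]] by simp

lemma prim_all_less [pr]:
  fixes n :: "'a :: coded \<Rightarrow> nat"
  assumes "prim (\<lambda>p. P (fst p) (snd p))" "prim n"
  shows "prim (\<lambda>x. \<forall>i<n x. P x i)"
proof -
  have "(\<forall>i<n x. P x i) \<longleftrightarrow> filter (\<lambda>i. \<not> P x i) [0..<n x] = []" for x
    by (auto simp: filter_empty_conv)
  moreover have "prim (\<lambda>x. filter (\<lambda>i. \<not> P x i) [0..<n x] = [])"
    by (intro pr assms prim_comp2[OF assms(1)])
  ultimately show ?thesis by simp
qed

text \<open>A simulated tape carries its index, the head position and the list of all writes;
  unwritten cells are given by the function \<open>B\<close>.\<close>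

type_synonym sim_tape = "nat \<times> int \<times> (int \<times> nat) list"

definition sim_cell :: "(nat \<Rightarrow> int \<Rightarrow> nat) \<Rightarrow> sim_tape \<Rightarrow> int \<Rightarrow> nat" where
  "sim_cell B a i = (case map_of (snd (snd a)) i of None \<Rightarrow> B (fst a) i | Some w \<Rightarrow> w)"

definition sim_lookup :: "(nat \<Rightarrow> int \<Rightarrow> nat) \<Rightarrow> tm \<Rightarrow> nat \<times> sim_tape list \<Rightarrow>
    (nat \<times> (nat \<times> int) list) option" where
  "sim_lookup B M c = map_of (snd M) (fst c, map (\<lambda>a. sim_cell B a (fst (snd a))) (snd c))"

definition sim_step :: "(nat \<Rightarrow> int \<Rightarrow> nat) \<Rightarrow> tm \<Rightarrow> nat \<times> sim_tape list \<Rightarrow> nat \<times> sim_tape list" where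
  "sim_step B M c = (case sim_lookup B M c of None \<Rightarrow> c
     | Some r \<Rightarrow> (fst r, map (\<lambda>p. (fst (snd p), fst (snd (snd p)) + snd (fst p),
         (fst (snd (snd p)), fst (fst p)) # snd (snd (snd p)))) (zip (snd r) (snd c))))"

definition sim_run :: "(nat \<Rightarrow> int \<Rightarrow> nat) \<Rightarrow> tm \<Rightarrow> nat \<Rightarrow> nat \<times> sim_tape list" where
  "sim_run B M t = (sim_step B M ^^ t) (0, map (\<lambda>i. (i, 0, [])) [0..<fst M])"

definition abs_config :: "(nat \<Rightarrow> int \<Rightarrow> nat) \<Rightarrow> nat \<times> sim_tape list \<Rightarrow> config" where
  "abs_config B c = (fst c, map (\<lambda>a. (fst (snd a), sim_cell B a)) (snd c))"

lemma sim_lookup: "tm_lookup M (abs_config B c) = sim_lookup B M c"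
  by (simp add: tm_lookup_def sim_lookup_def abs_config_def comp_def)

lemma sim_cell_write: "sim_cell B (fst a, h', (h, w) # snd (snd a)) = (sim_cell B a)(h := w)"
  by (rule ext) (simp add: sim_cell_def cong: option.case_cong)

lemma sim_step: "abs_config B (sim_step B M c) = tm_step M (abs_config B c)"
proof (cases "sim_lookup B M c")
  case None
  then show ?thesis by (simp add: sim_step_def tm_step_def sim_lookup)
next
  case (Some r)
  have "map (\<lambda>a. (fst (snd a), sim_cell B a)) (map (\<lambda>p. (fst (snd p), fst (snd (snd p)) + snd (fst p),
         (fst (snd (snd p)), fst (fst p)) # snd (snd (snd p)))) (zip acts xs)) =
      map2 (\<lambda>(w, d) (h, t). (h + d, t(h := w))) acts (map (\<lambda>a. (fst (snd a), sim_cell B a)) xs)"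
    for acts :: "(nat \<times> int) list" and xs
    by (rule nth_equalityI)
      (simp_all add: case_prod_unfold sim_cell_write)
  note writes = this
  obtain q acts where r: "r = (q, acts)" by force
  have l: "tm_lookup M (abs_config B c) = Some (q, acts)" using Some by (simp add: sim_lookup r)
  show ?thesis unfolding tm_step_def l sim_step_def Some r
    by (simp only: option.case prod.case abs_config_def fst_conv snd_conv writes)
qed

lemma sim_run:
  assumes "\<And>i. i < fst M \<Longrightarrow> B i = (if i < length ts then ts ! i else (\<lambda>_. 0))"
  shows "abs_config B (sim_run B M t) = tm_run M t (tm_init M ts)"
proof (induction t)
  case 0
  show ?case by (auto simp: sim_run_def abs_config_def tm_init_def sim_cell_def assms)
next
  case (Suc t)
  then show ?case by (simp add: sim_run_def sim_step tm_run_Suc)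
qed

text \<open>The initial contents \<open>B\<close> carry a parameter because they vary with the input
  and the oracle, which are themselves variables of the functions shown to be primitive
  recursive.\<close>

context
  fixes B :: "'e :: coded \<Rightarrow> nat \<Rightarrow> int \<Rightarrow> nat"
  assumes B: "prim (\<lambda>p. B (fst p) (fst (snd p)) (snd (snd p)))"
begin

lemma prim_sim_cell:
  assumes "prim u" "prim a" "prim i"
  shows "prim (\<lambda>x. sim_cell (B (u x)) (a x) (i x))"
  unfolding sim_cell_def by (intro pr assms prim_comp3[OF B] prim_comp[OF assms(2)])

lemma prim_sim_lookup:
  assumes "prim u" "prim M" "prim c"
  shows "prim (\<lambda>x. sim_lookup (B (u x)) (M x) (c x))"
  unfolding sim_lookup_def by (intro pr assms prim_sim_cell prim_comp[OF assms(1)])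

lemma prim_sim_step:
  assumes "prim u" "prim M" "prim c"
  shows "prim (\<lambda>x. sim_step (B (u x)) (M x) (c x))"
  unfolding sim_step_def by (intro pr assms prim_sim_lookup prim_comp[OF assms(3)])

lemma prim_sim_run:
  assumes "prim u" "prim M" "prim t"
  shows "prim (\<lambda>x. sim_run (B (u x)) (M x) (t x))"
  unfolding sim_run_def
  by (intro pr assms prim_sim_step prim_comp[OF assms(1)] prim_comp[OF assms(2)])

end

text \<open>Fixing the time \<open>t\<close> and the output \<open>m\<close> turns the semidecidable
  relation \<open>turing_functional\<close> into a decidable one; the quantifier over
  \<open>t\<close> is added outside.\<close>

definition sim_output :: "(nat \<Rightarrow> int \<Rightarrow> nat) \<Rightarrow> tm \<Rightarrow> nat \<Rightarrow> nat \<Rightarrow> bool" where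
  "sim_output B M t m \<longleftrightarrow> sim_lookup B M (sim_run B M t) = None \<and>
     (\<forall>i<m. sim_cell B (hd (snd (sim_run B M t))) (int i) = 2) \<and>
     sim_cell B (hd (snd (sim_run B M t))) (int m) = 0"

lemma prim_sim_output:
  assumes B: "prim (\<lambda>p. B (fst p) (fst (snd p)) (snd (snd p)))" and "prim u" "prim M" "prim t" "prim m"
  shows "prim (\<lambda>x. sim_output (B (u x)) (M x) (t x) (m x))"
  unfolding sim_output_def
  by (intro pr assms prim_sim_lookup prim_sim_run prim_sim_cell prim_comp[OF assms(2)]
    prim_comp[OF assms(3)] prim_comp[OF assms(4)] prim_comp[OF assms(5)])

definition oracle_base :: "(nat \<Rightarrow> nat) \<Rightarrow> nat \<Rightarrow> nat \<Rightarrow> int \<Rightarrow> nat" where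
  "oracle_base p n j i =
     (if j = 0 then if 0 \<le> i \<and> i < int n then 2 else 0
      else if j = 1 then
        if 0 \<le> i then if p (fst (prod_decode (nat i))) = snd (prod_decode (nat i)) then 2 else 1 else 0
      else 0)"

lemma oracle_base:
  "oracle_base p n j = (if j < length [string_tape (replicate n True), omega_tape (graph_seq p)]
     then [string_tape (replicate n True), omega_tape (graph_seq p)] ! j else (\<lambda>_. 0))"
  by (auto simp: fun_eq_iff oracle_base_def string_tape_def omega_tape_def bit_sym_def graph_seq_def
      less_Suc_eq nth_Cons split: nat.splits)

text \<open>Well-formed instructions act on all tapes, so none is lost. This is what makes
  \<open>hd\<close> of the simulated tapes denote tape 0.\<close>

lemma length_tm_step: "tm_wf M \<Longrightarrow> length (snd c) = fst M \<Longrightarrow> length (snd (tm_step M c)) = fst M"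
  by (fastforce simp: tm_step_def tm_wf_def tm_lookup_def split: option.splits dest!: map_of_SomeD)

lemma length_tm_run: "tm_wf M \<Longrightarrow> length (snd (tm_run M t (tm_init M ts))) = fst M"
  by (induction t) (simp_all add: tm_run_Suc length_tm_step, simp add: tm_init_def)

lemma sim_output_iff:
  fixes p n
  assumes "tm_wf M" "2 \<le> fst M"
  defines "c \<equiv> \<lambda>t. tm_run M t (tm_init M [string_tape (replicate n True), omega_tape (graph_seq p)])"
  shows "sim_output (oracle_base p n) M t m \<longleftrightarrow>
    tm_halted M (c t) \<and> tape_holds (snd (snd (c t) ! 0)) (replicate m True)"
proof -
  let ?B = "oracle_base p n"
  have r: "abs_config ?B (sim_run ?B M t) = c t"
    unfolding c_def by (rule sim_run) (rule oracle_base)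
  have "length (snd (sim_run ?B M t)) = length (snd (c t))"
    unfolding r[symmetric] by (simp add: abs_config_def)
  also have "\<dots> = fst M" unfolding c_def by (rule length_tm_run[OF assms(1)])
  finally have "snd (sim_run ?B M t) \<noteq> []" using assms(2) by auto
  then have "snd (snd (c t) ! 0) = sim_cell ?B (hd (snd (sim_run ?B M t)))"
    unfolding r[symmetric] by (simp add: abs_config_def hd_conv_nth)
  then show ?thesis
    unfolding sim_output_def tm_halted_def tape_holds_def
    by (simp add: bit_sym_def sim_lookup[symmetric] r)
qed

lemma turing_functional_iff:
  "turing_functional e p n m \<longleftrightarrow> tm_wf (tm_decode e) \<and> 2 \<le> fst (tm_decode e) \<and>
     (\<exists>t. sim_output (oracle_base p n) (tm_decode e) t m)"
  unfolding turing_functional_def Let_def using sim_output_iff by blast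

lemma prim_tm_decode [pr]: "prim f \<Longrightarrow> prim (\<lambda>x. tm_decode (f x))"
  by (rule prim_comp[of tm_decode]) (rule primI[OF prec_id], simp add: enc_tm_decode)

lemma tape_holds_unique:
  assumes "tape_holds t (replicate m True)" "tape_holds t (replicate m' True)"
  shows "m = m'"
proof (rule ccontr)
  have *: "\<not> m < m'" if "tape_holds t (replicate m True)" "tape_holds t (replicate m' True)" for m m'
    using that by (auto simp: tape_holds_def bit_sym_def)
  assume "m \<noteq> m'"
  with *[OF assms] *[OF assms(2,1)] show False by simp
qed

lemma tm_run_halted: "tm_halted M (tm_run M s c) \<Longrightarrow> s \<le> t \<Longrightarrow> tm_run M t c = tm_run M s c"
proof (induction t)
  case (Suc t)
  then show ?case
    by (cases "s = Suc t") (auto simp: tm_run_Suc tm_step_def tm_halted_def le_Suc_eq)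
qed simp

lemma sim_output_unique:
  assumes "tm_wf M" "2 \<le> fst M" "sim_output (oracle_base p n) M t m" "sim_output (oracle_base p n) M t' m'"
  shows "m = m'"
proof -
  define c where "c = (\<lambda>t. tm_run M t (tm_init M [string_tape (replicate n True), omega_tape (graph_seq p)]))"
  have h: "tm_halted M (c t)" "tape_holds (snd (snd (c t) ! 0)) (replicate m True)"
     "tm_halted M (c t')" "tape_holds (snd (snd (c t') ! 0)) (replicate m' True)"
    using assms(3,4) unfolding sim_output_iff[OF assms(1,2)] c_def by auto
  have "c t = c t'"
    using tm_run_halted[of M t _ t'] tm_run_halted[of M t' _ t] h(1,3) unfolding c_def
    by (metis nat_le_linear)
  then show ?thesis using h tape_holds_unique by metis
qed

lemma turing_functional_unique:
  "turing_functional e p n m \<Longrightarrow> turing_functional e p n m' \<Longrightarrow> m = m'"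
  unfolding turing_functional_iff using sim_output_unique by blast

subsection \<open>Searching for counterexamples of a \<open>\<Sigma>\<^sup>0\<^sub>2\<close> set\<close>

text \<open>The state \<open>(x, y, t)\<close> means that the relation is being evaluated at \<open>(x, y)\<close> and the
  evaluation has run for \<open>t\<close> steps; refuting the candidate \<open>x\<close> moves on to the next one.\<close>

definition query_code :: "nat \<Rightarrow> nat \<times> nat \<times> nat \<Rightarrow> nat" where
  "query_code z p = prod_encode (z, prod_encode (fst p, fst (snd p)))"

definition refuted :: "nat \<Rightarrow> nat \<Rightarrow> nat \<times> nat \<times> nat \<Rightarrow> bool" where
  "refuted e z p \<longleftrightarrow> sim_output (oracle_base (\<lambda>_. 0) (query_code z p)) (tm_decode e) (snd (snd p)) 0"

definition confirmed :: "nat \<Rightarrow> nat \<Rightarrow> nat \<times> nat \<times> nat \<Rightarrow> bool" where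
  "confirmed e z p \<longleftrightarrow> sim_output (oracle_base (\<lambda>_. 0) (query_code z p)) (tm_decode e) (snd (snd p)) 1"

definition search_step :: "nat \<Rightarrow> nat \<Rightarrow> nat \<times> nat \<times> nat \<Rightarrow> nat \<times> nat \<times> nat" where
  "search_step e z p =
     (if refuted e z p then (Suc (fst p), 0, 0)
      else if confirmed e z p then (fst p, Suc (fst (snd p)), 0)
      else (fst p, fst (snd p), Suc (snd (snd p))))"

definition search :: "nat \<Rightarrow> nat \<Rightarrow> nat \<Rightarrow> nat \<times> nat \<times> nat" where
  "search e z s = (search_step e z ^^ s) (0, 0, 0)"

lemma prim_oracle_base_const:
  "prim (\<lambda>p. oracle_base (\<lambda>_. 0) (fst p) (fst (snd p)) (snd (snd p)))"
  unfolding oracle_base_def by (intro pr)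

lemma prim_query_code [pr]: "prim f \<Longrightarrow> prim g \<Longrightarrow> prim (\<lambda>x. query_code (f x) (g x))"
  unfolding query_code_def by (intro pr)

lemma prim_refuted [pr]: "prim f \<Longrightarrow> prim g \<Longrightarrow> prim (\<lambda>x. refuted e (f x) (g x))"
  unfolding refuted_def by (intro pr prim_sim_output[OF prim_oracle_base_const])

lemma prim_confirmed [pr]: "prim f \<Longrightarrow> prim g \<Longrightarrow> prim (\<lambda>x. confirmed e (f x) (g x))"
  unfolding confirmed_def by (intro pr prim_sim_output[OF prim_oracle_base_const])

lemma prim_search [pr]: assumes "prim f" "prim g" shows "prim (\<lambda>x. search e (f x) (g x))"
  unfolding search_def search_step_def by (intro pr assms prim_comp[OF assms(1)])

lemma search_Suc: "search e z (Suc s) = search_step e z (search e z s)"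
  by (simp add: search_def)

lemma search_fst_mono: "s \<le> s' \<Longrightarrow> fst (search e z s) \<le> fst (search e z s')"
proof (induction s')
  case (Suc s')
  then show ?case by (cases "s = Suc s'") (auto simp: search_Suc search_step_def le_Suc_eq)
qed simp

text \<open>Each stage advances the candidate by at most one. Hence candidate \<open>m\<close> is
  refuted at stage \<open>m\<close> or later, which spreads the refutations over infinitely many
  stages.\<close>

lemma search_fst_le: "fst (search e z s) \<le> s"
  by (induction s) (auto simp: search_Suc search_step_def, simp add: search_def)

text \<open>An event is the refutation of the current candidate. A true witness is never refuted and
  stops the progress; without a witness every candidate is eventually refuted.\<close>

lemma Sigma02_events:
  assumes "Sigma02 S"
  shows "\<exists>E. prec E \<and> (\<forall>z. z \<in> S \<longleftrightarrow> \<not> (\<exists>\<^sub>\<infinity>s. E (prod_encode (z, s)) \<noteq> 0))"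
proof -
  obtain R g e where S: "\<And>z. z \<in> S \<longleftrightarrow> (\<exists>x. \<forall>y. R z x y)"
    and g: "\<And>z x y. g (prod_encode (z, prod_encode (x, y))) = of_bool (R z x y)"
    and e: "\<And>n. turing_functional e (\<lambda>_. 0) n (g n)"
    using assms unfolding Sigma02_def computable_rel3_def computable_fun_def by blast
  have wf: "tm_wf (tm_decode e)" "2 \<le> fst (tm_decode e)"
    using e unfolding turing_functional_iff by auto
  have out: "m = of_bool (R z (fst p) (fst (snd p)))"
    if "sim_output (oracle_base (\<lambda>_. 0) (query_code z p)) (tm_decode e) t m" for z p t m
  proof -
    have "turing_functional e (\<lambda>_. 0) (query_code z p) m"
      unfolding turing_functional_iff using wf that by blast
    from turing_functional_unique[OF this e] show ?thesis by (simp add: query_code_def g)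
  qed
  have ref: "\<not> R z (fst p) (fst (snd p))" if "refuted e z p" for z p
    using out[OF that[unfolded refuted_def]] by (cases "R z (fst p) (fst (snd p))") auto
  have conf: "R z (fst p) (fst (snd p))" if "confirmed e z p" for z p
    using out[OF that[unfolded confirmed_def]] by (cases "R z (fst p) (fst (snd p))") auto
  \<comment> \<open>The evaluation at \<open>(x, y)\<close> halts with output 0 or 1, so the growing
    step bound cannot increase forever without an answer.\<close>
  have progress: "\<exists>s'\<ge>s. search e z s' = (x, y, snd (snd (search e z s'))) \<and>
      (refuted e z (search e z s') \<or> confirmed e z (search e z s'))" if "search e z s = (x, y, 0)" for z s x y
  proof (rule ccontr)
    assume *: "\<not> ?thesis"
    have at: "search e z (s + t) = (x, y, t)" for t
    proof (induction t)
      case (Suc t)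
      have "\<not> refuted e z (search e z (s + t))" "\<not> confirmed e z (search e z (s + t))"
        using * Suc by (metis le_add1 snd_conv)+
      with Suc show ?case by (simp add: search_Suc search_step_def)
    qed (use that in simp)
    obtain t where t: "sim_output (oracle_base (\<lambda>_. 0) (query_code z (x, y, t))) (tm_decode e) t (g (query_code z (x, y, t)))"
      using e[of "query_code z (x, y, 0)"] unfolding turing_functional_iff by (auto simp: query_code_def)
    have "g (query_code z (x, y, t)) = 0 \<or> g (query_code z (x, y, t)) = 1"
      by (simp add: query_code_def g)
    with t have "refuted e z (search e z (s + t)) \<or> confirmed e z (search e z (s + t))"
      by (auto simp: refuted_def confirmed_def at)
    with * at[of t] show False by (metis le_add1 snd_conv)
  qed
  define E where "E = (\<lambda>c. of_bool (refuted e (fst (prod_decode c))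
    (search e (fst (prod_decode c)) (snd (prod_decode c)))) :: nat)"
  have "prec E" unfolding prec_iff_prim E_def by (intro pr)
  moreover have "z \<in> S \<longleftrightarrow> \<not> (\<exists>\<^sub>\<infinity>s. E (prod_encode (z, s)) \<noteq> 0)" for z
  proof
    assume "z \<in> S"
    then obtain x where x: "\<And>y. R z x y" using S by blast
    \<comment> \<open>The search cannot pass a witness \<open>x\<close>, because moving on from it
      would require a false instance of the relation at \<open>x\<close>.\<close>
    have le: "fst (search e z s) \<le> x" for s
    proof (induction s)
      case (Suc s)
      show ?case
      proof (cases "refuted e z (search e z s)")
        case True
        then have "fst (search e z s) \<noteq> x" using ref x by metis
        then show ?thesis using Suc True by (simp add: search_Suc search_step_def)
      qed (use Suc in \<open>auto simp: search_Suc search_step_def\<close>)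
    qed (simp add: search_def)
    show "\<not> (\<exists>\<^sub>\<infinity>s. E (prod_encode (z, s)) \<noteq> 0)"
    proof
      assume inf: "\<exists>\<^sub>\<infinity>s. E (prod_encode (z, s)) \<noteq> 0"
      have "\<exists>s. n \<le> fst (search e z s)" for n
      proof (induction n)
        case (Suc n)
        then obtain s where s: "n \<le> fst (search e z s)" by blast
        obtain s' where s': "s \<le> s'" "E (prod_encode (z, s')) \<noteq> 0"
          using inf unfolding INFM_nat_le by blast
        then have "refuted e z (search e z s')" by (simp add: E_def)
        then have "fst (search e z (Suc s')) = Suc (fst (search e z s'))"
          by (simp add: search_Suc search_step_def)
        then show ?case using search_fst_mono[OF s'(1), of e z] s by (intro exI[of _ "Suc s'"]) simp
      qed simp
      from this[of "Suc x"] le show False by (metis not_less_eq_eq)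
    qed
  next
    assume fin: "\<not> (\<exists>\<^sub>\<infinity>s. E (prod_encode (z, s)) \<noteq> 0)"
    show "z \<in> S"
    proof (rule ccontr)
      assume "z \<notin> S"
      then have nR: "\<exists>y. \<not> R z x y" for x using S by blast
      \<comment> \<open>If the candidate survived, every \<open>y\<close> would be confirmed in
        turn, including one at which the relation fails.\<close>
      have refutation: "\<exists>s'\<ge>s. refuted e z (search e z s') \<and> fst (search e z s') = x"
        if "search e z s = (x, 0, 0)" for s x
      proof (rule ccontr)
        assume *: "\<not> ?thesis"
        have "\<exists>s'\<ge>s. search e z s' = (x, y, 0) \<and> (\<forall>y'<y. R z x y')" for y
        proof (induction y)
          case (Suc y)
          then obtain s1 where s1: "s \<le> s1" "search e z s1 = (x, y, 0)" "\<forall>y'<y. R z x y'" by blast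
          obtain s2 where s2: "s1 \<le> s2" "search e z s2 = (x, y, snd (snd (search e z s2)))"
            "refuted e z (search e z s2) \<or> confirmed e z (search e z s2)"
            using progress[OF s1(2)] by blast
          have nr: "\<not> refuted e z (search e z s2)" using * s1(1) s2(1,2) by (metis fst_conv le_trans)
          then have c: "confirmed e z (search e z s2)" using s2(3) by blast
          have "search e z (Suc s2) = (x, Suc y, 0)"
            using nr c s2(2) by (simp add: search_Suc search_step_def) (metis fst_conv snd_conv)
          moreover have "R z x y" using conf[OF c] s2(2) by (metis fst_conv snd_conv)
          ultimately show ?case using s1 s2(1) by (intro exI[of _ "Suc s2"]) (auto simp: less_Suc_eq)
        qed (use that in auto)
        then show False using nR[of x] by (metis lessI)
      qed
      have reach: "\<exists>s. search e z s = (x, 0, 0)" for x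
      proof (induction x)
        case 0
        show ?case by (intro exI[of _ 0]) (simp add: search_def)
      next
        case (Suc x)
        then obtain s where "search e z s = (x, 0, 0)" by blast
        from refutation[OF this] obtain s' where "refuted e z (search e z s')" "fst (search e z s') = x" by blast
        then have "search e z (Suc s') = (Suc x, 0, 0)" by (simp add: search_Suc search_step_def)
        then show ?case by blast
      qed
      have "\<exists>s\<ge>m. E (prod_encode (z, s)) \<noteq> 0" for m
      proof -
        obtain s where "search e z s = (m, 0, 0)" using reach by blast
        from refutation[OF this] obtain s' where s': "refuted e z (search e z s')" "fst (search e z s') = m" by blast
        have "m \<le> s'" using search_fst_le[of e z s'] s'(2) by simp
        then show ?thesis using s'(1) by (intro exI[of _ s']) (simp add: E_def)
      qed
      then show False using fin unfolding INFM_nat_le by blast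
    qed
  qed
  ultimately show ?thesis by blast
qed

section \<open>Binary expansions\<close>

definition tail :: "nat \<Rightarrow> (nat \<Rightarrow> bool) \<Rightarrow> nat \<Rightarrow> bool" where
  "tail n \<alpha> i = \<alpha> (n + i)"

lemma summable_half: "summable (\<lambda>s. 1 / 2 ^ (s + 1) :: real)"
  using sums_summable[OF power_half_series] by (simp add: power_divide)

lemma summable_bin: "summable (\<lambda>s. of_bool (\<alpha> s) / 2 ^ (s + 1) :: real)"
  by (rule summable_comparison_test'[OF summable_half, of 0]) (simp add: of_bool_def)

lemma bin_val_nonneg: "0 \<le> bin_val \<alpha>"
  unfolding bin_val_def by (rule suminf_nonneg[OF summable_bin]) simp

lemma suminf_half: "(\<Sum>s. 1 / 2 ^ (s + 1) :: real) = 1"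
proof -
  have "(\<lambda>s. (1/2) ^ Suc s :: real) sums 1" by (rule power_half_series)
  then show ?thesis by (simp add: sums_iff power_divide)
qed

lemma bin_val_le_1: "bin_val \<alpha> \<le> 1"
proof -
  have "bin_val \<alpha> \<le> (\<Sum>s. 1 / 2 ^ (s + 1))"
    unfolding bin_val_def by (rule suminf_le[OF _ summable_bin summable_half]) (simp add: divide_right_mono)
  then show ?thesis by (simp only: suminf_half)
qed

lemma bin_val_unit: "bin_val \<alpha> \<in> {0..1}"
  using bin_val_nonneg bin_val_le_1 by simp

lemma bin_val_Suc: "2 * bin_val \<alpha> = of_bool (\<alpha> 0) + bin_val (tail 1 \<alpha>)"
proof -
  have "bin_val \<alpha> = of_bool (\<alpha> 0) / 2 + (\<Sum>s. of_bool (\<alpha> (Suc s)) / 2 ^ (Suc s + 1))"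
    unfolding bin_val_def using suminf_split_head[OF summable_bin[of \<alpha>]] by simp
  also have "(\<Sum>s. of_bool (\<alpha> (Suc s)) / 2 ^ (Suc s + 1)) = bin_val (tail 1 \<alpha>) / 2"
    using suminf_divide[OF summable_bin[of "tail 1 \<alpha>"], of 2]
    by (simp add: bin_val_def tail_def mult.commute)
  finally show ?thesis by simp
qed

lemma tail_0 [simp]: "tail 0 \<alpha> = \<alpha>"
  by (simp add: tail_def fun_eq_iff)

lemma bin_val_tail_Suc: "bin_val (tail (Suc n) \<alpha>) = 2 * bin_val (tail n \<alpha>) - of_bool (\<alpha> n)"
  using bin_val_Suc[of "tail n \<alpha>"] by (simp add: tail_def[abs_def])

text \<open>A nonzero quantity that doubles forever is unbounded. All digit-by-digit invariants are
  turned into equations in this way: the error doubles with each digit, yet stays bounded.\<close>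

lemma bounded_doubling:
  fixes u :: "nat \<Rightarrow> real"
  assumes "\<And>n. u (Suc n) = 2 * u n" "\<And>n. \<bar>u n\<bar> \<le> C"
  shows "u n = 0"
proof -
  have u: "u n = 2 ^ n * u 0" for n by (induction n) (simp_all add: assms(1))
  have "u 0 = 0"
  proof (rule ccontr)
    assume "u 0 \<noteq> 0"
    obtain n where "C / \<bar>u 0\<bar> < 2 ^ n" using real_arch_pow[of 2 "C / \<bar>u 0\<bar>"] by auto
    then have "C < \<bar>u n\<bar>" using \<open>u 0 \<noteq> 0\<close> by (simp add: u[of n] abs_mult field_simps)
    with assms(2)[of n] show False by simp
  qed
  then show ?thesis using u[of n] by simp
qed

lemma bin_val_unique:
  assumes "\<And>n. x (Suc n) = 2 * x n - of_bool (\<beta> n)" "\<And>n. \<bar>x n\<bar> \<le> C"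
  shows "x 0 = bin_val \<beta>"
proof -
  have "x n - bin_val (tail n \<beta>) = 0" for n
  proof (rule bounded_doubling)
    show "x (Suc n) - bin_val (tail (Suc n) \<beta>) = 2 * (x n - bin_val (tail n \<beta>))" for n
      by (simp add: assms(1) bin_val_tail_Suc)
    show "\<bar>x n - bin_val (tail n \<beta>)\<bar> \<le> C + 1" for n
      using assms(2)[of n] bin_val_nonneg[of "tail n \<beta>"] bin_val_le_1[of "tail n \<beta>"] by linarith
  qed
  from this[of 0] show ?thesis by simp
qed

lemma bin_val_surj: assumes "y \<in> {0..1}" shows "\<exists>\<beta>. bin_val \<beta> = y"
proof -
  \<comment> \<open>The greedy expansion: \<open>x n\<close> is the value still to be represented
    after \<open>n\<close> digits, doubled \<open>n\<close> times; it stays in the unit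
    interval.\<close>
  define x where "x = rec_nat y (\<lambda>_ r. 2 * r - of_bool (1/2 \<le> r))"
  have xS: "x (Suc n) = 2 * x n - of_bool (1/2 \<le> x n)" for n by (simp add: x_def)
  have "0 \<le> x n \<and> x n \<le> 1" for n
  proof (induction n)
    case 0
    show ?case using assms by (simp add: x_def)
  next
    case (Suc n)
    then show ?case by (auto simp: xS)
  qed
  then have "x 0 = bin_val (\<lambda>n. 1/2 \<le> x n)"
    by (intro bin_val_unique[where C = 1] xS) (simp add: abs_le_iff)
  moreover have "x 0 = y" by (simp add: x_def)
  ultimately show ?thesis by metis
qed

lemma bin_val_prefix:
  "bin_val \<alpha> = (\<Sum>s<n. of_bool (\<alpha> s) / 2 ^ (s + 1)) + bin_val (tail n \<alpha>) / 2 ^ n"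
proof (induction n)
  case (Suc n)
  have "bin_val (tail (Suc n) \<alpha>) / 2 ^ Suc n = bin_val (tail n \<alpha>) / 2 ^ n - of_bool (\<alpha> n) / 2 ^ (n + 1)"
    by (simp add: bin_val_tail_Suc diff_divide_distrib)
  with Suc show ?case by simp
qed simp

lemma bin_val_cong_le:
  assumes "\<And>i. i < n \<Longrightarrow> \<alpha> i = \<beta> i"
  shows "\<bar>bin_val \<alpha> - bin_val \<beta>\<bar> \<le> 1 / 2 ^ n"
proof -
  have "bin_val \<alpha> - bin_val \<beta> = (bin_val (tail n \<alpha>) - bin_val (tail n \<beta>)) / 2 ^ n"
    using bin_val_prefix[of \<alpha> n] bin_val_prefix[of \<beta> n] assms by (simp add: diff_divide_distrib)
  moreover have "\<bar>bin_val (tail n \<alpha>) - bin_val (tail n \<beta>)\<bar> \<le> 1"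
    using bin_val_unit[of "tail n \<alpha>"] bin_val_unit[of "tail n \<beta>"] by (auto simp: abs_le_iff)
  ultimately show ?thesis by (simp add: divide_right_mono)
qed

text \<open>The carry of a digit-wise comparison stays within \<open>{-1, 0, 1}\<close> exactly for two expansions
  of the same number.\<close>

lemma bin_val_eq_iff:
  "bin_val \<beta> = bin_val \<gamma> \<longleftrightarrow> (\<exists>d :: nat \<Rightarrow> int. d 0 = 0 \<and>
     (\<forall>n. d (Suc n) = 2 * d n + of_bool (\<beta> n) - of_bool (\<gamma> n) \<and> d n \<in> {-1, 0, 1}))"
proof
  assume eq: "bin_val \<beta> = bin_val \<gamma>"
  define d where "d = rec_nat 0 (\<lambda>n r. 2 * r + of_bool (\<beta> n) - of_bool (\<gamma> n) :: int)"
  have dS: "d (Suc n) = 2 * d n + of_bool (\<beta> n) - of_bool (\<gamma> n)" for n by (simp add: d_def)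
  \<comment> \<open>The integer carry equals a difference of two numbers in the unit interval, which
    leaves only the values -1, 0 and 1.\<close>
  have "real_of_int (d n) = bin_val (tail n \<gamma>) - bin_val (tail n \<beta>)" for n
    by (induction n) (auto simp: dS bin_val_tail_Suc eq, auto simp: d_def)
  then have "\<bar>real_of_int (d n)\<bar> \<le> 1" for n
    using bin_val_unit[of "tail n \<gamma>"] bin_val_unit[of "tail n \<beta>"] by (auto simp: abs_le_iff)
  then have "\<bar>d n\<bar> \<le> 1" for n by (metis of_int_abs of_int_le_1_iff)
  moreover have "i \<in> {-1, 0, 1}" if "\<bar>i\<bar> \<le> 1" for i :: int
    using that by auto
  ultimately have "d n \<in> {-1, 0, 1}" for n by blast
  then show "\<exists>d :: nat \<Rightarrow> int. d 0 = 0 \<and>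
     (\<forall>n. d (Suc n) = 2 * d n + of_bool (\<beta> n) - of_bool (\<gamma> n) \<and> d n \<in> {-1, 0, 1})"
    by (intro exI[of _ d]) (auto simp: dS, simp add: d_def)
next
  assume "\<exists>d :: nat \<Rightarrow> int. d 0 = 0 \<and>
     (\<forall>n. d (Suc n) = 2 * d n + of_bool (\<beta> n) - of_bool (\<gamma> n) \<and> d n \<in> {-1, 0, 1})"
  then obtain d :: "nat \<Rightarrow> int" where d: "d 0 = 0" "\<And>n. d (Suc n) = 2 * d n + of_bool (\<beta> n) - of_bool (\<gamma> n)"
    "\<And>n. d n \<in> {-1, 0, 1}" by blast
  have "real_of_int (d n) + bin_val (tail n \<beta>) - bin_val (tail n \<gamma>) = 0" for n
  proof (rule bounded_doubling)
    show "real_of_int (d (Suc n)) + bin_val (tail (Suc n) \<beta>) - bin_val (tail (Suc n) \<gamma>) =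
        2 * (real_of_int (d n) + bin_val (tail n \<beta>) - bin_val (tail n \<gamma>))" for n
      by (simp add: d(2) bin_val_tail_Suc)
    show "\<bar>real_of_int (d n) + bin_val (tail n \<beta>) - bin_val (tail n \<gamma>)\<bar> \<le> 2" for n
      using d(3)[of n] bin_val_unit[of "tail n \<gamma>"] bin_val_unit[of "tail n \<beta>"] by auto
  qed
  from this[of 0] show "bin_val \<beta> = bin_val \<gamma>" by (simp add: d(1))
qed

section \<open>Safety automata\<close>

text \<open>Every infinite path counts, so the set of runs is closed. Correctness can then be judged
  from finite prefixes, as the refutation test of part (a) requires.\<close>

definition safe_run :: "'q set \<Rightarrow> ('q \<times> bool \<times> bool \<times> 'q) set \<Rightarrow>
    (nat \<Rightarrow> bool) \<Rightarrow> (nat \<Rightarrow> bool) \<Rightarrow> (nat \<Rightarrow> 'q) \<Rightarrow> bool" where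
  "safe_run I Tr \<alpha> \<beta> r \<longleftrightarrow> r 0 \<in> I \<and> (\<forall>i. (r i, \<alpha> i, \<beta> i, r (Suc i)) \<in> Tr)"

definition safe_computes :: "'q set \<Rightarrow> ('q \<times> bool \<times> bool \<times> 'q) set \<Rightarrow> (real \<Rightarrow> real) \<Rightarrow> bool" where
  "safe_computes I Tr f \<longleftrightarrow> (\<forall>\<alpha>. (\<exists>r \<beta>. safe_run I Tr \<alpha> \<beta> r) \<and>
     (\<forall>r \<beta>. safe_run I Tr \<alpha> \<beta> r \<longrightarrow> bin_val \<beta> = f (bin_val \<alpha>)))"

definition safe_fun :: "(real \<Rightarrow> real) \<Rightarrow> bool" where
  "safe_fun f \<longleftrightarrow> (\<exists>(I :: nat set) Tr. finite I \<and> finite Tr \<and> safe_computes I Tr f)"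

text \<open>Constructions use structured states; a renaming into numbers via \<open>to_nat\<close>
  maps runs to runs in both directions.\<close>

lemma safe_funI:
  fixes I :: "'q :: countable set"
  assumes "finite I" "finite Tr" "safe_computes I Tr f"
  shows "safe_fun f"
proof -
  define h where "h = (\<lambda>(q, a :: bool, b :: bool, q'). (to_nat (q :: 'q), a, b, to_nat (q' :: 'q)))"
  have run: "safe_run I Tr \<alpha> \<beta> r \<Longrightarrow> safe_run (to_nat ` I) (h ` Tr) \<alpha> \<beta> (\<lambda>i. to_nat (r i))" for \<alpha> \<beta> r
    by (force simp: safe_run_def h_def image_iff)
  have run': "safe_run (to_nat ` I) (h ` Tr) \<alpha> \<beta> r \<Longrightarrow> safe_run I Tr \<alpha> \<beta> (\<lambda>i. from_nat (r i))" for \<alpha> \<beta> r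
  proof -
    assume r: "safe_run (to_nat ` I) (h ` Tr) \<alpha> \<beta> r"
    have "(from_nat (r i), \<alpha> i, \<beta> i, from_nat (r (Suc i))) \<in> Tr" for i
    proof -
      have "(r i, \<alpha> i, \<beta> i, r (Suc i)) \<in> h ` Tr" using r by (simp add: safe_run_def)
      then show ?thesis by (auto simp: h_def)
    qed
    then show ?thesis using r by (auto simp: safe_run_def)
  qed
  have "safe_computes (to_nat ` I) (h ` Tr) f"
    using assms(3) run run' unfolding safe_computes_def by blast
  then show ?thesis unfolding safe_fun_def using assms(1,2) by blast
qed

lemma safe_fun_transducer: assumes "safe_fun f" shows "transducer_fun f"
proof -
  obtain I :: "nat set" and Tr where *: "finite I" "finite Tr" "safe_computes I Tr f"
    using assms unfolding safe_fun_def by blast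
  define Q where "Q = I \<union> fst ` Tr \<union> (\<lambda>(_, _, _, q). q) ` Tr"
  define T where "T = \<lparr>t_delay = 0, t_states = Q, t_init = I, t_wait = {}, t_write = Tr\<rparr>"
  have "transducer_wf T" using * by (force simp: transducer_wf_def T_def Q_def)
  moreover have "transducer_run T \<alpha> r \<beta> \<longleftrightarrow> safe_run I Tr \<alpha> \<beta> r" for \<alpha> r \<beta>
    by (simp add: transducer_run_def T_def safe_run_def)
  ultimately show ?thesis using *(3) unfolding transducer_fun_def transducer_computes_def safe_computes_def
    by blast
qed

text \<open>A delay can be traded for guessing the next input bits.\<close>

lemma transducer_safe_fun: assumes "transducer_fun f" shows "safe_fun f"
proof -
  obtain T where T: "transducer_wf T" "transducer_computes T f"
    using assms unfolding transducer_fun_def by blast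
  define D where "D = t_delay T"
  \<comment> \<open>The automaton guesses the first \<open>D\<close> input bits \<open>w\<close> and
    starts in a state that the transducer can reach by reading them silently. From then on it is
    \<open>D\<close> bits ahead of its actual input.\<close>
  define I where "I = {(q, w). length w = D \<and> (\<exists>p. p 0 \<in> t_init T \<and> p D = q \<and>
    (\<forall>i<D. (p i, w ! i, p (Suc i)) \<in> t_wait T))} \<inter> t_states T \<times> {w. length w = D}"
  \<comment> \<open>The window of guessed bits is a queue: a new guess \<open>i\<close> enters and
    the oldest bit must equal the letter read. Appending before taking the head also covers
    \<open>D = 0\<close>, where the guess is the letter itself.\<close>
  define Tr where "Tr = (\<lambda>(w, i, b, q, q'). ((q, w), hd (w @ [i]), b, (q', tl (w @ [i])))) `
    {(w, i, b, q, q'). length w = D \<and> (q, i, b, q') \<in> t_write T}"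
  have fw: "finite {w :: bool list. length w = D}" using finite_lists_length_eq[of "UNIV :: bool set" D] by simp
  have ft: "finite (t_states T)" using T(1) by (simp add: transducer_wf_def)
  have "finite I" unfolding I_def by (rule finite_Int) (use ft fw in blast)
  moreover have "finite Tr" unfolding Tr_def
  proof (rule finite_imageI, rule finite_subset)
    show "{(w, i, b, q, q'). length w = D \<and> (q, i, b, q') \<in> t_write T} \<subseteq>
        {w. length w = D} \<times> UNIV \<times> UNIV \<times> t_states T \<times> t_states T"
      using T(1) by (auto simp: transducer_wf_def)
    show "finite ({w :: bool list. length w = D} \<times> (UNIV :: bool set) \<times> (UNIV :: bool set) \<times> t_states T \<times> t_states T)"
      using fw ft by simp
  qed
  moreover have "safe_computes I Tr f"
    unfolding safe_computes_def
  proof (intro allI conjI impI)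
    fix \<alpha>
    obtain r \<beta> where r: "transducer_run T \<alpha> r \<beta>" using T(2) unfolding transducer_computes_def by blast
    define w where "w = (\<lambda>j. map (\<lambda>i. \<alpha> (j + i)) [0..<D])"
    have wS: "hd (w j @ [\<alpha> (D + j)]) = \<alpha> j" "tl (w j @ [\<alpha> (D + j)]) = w (Suc j)" for j
    proof -
      have "w j @ [\<alpha> (D + j)] = map (\<lambda>i. \<alpha> (j + i)) [0..<Suc D]" by (simp add: w_def add.commute)
      also have "\<dots> = \<alpha> j # w (Suc j)" by (simp add: upt_conv_Cons map_Suc_upt[symmetric] comp_def w_def del: upt_Suc)
      finally show "hd (w j @ [\<alpha> (D + j)]) = \<alpha> j" "tl (w j @ [\<alpha> (D + j)]) = w (Suc j)" by simp_all
    qed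
    have wr: "(r (D + j), \<alpha> (D + j), \<beta> j, r (D + Suc j)) \<in> t_write T" for j
      using r by (simp add: transducer_run_def D_def)
    have "(r D, w 0) \<in> I"
      using r wr[of 0] T(1) unfolding I_def transducer_run_def transducer_wf_def
      by (auto simp: w_def D_def intro!: exI[of _ r])
    moreover have "((r (D + j), w j), \<alpha> j, \<beta> j, (r (D + Suc j), w (Suc j))) \<in> Tr" for j
      unfolding Tr_def
      by (rule image_eqI[of _ _ "(w j, \<alpha> (D + j), \<beta> j, r (D + j), r (D + Suc j))"])
        (use wr[of j] in \<open>simp_all add: wS, simp add: w_def\<close>)
    ultimately have "safe_run I Tr \<alpha> \<beta> (\<lambda>j. (r (D + j), w j))"
      by (simp add: safe_run_def)
    then show "\<exists>r \<beta>. safe_run I Tr \<alpha> \<beta> r" by blast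
  next
    fix \<alpha> r \<beta>
    assume r: "safe_run I Tr \<alpha> \<beta> r"
    have rS: "(r j, \<alpha> j, \<beta> j, r (Suc j)) \<in> Tr" for j using r by (simp add: safe_run_def)
    have len: "length (snd (r j)) = D" for j using rS[of j] by (auto simp: Tr_def)
    define w where "w = (\<lambda>j. snd (r j))"
    have "\<exists>i. (fst (r j), i, \<beta> j, fst (r (Suc j))) \<in> t_write T \<and> \<alpha> j = hd (w j @ [i]) \<and>
        w (Suc j) = tl (w j @ [i])" for j
      using rS[of j] unfolding w_def Tr_def by auto
    then obtain x where x: "\<And>j. (fst (r j), x j, \<beta> j, fst (r (Suc j))) \<in> t_write T"
      "\<And>j. \<alpha> j = hd (w j @ [x j])" "\<And>j. w (Suc j) = tl (w j @ [x j])" by metis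
    have wx: "w j @ [x j] = \<alpha> j # w (Suc j)" for j
      using x(2,3)[of j] by (cases "w j @ [x j]") auto
    \<comment> \<open>Every bit of the window reaches the front after finitely many steps and is
      compared with the input there, so an infinite run admits only correct guesses.\<close>
    have wn: "w j ! i = \<alpha> (j + i)" if "i < D" for i j
      using that
    proof (induction i arbitrary: j)
      case 0
      then have "w j \<noteq> []" using len[of j] by (auto simp: w_def)
      then show ?case using x(2)[of j] by (simp add: hd_conv_nth[symmetric])
    next
      case (Suc i)
      have "w j ! Suc i = (w j @ [x j]) ! Suc i" using Suc.prems len[of j] by (simp add: nth_append w_def)
      also have "\<dots> = w (Suc j) ! i" by (simp add: wx)
      finally show ?case using Suc.IH[of "Suc j"] Suc.prems by simp
    qed
    have xa: "x j = \<alpha> (D + j)" for j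
    proof (cases D)
      case 0
      then have "w j = []" using len[of j] by (simp add: w_def)
      then show ?thesis using x(2)[of j] 0 by simp
    next
      case (Suc D')
      have "x j = (w j @ [x j]) ! D" using len[of j] by (simp add: w_def nth_append)
      also have "\<dots> = w (Suc j) ! D'" by (simp add: wx Suc)
      finally show ?thesis using wn[of D' "Suc j"] Suc by (simp add: add.commute)
    qed
    obtain p where p: "p 0 \<in> t_init T" "p D = fst (r 0)" "\<And>i. i < D \<Longrightarrow> (p i, w 0 ! i, p (Suc i)) \<in> t_wait T"
      using r unfolding safe_run_def I_def w_def by (cases "r 0") auto
    define r' where "r' = (\<lambda>i. if i \<le> D then p i else fst (r (i - D)))"
    have "transducer_run T \<alpha> r' \<beta>"
      unfolding transducer_run_def D_def[symmetric]
    proof (intro conjI allI impI)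
      show "r' 0 \<in> t_init T" using p by (simp add: r'_def)
      show "(r' i, \<alpha> i, r' (Suc i)) \<in> t_wait T" if "i < D" for i
        using p(3)[OF that] wn[OF that, of 0] that by (simp add: r'_def)
      have "r' (D + j) = fst (r j)" for j using p(2) by (simp add: r'_def)
      then show "(r' (D + j), \<alpha> (D + j), \<beta> j, r' (Suc (D + j))) \<in> t_write T" for j
        using x(1)[of j] by (simp add: xa flip: add_Suc_right)
    qed
    then show "bin_val \<beta> = f (bin_val \<alpha>)" using T(2) unfolding transducer_computes_def by blast
  qed
  ultimately show ?thesis by (rule safe_funI)
qed

text \<open>Taking all states as accepting turns existence of an infinite run into acceptance by a
  Buchi automaton.\<close>

lemma regular_funI:
  fixes I :: "'q :: countable set"
  assumes "finite I" "finite Tr"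
    and "\<And>\<alpha> \<beta>. (\<exists>r. r 0 \<in> I \<and> (\<forall>i. (r i, interleave \<alpha> \<beta> i, r (Suc i)) \<in> Tr)) \<longleftrightarrow>
      f (bin_val \<alpha>) = bin_val \<beta>"
  shows "regular_fun f"
proof -
  define h where "h = (\<lambda>(q, a :: bool, q'). (to_nat (q :: 'q), a, to_nat (q' :: 'q)))"
  define Q where "Q = to_nat ` (I \<union> fst ` Tr \<union> (\<lambda>(_, _, q). q) ` Tr)"
  define A where "A = \<lparr>b_states = Q, b_init = to_nat ` I, b_trans = h ` Tr, b_acc = Q\<rparr>"
  have "buchi_wf A" using assms(1,2) by (force simp: buchi_wf_def A_def Q_def h_def)
  moreover have "buchi_accepts A w \<longleftrightarrow> (\<exists>r. r 0 \<in> I \<and> (\<forall>i. (r i, w i, r (Suc i)) \<in> Tr))" for w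
  proof
    assume "buchi_accepts A w"
    then obtain r where r: "r 0 \<in> to_nat ` I" "\<And>i. (r i, w i, r (Suc i)) \<in> h ` Tr"
      unfolding buchi_accepts_def A_def by auto
    have "(from_nat (r i), w i, from_nat (r (Suc i))) \<in> Tr" for i
      using r(2)[of i] by (auto simp: h_def)
    then show "\<exists>r. r 0 \<in> I \<and> (\<forall>i. (r i, w i, r (Suc i)) \<in> Tr)"
      using r(1) by (intro exI[of _ "\<lambda>i. from_nat (r i)"]) auto
  next
    assume "\<exists>r. r 0 \<in> I \<and> (\<forall>i. (r i, w i, r (Suc i)) \<in> Tr)"
    then obtain r where r: "r 0 \<in> I" "\<And>i. (r i, w i, r (Suc i)) \<in> Tr" by blast
    have "(to_nat (r i), w i, to_nat (r (Suc i))) \<in> h ` Tr" for i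
      using r(2)[of i] by (force simp: h_def image_iff)
    moreover have "to_nat (r i) \<in> Q" for i using r(2)[of i] by (force simp: Q_def)
    ultimately show "buchi_accepts A w"
      unfolding buchi_accepts_def A_def using r(1) by (intro exI[of _ "\<lambda>i. to_nat (r i)"]) auto
  qed
  ultimately show ?thesis unfolding regular_fun_def using assms(3) by (intro exI[of _ A]) simp
qed

lemma interleave_even [simp]: "interleave \<alpha> \<beta> (2 * i) = \<alpha> i"
  by (simp add: interleave_def)

lemma interleave_odd [simp]: "interleave \<alpha> \<beta> (Suc (2 * i)) = \<beta> i"
  by (simp add: interleave_def)

text \<open>The automaton may produce only some expansions of the value, whereas a regular function
  needs all of them to be accepted. The Buchi automaton guesses an expansion produced by a run and
  compares it with the given one through the bounded carry.\<close>

lemma safe_fun_regular: assumes "safe_fun f" shows "regular_fun f"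
proof -
  obtain I :: "nat set" and Tr where *: "finite I" "finite Tr" "safe_computes I Tr f"
    using assms unfolding safe_fun_def by blast
  define Q where "Q = I \<union> fst ` Tr \<union> (\<lambda>(_, _, _, q). q) ` Tr"
  \<comment> \<open>The last component splits each step of the automaton in two: it is
    \<open>None\<close> before an input bit and stores this bit until the output bit
    arrives.\<close>
  define S where "S = Q \<times> {-1, 0, 1 :: int} \<times> (UNIV :: bool option set)"
  define I' where "I' = (\<lambda>q. (q, 0 :: int, None :: bool option)) ` I"
  define ok where "ok = (\<lambda>(x :: nat \<times> int \<times> bool option) a (y :: nat \<times> int \<times> bool option). case snd (snd x) of
      None \<Rightarrow> y = (fst x, fst (snd x), Some a)
    | Some a' \<Rightarrow> snd (snd y) = None \<and> (\<exists>b'. (fst x, a', b', fst y) \<in> Tr \<and>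
        fst (snd y) = 2 * fst (snd x) + of_bool a - of_bool b'))"
  define Tr' where "Tr' = {(x, a, y). x \<in> S \<and> y \<in> S \<and> ok x a y}"
  have fS: "finite S" using * by (simp add: S_def Q_def)
  have "finite I'" using * by (simp add: I'_def)
  have "finite Tr'"
  proof (rule finite_subset)
    show "Tr' \<subseteq> S \<times> UNIV \<times> S" by (auto simp: Tr'_def)
  qed (intro finite_cartesian_product fS finite)
  have read: "y = (fst x, fst (snd x), Some a)" if "(x, a, y) \<in> Tr'" "snd (snd x) = None" for x a y
    using that by (simp add: Tr'_def ok_def)
  have written: "(\<exists>b'. (fst x, a, b', fst y) \<in> Tr \<and>
      fst (snd y) = 2 * fst (snd x) + of_bool b - of_bool b') \<and> snd (snd y) = None"
    if "(x, b, y) \<in> Tr'" "snd (snd x) = Some a" for x a b y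
    using that by (simp add: Tr'_def ok_def)
  have carry: "fst (snd x) \<in> {-1, 0, 1}" if "(x, b, y) \<in> Tr'" for x b y
    using that by (simp add: Tr'_def S_def mem_Times_iff)
  note \<open>finite I'\<close> \<open>finite Tr'\<close>
  moreover have "(\<exists>r. r 0 \<in> I' \<and> (\<forall>i. (r i, interleave \<alpha> \<beta> i, r (Suc i)) \<in> Tr')) \<longleftrightarrow>
      f (bin_val \<alpha>) = bin_val \<beta>" for \<alpha> \<beta>
  proof
    assume "\<exists>r. r 0 \<in> I' \<and> (\<forall>i. (r i, interleave \<alpha> \<beta> i, r (Suc i)) \<in> Tr')"
    then obtain r where r: "r 0 \<in> I'" "\<And>i. (r i, interleave \<alpha> \<beta> i, r (Suc i)) \<in> Tr'" by blast
    define q where "q = (\<lambda>i. fst (r (2 * i)))"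
    define d where "d = (\<lambda>i. fst (snd (r (2 * i))))"
    have two: "(\<exists>b'. (q i, \<alpha> i, b', q (Suc i)) \<in> Tr \<and> d (Suc i) = 2 * d i + of_bool (\<beta> i) - of_bool b') \<and>
        snd (snd (r (2 * Suc i))) = None" if "snd (snd (r (2 * i))) = None" for i
    proof -
      have "r (Suc (2 * i)) = (q i, d i, Some (\<alpha> i))"
        using read[OF r(2)[of "2 * i"] that] by (simp add: q_def d_def)
      with written[OF r(2)[of "Suc (2 * i)"], of "\<alpha> i"] show ?thesis
        by (simp add: q_def d_def)
    qed
    have none: "snd (snd (r (2 * i))) = None" for i
      by (induction i) (use r(1) two in \<open>auto simp: I'_def\<close>)
    obtain \<beta>' where b: "\<And>i. (q i, \<alpha> i, \<beta>' i, q (Suc i)) \<in> Tr"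
      "\<And>i. d (Suc i) = 2 * d i + of_bool (\<beta> i) - of_bool (\<beta>' i)"
      using two none by metis
    have "safe_run I Tr \<alpha> \<beta>' q" using r(1) b(1) by (auto simp: safe_run_def q_def I'_def)
    then have "bin_val \<beta>' = f (bin_val \<alpha>)" using *(3) unfolding safe_computes_def by blast
    moreover have "d i \<in> {-1, 0, 1}" for i unfolding d_def by (rule carry[OF r(2)])
    moreover have "d 0 = 0" using r(1) by (auto simp: d_def I'_def)
    ultimately show "f (bin_val \<alpha>) = bin_val \<beta>"
      using bin_val_eq_iff[of \<beta> \<beta>'] b(2) by metis
  next
    assume eq: "f (bin_val \<alpha>) = bin_val \<beta>"
    obtain q \<beta>' where q: "safe_run I Tr \<alpha> \<beta>' q" "bin_val \<beta>' = f (bin_val \<alpha>)"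
      using *(3) unfolding safe_computes_def by blast
    have "bin_val \<beta> = bin_val \<beta>'" using eq q by simp
    then obtain d :: "nat \<Rightarrow> int" where d: "d 0 = 0" "\<And>n. d (Suc n) = 2 * d n + of_bool (\<beta> n) - of_bool (\<beta>' n)"
      "\<And>n. d n \<in> {-1, 0, 1}" unfolding bin_val_eq_iff by blast
    define r where "r = (\<lambda>i. (q (i div 2), d (i div 2), if even i then None else Some (\<alpha> (i div 2))))"
    have tr: "(q i, \<alpha> i, \<beta>' i, q (Suc i)) \<in> Tr" for i using q(1) by (simp add: safe_run_def)
    have qQ: "q i \<in> Q" for i using tr[of i] by (force simp: Q_def)
    have "(r i, interleave \<alpha> \<beta> i, r (Suc i)) \<in> Tr'" for i
    proof (cases "even i")
      case True
      then obtain j where "i = 2 * j" by blast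
      then show ?thesis using qQ d(3) by (simp add: r_def Tr'_def S_def ok_def)
    next
      case False
      then obtain j where i: "i = Suc (2 * j)" by (metis oddE Suc_eq_plus1)
      have "ok (r i) (\<beta> j) (r (Suc i))"
        using d(2)[of j] tr[of j] unfolding ok_def by (auto simp: r_def i)
      moreover have "r i \<in> S" "r (Suc i) \<in> S" using qQ d(3) by (simp_all add: r_def S_def)
      ultimately show ?thesis by (simp add: Tr'_def i)
    qed
    moreover have "r 0 \<in> I'" using q(1) d(1) by (simp add: r_def I'_def safe_run_def)
    ultimately show "\<exists>r. r 0 \<in> I' \<and> (\<forall>i. (r i, interleave \<alpha> \<beta> i, r (Suc i)) \<in> Tr')" by blast
  qed
  ultimately show ?thesis by (rule regular_funI)
qed

text \<open>Agreement of longer and longer prefixes means convergence of the values, so this is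
  closedness of the graph, expressed in terms of expansions.\<close>

lemma graph_limit:
  assumes "continuous_on {0..1} f"
    and "\<And>n. \<exists>\<alpha>' \<beta>'. (\<forall>i<n. \<alpha>' i = \<alpha> i \<and> \<beta>' i = \<beta> i) \<and> f (bin_val \<alpha>') = bin_val \<beta>'"
  shows "f (bin_val \<alpha>) = bin_val \<beta>"
proof -
  obtain a b where ab: "\<And>n i. i < n \<Longrightarrow> a n i = \<alpha> i \<and> b n i = \<beta> i" "\<And>n. f (bin_val (a n)) = bin_val (b n)"
    using assms(2) by metis
  have lim: "(\<lambda>n. bin_val (c n)) \<longlonglongrightarrow> bin_val \<gamma>" if "\<And>n i. i < n \<Longrightarrow> c n i = \<gamma> i" for c \<gamma>
  proof (rule LIM_zero_cancel, rule Lim_null_comparison)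
    show "\<forall>\<^sub>F n in sequentially. norm (bin_val (c n) - bin_val \<gamma>) \<le> 1 / 2 ^ n"
      using that bin_val_cong_le by (intro always_eventually) simp
    show "(\<lambda>n. 1 / 2 ^ n :: real) \<longlonglongrightarrow> 0"
      using LIMSEQ_realpow_zero[of "1/2 :: real"] by (simp add: power_divide)
  qed
  have "(\<lambda>n. f (bin_val (a n))) \<longlonglongrightarrow> f (bin_val \<alpha>)"
    by (rule continuous_on_tendsto_compose[OF assms(1) lim]) (use ab bin_val_unit in auto)
  moreover have "(\<lambda>n. bin_val (b n)) \<longlonglongrightarrow> bin_val \<beta>" by (rule lim) (use ab in auto)
  ultimately show ?thesis using LIMSEQ_unique ab(2) by auto
qed

text \<open>The graph of a continuous function is closed, so after discarding states without accepting
  continuation the acceptance condition becomes redundant.\<close>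

lemma regular_safe_fun:
  assumes "regular_fun f" "continuous_on {0..1} f" "f ` {0..1} \<subseteq> {0..1}"
  shows "safe_fun f"
proof -
  obtain A where A: "buchi_wf A" "\<And>\<alpha> \<beta>. buchi_accepts A (interleave \<alpha> \<beta>) \<longleftrightarrow> f (bin_val \<alpha>) = bin_val \<beta>"
    using assms(1) unfolding regular_fun_def by blast
  \<comment> \<open>The accepting continuation may read any word whatsoever, even one that has
    nothing to do with the current input; the limit argument below corrects for this.\<close>
  define live where "live = (\<lambda>q. \<exists>w r. r 0 = q \<and> (\<forall>i. (r i, w i, r (Suc i)) \<in> b_trans A) \<and> (\<exists>\<^sub>\<infinity>i. r i \<in> b_acc A))"
  define Tr where "Tr = {(q, a, b, q''). live q'' \<and> (\<exists>q'. (q, a, q') \<in> b_trans A \<and> (q', b, q'') \<in> b_trans A)}"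
  have fin: "finite (b_states A)" using A(1) by (simp add: buchi_wf_def)
  have "finite Tr"
  proof (rule finite_subset)
    show "Tr \<subseteq> b_states A \<times> UNIV \<times> UNIV \<times> b_states A" using A(1) by (auto simp: Tr_def buchi_wf_def)
    show "finite (b_states A \<times> (UNIV :: bool set) \<times> (UNIV :: bool set) \<times> b_states A)" using fin by simp
  qed
  moreover have "finite (b_init A)" using A(1) fin by (auto simp: buchi_wf_def intro: finite_subset)
  moreover have "safe_computes (b_init A) Tr f"
    unfolding safe_computes_def
  proof (intro allI conjI impI)
    fix \<alpha>
    obtain \<beta> where "bin_val \<beta> = f (bin_val \<alpha>)" using bin_val_surj assms(3) bin_val_unit by blast
    then obtain r where r: "r 0 \<in> b_init A" "\<And>i. (r i, interleave \<alpha> \<beta> i, r (Suc i)) \<in> b_trans A"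
      "\<exists>\<^sub>\<infinity>i. r i \<in> b_acc A" using A(2)[of \<alpha> \<beta>] unfolding buchi_accepts_def by auto
    have "live (r n)" for n
      unfolding live_def
    proof (intro exI conjI allI)
      show "r (n + 0) = r n" by simp
      show "(r (n + i), interleave \<alpha> \<beta> (n + i), r (n + Suc i)) \<in> b_trans A" for i using r(2)[of "n + i"] by simp
      show "\<exists>\<^sub>\<infinity>i. r (n + i) \<in> b_acc A"
        unfolding INFM_nat_le
      proof
        fix m
        obtain k where "n + m \<le> k" "r k \<in> b_acc A" using r(3) unfolding INFM_nat_le by blast
        then show "\<exists>i\<ge>m. r (n + i) \<in> b_acc A" by (intro exI[of _ "k - n"]) auto
      qed
    qed
    then have "(r (2 * i), \<alpha> i, \<beta> i, r (2 * Suc i)) \<in> Tr" for i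
      using r(2)[of "2 * i"] r(2)[of "Suc (2 * i)"] unfolding Tr_def by auto
    then have "safe_run (b_init A) Tr \<alpha> \<beta> (\<lambda>i. r (2 * i))" using r(1) by (simp add: safe_run_def)
    then show "\<exists>r \<beta>. safe_run (b_init A) Tr \<alpha> \<beta> r" by blast
  next
    fix \<alpha> r \<beta>
    assume r: "safe_run (b_init A) Tr \<alpha> \<beta> r"
    then have rt: "(r i, \<alpha> i, \<beta> i, r (Suc i)) \<in> Tr" for i by (simp add: safe_run_def)
    then have "\<exists>q'. (r i, \<alpha> i, q') \<in> b_trans A \<and> (q', \<beta> i, r (Suc i)) \<in> b_trans A" for i
      unfolding Tr_def by blast
    then obtain m where m: "\<And>i. (r i, \<alpha> i, m i) \<in> b_trans A" "\<And>i. (m i, \<beta> i, r (Suc i)) \<in> b_trans A"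
      by metis
    have "f (bin_val \<alpha>) = bin_val \<beta>"
    proof (rule graph_limit[OF assms(2)])
      fix n
      \<comment> \<open>The first \<open>n + 1\<close> pairs of the run are kept and the accepting
        continuation is appended. The resulting accepted pair lies on the graph and agrees with the
        given one on a prefix.\<close>
      have "live (r (Suc n))" using rt[of n] by (simp add: Tr_def)
      then obtain w \<rho> where \<rho>: "\<rho> 0 = r (Suc n)" "\<And>i. (\<rho> i, w i, \<rho> (Suc i)) \<in> b_trans A" "\<exists>\<^sub>\<infinity>i. \<rho> i \<in> b_acc A"
        unfolding live_def by blast
      define N where "N = 2 * Suc n"
      define u where "u = (\<lambda>i. if i < N then interleave \<alpha> \<beta> i else w (i - N))"
      define s where "s = (\<lambda>i. if i < N then if even i then r (i div 2) else m (i div 2) else \<rho> (i - N))"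
      have "u = interleave (\<lambda>i. u (2 * i)) (\<lambda>i. u (Suc (2 * i)))"
        by (auto simp: fun_eq_iff interleave_def)
      moreover have "buchi_accepts A u"
        unfolding buchi_accepts_def
      proof (intro exI[of _ s] conjI allI)
        show "s 0 \<in> b_init A" using r by (simp add: s_def N_def safe_run_def)
        show "(s i, u i, s (Suc i)) \<in> b_trans A" for i
        proof (cases "i < N")
          case True
          show ?thesis
          proof (cases "even i")
            case True
            then obtain j where j: "i = 2 * j" by blast
            with \<open>i < N\<close> have "Suc i < N" by (simp add: N_def) presburger
            then show ?thesis using m(1)[of j] \<open>i < N\<close> j by (simp add: s_def u_def)
          next
            case False
            then obtain j where j: "i = Suc (2 * j)" by (metis oddE Suc_eq_plus1)
            have "s (Suc i) = r (Suc j)"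
            proof (cases "Suc i < N")
              case False
              then have "j = n" using \<open>i < N\<close> j by (simp add: N_def)
              then show ?thesis using False j \<rho>(1) by (simp add: s_def N_def)
            qed (use j in \<open>simp add: s_def\<close>)
            then show ?thesis using m(2)[of j] \<open>i < N\<close> j by (simp add: s_def u_def)
          qed
        next
          case False
          then have "Suc i - N = Suc (i - N)" by simp
          then show ?thesis using \<rho>(2)[of "i - N"] False by (simp add: s_def u_def)
        qed
        show "\<exists>\<^sub>\<infinity>i. s i \<in> b_acc A"
          unfolding INFM_nat_le
        proof
          fix k
          obtain i where "k \<le> i" "\<rho> i \<in> b_acc A" using \<rho>(3) unfolding INFM_nat_le by blast
          then show "\<exists>i\<ge>k. s i \<in> b_acc A" by (intro exI[of _ "i + N"]) (simp add: s_def)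
        qed
      qed
      ultimately have "f (bin_val (\<lambda>i. u (2 * i))) = bin_val (\<lambda>i. u (Suc (2 * i)))" using A(2) by metis
      moreover have "\<forall>i<n. u (2 * i) = \<alpha> i \<and> u (Suc (2 * i)) = \<beta> i" by (simp add: u_def N_def)
      ultimately show "\<exists>\<alpha>' \<beta>'. (\<forall>i<n. \<alpha>' i = \<alpha> i \<and> \<beta>' i = \<beta> i) \<and> f (bin_val \<alpha>') = bin_val \<beta>'"
        by (intro exI[of _ "\<lambda>i. u (2 * i)"] exI[of _ "\<lambda>i. u (Suc (2 * i))"]) simp
    qed
    then show "bin_val \<beta> = f (bin_val \<alpha>)" by simp
  qed
  ultimately show ?thesis by (intro safe_funI[of "b_init A" Tr])
qed

section \<open>Computable functions are continuous\<close>

text \<open>Within \<open>t\<close> steps no head leaves the cells at distance \<open>t\<close> from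
  the origin, so the initial contents beyond them are invisible.\<close>

lemma sim_run_cong:
  assumes "tm_wf M" "\<And>j i. \<bar>i\<bar> \<le> int t \<Longrightarrow> B j i = B' j i"
  shows "sim_run B M t = sim_run B' M t \<and> (\<forall>a \<in> set (snd (sim_run B M t)). \<bar>fst (snd a)\<bar> \<le> int t)"
  using assms(2)
proof (induction t)
  case 0
  show ?case by (auto simp: sim_run_def)
next
  case (Suc t)
  let ?c = "sim_run B M t"
  have IH: "sim_run B M t = sim_run B' M t" "\<forall>a \<in> set (snd ?c). \<bar>fst (snd a)\<bar> \<le> int t"
    using Suc.IH Suc.prems by force+
  have "sim_lookup B M ?c = sim_lookup B' M ?c"
  proof -
    have "map (\<lambda>a. sim_cell B a (fst (snd a))) (snd ?c) = map (\<lambda>a. sim_cell B' a (fst (snd a))) (snd ?c)"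
      using IH(2) Suc.prems by (auto simp: sim_cell_def split: option.splits)
    then show ?thesis by (simp only: sim_lookup_def)
  qed
  then have 1: "sim_run B M (Suc t) = sim_run B' M (Suc t)"
    using IH(1) by (simp add: sim_run_def sim_step_def)
  have "\<bar>fst (snd a)\<bar> \<le> int (Suc t)" if mem: "a \<in> set (snd (sim_step B M ?c))" for a
  proof (cases "sim_lookup B M ?c")
    case None
    then show ?thesis using mem IH(2) by (force simp: sim_step_def)
  next
    case (Some r)
    have r: "\<forall>(w, d) \<in> set (snd r). d \<in> {-1, 0, 1}"
      using assms(1) map_of_SomeD[OF Some[unfolded sim_lookup_def]] unfolding tm_wf_def by force
    obtain x y where xy: "(x, y) \<in> set (zip (snd r) (snd ?c))" "fst (snd a) = fst (snd y) + snd x"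
    proof -
      have "a \<in> (\<lambda>p. (fst (snd p), fst (snd (snd p)) + snd (fst p),
         (fst (snd (snd p)), fst (fst p)) # snd (snd (snd p)))) ` set (zip (snd r) (snd ?c))"
        using mem unfolding sim_step_def Some by simp
      then obtain p where "p \<in> set (zip (snd r) (snd ?c))" "fst (snd a) = fst (snd (snd p)) + snd (fst p)"
        by auto
      then show thesis using that[of "fst p" "snd p"] by simp
    qed
    have "snd x \<in> {-1, 0, 1}" using r set_zip_leftD[OF xy(1)] by (cases x) force
    moreover have "\<bar>fst (snd y)\<bar> \<le> int t" using IH(2) set_zip_rightD[OF xy(1)] by blast
    ultimately show ?thesis using xy(2) by auto
  qed
  then show ?case using 1 by (simp add: sim_run_def)
qed

lemma use_principle:
  assumes "turing_functional e p n m"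
  shows "\<exists>T. \<forall>p'. (\<forall>i\<le>T. p' i = p i) \<longrightarrow> turing_functional e p' n m"
proof -
  let ?M = "tm_decode e"
  obtain t where t: "tm_wf ?M" "2 \<le> fst ?M" "sim_output (oracle_base p n) ?M t m"
    using assms unfolding turing_functional_iff by blast
  \<comment> \<open>The computation looks at cells up to \<open>t\<close> and the output check at
    cells up to \<open>m\<close>; cell \<open>i\<close> of the oracle tape concerns an argument of
    \<open>p\<close> that is at most \<open>i\<close>.\<close>
  have "turing_functional e p' n m" if p': "\<forall>i\<le>t + m. p' i = p i" for p'
  proof -
    have B: "oracle_base p n j i = oracle_base p' n j i" if "\<bar>i\<bar> \<le> int (t + m)" for j i
    proof -
      have "fst (prod_decode (nat i)) \<le> nat i"
        by (metis le_prod_encode_1 prod.collapse prod_decode_inverse)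
      also have "nat i \<le> t + m" using that by linarith
      finally show ?thesis using p' by (simp add: oracle_base_def)
    qed
    let ?c = "sim_run (oracle_base p n) ?M t"
    have c: "sim_run (oracle_base p' n) ?M t = ?c" "\<forall>a \<in> set (snd ?c). \<bar>fst (snd a)\<bar> \<le> int t"
      using sim_run_cong[OF t(1), of t "oracle_base p n" "oracle_base p' n"] B by auto
    have "map (\<lambda>a. sim_cell (oracle_base p n) a (fst (snd a))) (snd ?c) =
        map (\<lambda>a. sim_cell (oracle_base p' n) a (fst (snd a))) (snd ?c)"
      using c(2) B by (fastforce simp: sim_cell_def split: option.splits)
    then have "sim_lookup (oracle_base p' n) ?M ?c = sim_lookup (oracle_base p n) ?M ?c"
      by (simp only: sim_lookup_def)
    moreover have "sim_cell (oracle_base p' n) a (int i) = sim_cell (oracle_base p n) a (int i)"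
      if "i \<le> m" for a i
      using B[of "int i"] that by (simp add: sim_cell_def split: option.splits)
    ultimately have "sim_output (oracle_base p' n) ?M t m"
      using t(3) by (auto simp: sim_output_def c(1))
    then show ?thesis using t(1,2) unfolding turing_functional_iff by blast
  qed
  then show ?thesis by blast
qed

text \<open>The error is half of what a name allows. The other half leaves room for moving the point
  without changing a finite part of the name.\<close>

lemma rounding_name:
  assumes "0 \<le> x"
  shows "\<bar>x - real (nat (round (x * 2 ^ i))) / 2 ^ i\<bar> \<le> 1 / 2 / 2 ^ i"
proof -
  have "0 \<le> round (x * 2 ^ i)" using round_mono[of 0 "x * 2 ^ i"] assms by simp
  then have "x - real (nat (round (x * 2 ^ i))) / 2 ^ i = (x * 2 ^ i - real_of_int (round (x * 2 ^ i))) / 2 ^ i"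
    by (simp add: diff_divide_distrib)
  moreover have "\<bar>x * 2 ^ i - real_of_int (round (x * 2 ^ i))\<bar> \<le> 1 / 2"
    using of_int_round_abs_le[of "x * 2 ^ i"] by (simp add: abs_minus_commute)
  then have "\<bar>x * 2 ^ i - real_of_int (round (x * 2 ^ i))\<bar> / 2 ^ i \<le> 1 / 2 / 2 ^ i"
    by (rule divide_right_mono) simp
  ultimately show ?thesis by (simp only: abs_divide) simp
qed

text \<open>A nearby point has a name that shares with the rounding name of \<open>x\<close> the
  finite part consulted for output \<open>n\<close>, so both values have the same
  approximation.\<close>

lemma functional_computes_continuous:
  assumes "functional_computes e f"
  shows "continuous_on {0..1} f"
  unfolding continuous_on_iff
proof (intro ballI allI impI)
  fix x \<epsilon> :: real
  assume x: "x \<in> {0..1}" and "0 < \<epsilon>"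
  obtain n where n: "2 / \<epsilon> < 2 ^ n" using real_arch_pow[of 2 "2 / \<epsilon>"] by auto
  define p where "p = (\<lambda>i. nat (round (x * 2 ^ i)))"
  have px: "\<bar>x - real (p i) / 2 ^ i\<bar> \<le> 1 / 2 / 2 ^ i" for i
    unfolding p_def by (rule rounding_name) (use x in simp)
  have half: "(1 / 2 / 2 ^ i :: real) \<le> 1 / 2 ^ i" for i by (simp add: field_simps)
  have "cauchy_name p x" unfolding cauchy_name_def using order_trans[OF px half] by blast
  then obtain q where q: "cauchy_name q (f x)" "turing_functional e p n (q n)"
    using assms x unfolding functional_computes_def by blast
  obtain T where T: "\<And>p'. (\<forall>i\<le>T. p' i = p i) \<Longrightarrow> turing_functional e p' n (q n)"
    using use_principle[OF q(2)] by blast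
  have "dist (f y) (f x) < \<epsilon>" if y: "y \<in> {0..1}" "dist y x < 1 / 2 / 2 ^ T" for y
  proof -
    \<comment> \<open>Up to \<open>T\<close> the rounding name of \<open>x\<close> is still correct
      for \<open>y\<close>, because \<open>y\<close> is closer to \<open>x\<close> than half of
      \<open>2^-T\<close>; afterwards \<open>y\<close> is rounded itself.\<close>
    define p' where "p' = (\<lambda>i. if i \<le> T then p i else nat (round (y * 2 ^ i)))"
    have "\<bar>y - real (p' i) / 2 ^ i\<bar> \<le> 1 / 2 ^ i" for i
    proof (cases "i \<le> T")
      case True
      have "(1 / 2 / 2 ^ T :: real) \<le> 1 / 2 / 2 ^ i" using True by (simp add: frac_le power_increasing)
      moreover have "(1 / 2 ^ i :: real) = 1 / 2 / 2 ^ i + 1 / 2 / 2 ^ i" by simp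
      ultimately show ?thesis using px[of i] y(2) True unfolding dist_real_def p'_def by (simp del: divide_divide_eq_left)
    next
      case False
      then show ?thesis using order_trans[OF rounding_name half] y(1) by (simp add: p'_def)
    qed
    then have "cauchy_name p' y" by (simp add: cauchy_name_def)
    then obtain q' where q': "cauchy_name q' (f y)" "turing_functional e p' n (q' n)"
      using assms y(1) unfolding functional_computes_def by blast
    have "turing_functional e p' n (q n)" by (rule T) (simp add: p'_def)
    then have "q' n = q n" using q'(2) turing_functional_unique by blast
    then have "\<bar>f y - real (q n) / 2 ^ n\<bar> \<le> 1 / 2 ^ n" "\<bar>f x - real (q n) / 2 ^ n\<bar> \<le> 1 / 2 ^ n"
      using q(1) q'(1) unfolding cauchy_name_def by metis+
    then have "dist (f y) (f x) \<le> 1 / 2 ^ n + 1 / 2 ^ n" unfolding dist_real_def by linarith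
    also have "\<dots> < \<epsilon>" using n \<open>0 < \<epsilon>\<close> by (simp add: field_simps)
    finally show ?thesis .
  qed
  then show "\<exists>d>0. \<forall>y\<in>{0..1}. dist y x < d \<longrightarrow> dist (f y) (f x) < \<epsilon>"
    by (intro exI[of _ "1 / 2 / 2 ^ T"]) auto
qed

section \<open>Regularity of a computable function is \<open>\<Sigma>\<^sup>0\<^sub>2\<close>\<close>

text \<open>If every candidate failed at some bound, all of them would fail at the maximum of these
  bounds.\<close>

lemma finite_pigeonhole_antimono:
  fixes P :: "'a \<Rightarrow> nat \<Rightarrow> bool"
  assumes "finite X" "\<And>n. \<exists>x\<in>X. P x n" "\<And>x m n. P x n \<Longrightarrow> m \<le> n \<Longrightarrow> P x m"
  shows "\<exists>x\<in>X. \<forall>n. P x n"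
proof (rule ccontr)
  assume "\<not> (\<exists>x\<in>X. \<forall>n. P x n)"
  then obtain N where N: "\<And>x. x \<in> X \<Longrightarrow> \<not> P x (N x)" by metis
  obtain x where x: "x \<in> X" "P x (Max (N ` X))" using assms(2) by blast
  have "N x \<le> Max (N ` X)" using assms(1) x(1) by simp
  with N[OF x(1)] assms(3)[OF x(2)] show False by blast
qed

text \<open>Koenig's lemma: among finitely many states or transitions, one admits continuations of
  every finite length, and an infinite run is built by always choosing such a one.\<close>

lemma safe_run_Koenig:
  assumes "finite I" "finite Tr"
    and "\<And>n. \<exists>\<beta> r. r 0 \<in> I \<and> (\<forall>i<n. (r i, \<alpha> i, \<beta> i, r (Suc i)) \<in> Tr)"
  shows "\<exists>r \<beta>. safe_run I Tr \<alpha> \<beta> r"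
proof -
  define path where "path = (\<lambda>q k n. \<exists>\<beta> r. r 0 = q \<and> (\<forall>i<n. (r i, \<alpha> (k + i), \<beta> i, r (Suc i)) \<in> Tr))"
  have mono: "path q k m" if "path q k n" "m \<le> n" for q k m n
  proof -
    obtain \<beta> r where "r 0 = q" "\<forall>i<n. (r i, \<alpha> (k + i), \<beta> i, r (Suc i)) \<in> Tr"
      using \<open>path q k n\<close> unfolding path_def by blast
    then show ?thesis unfolding path_def using \<open>m \<le> n\<close>
      by (intro exI[of _ \<beta>] exI[of _ r]) auto
  qed
  have start: "\<exists>q\<in>I. \<forall>n. path q 0 n"
    by (rule finite_pigeonhole_antimono[OF assms(1) _ mono]) (use assms(3) in \<open>simp add: path_def, blast\<close>)
  have step: "\<exists>q'. (\<forall>n. path q' (Suc k) n) \<and> (\<exists>b. (q, \<alpha> k, b, q') \<in> Tr)" if q: "\<forall>n. path q k n" for q k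
  proof -
    let ?X = "{x \<in> Tr. fst x = q \<and> fst (snd x) = \<alpha> k}"
    have "\<exists>x\<in>?X. \<forall>n. path (snd (snd (snd x))) (Suc k) n"
    proof (rule finite_pigeonhole_antimono)
      fix n
      obtain \<beta> r where r: "r 0 = q" "\<And>i. i < Suc n \<Longrightarrow> (r i, \<alpha> (k + i), \<beta> i, r (Suc i)) \<in> Tr"
        using q unfolding path_def by blast
      have "path (r 1) (Suc k) n" unfolding path_def
        by (rule exI[of _ "\<lambda>i. \<beta> (Suc i)"], rule exI[of _ "\<lambda>i. r (Suc i)"]) (use r(2) in fastforce)
      then show "\<exists>x\<in>?X. path (snd (snd (snd x))) (Suc k) n"
        using r(1) r(2)[of 0] by (intro bexI[of _ "(q, \<alpha> k, \<beta> 0, r 1)"]) auto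
    qed (use assms(2) mono in auto)
    then show ?thesis by force
  qed
  have "\<exists>r. \<forall>k. ((\<forall>n. path (r k) k n) \<and> (k = 0 \<longrightarrow> r k \<in> I)) \<and> (\<exists>b. (r k, \<alpha> k, b, r (Suc k)) \<in> Tr)"
    by (rule dependent_nat_choice) (use start step in auto)
  then show ?thesis unfolding safe_run_def by metis
qed

section \<open>Automata as finite data: reachable states and lasso runs\<close>

type_synonym transition = "nat \<times> nat \<times> nat \<times> nat"
type_synonym automaton = "nat list \<times> transition list"

text \<open>Letters are arbitrary numbers to keep the coding surjective; entries with a letter above
  1 describe no transition.\<close>

definition Trs :: "automaton \<Rightarrow> (nat \<times> bool \<times> bool \<times> nat) set" where
  "Trs b = {(q, a, c, q'). (q, of_bool a, of_bool c, q') \<in> set (snd b)}"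

lemma finite_Trs: "finite (Trs b)"
proof (rule finite_subset)
  show "Trs b \<subseteq> (\<lambda>(q, a, c, q'). (q, a = 1, c = 1, q')) ` set (snd b)"
  proof
    fix x assume "x \<in> Trs b"
    then obtain q a c q' where x: "x = (q, a, c, q')" "(q, of_bool a, of_bool c, q') \<in> set (snd b)"
      by (auto simp: Trs_def)
    then show "x \<in> (\<lambda>(q, a, c, q'). (q, a = 1, c = 1, q')) ` set (snd b)"
      by (intro image_eqI[of _ _ "(q, of_bool a, of_bool c, q')"]) auto
  qed
qed simp

lemma automaton_exists:
  assumes "finite I" "finite Tr"
  shows "\<exists>b. set (fst b) = I \<and> Trs b = Tr"
proof -
  obtain il where il: "set il = I" using assms(1) finite_list by blast
  define h where
    "h = (\<lambda>(q :: nat, a :: bool, c :: bool, q' :: nat). (q, of_bool a :: nat, of_bool c :: nat, q'))"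
  obtain ts where ts: "set ts = h ` Tr" using assms(2) finite_list finite_imageI by metis
  have inj: "h x = h y \<Longrightarrow> x = y" for x y by (auto simp: h_def of_bool_def split: prod.splits if_splits)
  have "Trs (il, ts) = {x. h x \<in> set ts}" by (simp add: Trs_def h_def case_prod_unfold)
  also have "\<dots> = Tr" using inj unfolding ts by blast
  finally have "Trs (il, ts) = Tr" .
  then show ?thesis using il by (intro exI[of _ "(il, ts)"]) simp
qed

text \<open>One step of the subset construction. Any positive number counts as the letter 1, so that
  every list of numbers is an input word.\<close>

definition reach_step :: "automaton \<Rightarrow> nat \<Rightarrow> nat list \<Rightarrow> nat list" where
  "reach_step b s S = map (\<lambda>t. snd (snd (snd t))) (filter (\<lambda>t. fst t \<in> set S \<and>
     fst (snd t) = of_bool (0 < s) \<and> fst (snd (snd t)) \<le> 1) (snd b))"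

definition reachable :: "automaton \<Rightarrow> nat list \<Rightarrow> nat list" where
  "reachable b \<sigma> = fold (reach_step b) \<sigma> (fst b)"

lemma set_reach_step: "q' \<in> set (reach_step b s S) \<longleftrightarrow> (\<exists>q\<in>set S. \<exists>c. (q, 0 < s, c, q') \<in> Trs b)"
proof
  assume "q' \<in> set (reach_step b s S)"
  then obtain q a c where t: "(q, a, c, q') \<in> set (snd b)" "q \<in> set S" "a = of_bool (0 < s)" "c \<le> 1"
    by (auto simp: reach_step_def)
  have "of_bool (c = 1) = c" using t(4) by (cases "c = 1") auto
  with t(1,3) have "(q, 0 < s, c = 1, q') \<in> Trs b" by (simp add: Trs_def)
  then show "\<exists>q\<in>set S. \<exists>c. (q, 0 < s, c, q') \<in> Trs b" using t(2) by blast
next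
  assume "\<exists>q\<in>set S. \<exists>c. (q, 0 < s, c, q') \<in> Trs b"
  then obtain q c where "q \<in> set S" "(q, of_bool (0 < s), of_bool c, q') \<in> set (snd b)"
    by (auto simp: Trs_def)
  then show "q' \<in> set (reach_step b s S)" by (force simp: reach_step_def image_iff)
qed

lemma set_reachable:
  "q \<in> set (reachable b \<sigma>) \<longleftrightarrow> (\<exists>\<beta> r. r 0 \<in> set (fst b) \<and> r (length \<sigma>) = q \<and>
     (\<forall>i<length \<sigma>. (r i, 0 < \<sigma> ! i, \<beta> i, r (Suc i)) \<in> Trs b))"
proof (induction \<sigma> arbitrary: q rule: rev_induct)
  case Nil
  show ?case by (auto simp: reachable_def)
next
  case (snoc s \<sigma>)
  have "q \<in> set (reachable b (\<sigma> @ [s])) \<longleftrightarrow>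
      (\<exists>q'\<in>set (reachable b \<sigma>). \<exists>c. (q', 0 < s, c, q) \<in> Trs b)"
    by (simp add: reachable_def set_reach_step)
  also have "\<dots> \<longleftrightarrow> (\<exists>\<beta> r. r 0 \<in> set (fst b) \<and> r (length (\<sigma> @ [s])) = q \<and>
     (\<forall>i<length (\<sigma> @ [s]). (r i, 0 < (\<sigma> @ [s]) ! i, \<beta> i, r (Suc i)) \<in> Trs b))"
  proof
    assume "\<exists>q'\<in>set (reachable b \<sigma>). \<exists>c. (q', 0 < s, c, q) \<in> Trs b"
    then obtain q' c \<beta> r where *: "(q', 0 < s, c, q) \<in> Trs b" "r 0 \<in> set (fst b)" "r (length \<sigma>) = q'"
      "\<forall>i<length \<sigma>. (r i, 0 < \<sigma> ! i, \<beta> i, r (Suc i)) \<in> Trs b" using snoc by blast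
    show "\<exists>\<beta> r. r 0 \<in> set (fst b) \<and> r (length (\<sigma> @ [s])) = q \<and>
       (\<forall>i<length (\<sigma> @ [s]). (r i, 0 < (\<sigma> @ [s]) ! i, \<beta> i, r (Suc i)) \<in> Trs b)"
      by (rule exI[of _ "\<beta>(length \<sigma> := c)"], rule exI[of _ "r(Suc (length \<sigma>) := q)"])
        (use * in \<open>auto simp: nth_append less_Suc_eq\<close>)
  next
    assume "\<exists>\<beta> r. r 0 \<in> set (fst b) \<and> r (length (\<sigma> @ [s])) = q \<and>
       (\<forall>i<length (\<sigma> @ [s]). (r i, 0 < (\<sigma> @ [s]) ! i, \<beta> i, r (Suc i)) \<in> Trs b)"
    then obtain \<beta> r where *: "r 0 \<in> set (fst b)" "r (Suc (length \<sigma>)) = q"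
       "\<And>i. i < Suc (length \<sigma>) \<Longrightarrow> (r i, 0 < (\<sigma> @ [s]) ! i, \<beta> i, r (Suc i)) \<in> Trs b" by auto
    have "(r i, 0 < \<sigma> ! i, \<beta> i, r (Suc i)) \<in> Trs b" if "i < length \<sigma>" for i
      using *(3)[of i] that by (simp add: nth_append)
    then have "r (length \<sigma>) \<in> set (reachable b \<sigma>)" using *(1) snoc by blast
    moreover have "(r (length \<sigma>), 0 < s, \<beta> (length \<sigma>), q) \<in> Trs b" using *(2) *(3)[of "length \<sigma>"] by simp
    ultimately show "\<exists>q'\<in>set (reachable b \<sigma>). \<exists>c. (q', 0 < s, c, q) \<in> Trs b" by blast
  qed
  finally show ?case .
qed

text \<open>A lasso run is given by its list of transitions and the position to which the last
  transition returns.\<close>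

definition lasso_next :: "transition list \<Rightarrow> nat \<Rightarrow> nat \<Rightarrow> nat" where
  "lasso_next w s i = (if Suc i < length w then Suc i else s)"

definition lasso_at :: "transition list \<Rightarrow> nat \<Rightarrow> nat \<Rightarrow> transition" where
  "lasso_at w s i = hd (drop ((lasso_next w s ^^ i) 0) w)"

definition lasso :: "automaton \<Rightarrow> transition list \<Rightarrow> nat \<Rightarrow> bool" where
  "lasso b w s \<longleftrightarrow> s < length w \<and> fst (hd w) \<in> set (fst b) \<and>
     (\<forall>i<length w. hd (drop i w) \<in> set (snd b) \<and> fst (snd (hd (drop i w))) \<le> 1 \<and>
        fst (snd (snd (hd (drop i w)))) \<le> 1 \<and>
        snd (snd (snd (hd (drop i w)))) = fst (hd (drop (lasso_next w s i) w)))"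

definition lasso_in :: "transition list \<Rightarrow> nat \<Rightarrow> nat \<Rightarrow> bool" where
  "lasso_in w s i \<longleftrightarrow> fst (snd (lasso_at w s i)) = 1"

definition lasso_out :: "transition list \<Rightarrow> nat \<Rightarrow> nat \<Rightarrow> bool" where
  "lasso_out w s i \<longleftrightarrow> fst (snd (snd (lasso_at w s i))) = 1"

lemma lasso_index_less: "s < length w \<Longrightarrow> (lasso_next w s ^^ i) 0 < length w"
  by (induction i) (auto simp: lasso_next_def)

lemma lasso_index_eq: "i < length w \<Longrightarrow> (lasso_next w s ^^ i) 0 = i"
  by (induction i) (auto simp: lasso_next_def)

lemma lasso_safe_run:
  assumes "lasso b w s"
  shows "safe_run (set (fst b)) (Trs b) (lasso_in w s) (lasso_out w s) (\<lambda>i. fst (lasso_at w s i))"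
  unfolding safe_run_def
proof (intro conjI allI)
  show "fst (lasso_at w s 0) \<in> set (fst b)" using assms by (simp add: lasso_def lasso_at_def)
  fix i
  let ?k = "(lasso_next w s ^^ i) 0"
  have k: "?k < length w" using assms by (intro lasso_index_less) (simp add: lasso_def)
  obtain q a c q' where t: "lasso_at w s i = (q, a, c, q')" by (metis surj_pair)
  have tr: "(q, a, c, q') \<in> set (snd b)" "a \<le> 1" "c \<le> 1" "fst (lasso_at w s (Suc i)) = q'"
    using assms k t unfolding lasso_def lasso_at_def by (auto dest!: spec[of _ ?k])
  have "of_bool (a = 1) = a" "of_bool (c = 1) = c"
    using tr(2,3) by (cases "a = 1"; cases "c = 1"; auto)+
  with tr show "(fst (lasso_at w s i), lasso_in w s i, lasso_out w s i, fst (lasso_at w s (Suc i))) \<in> Trs b"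
    by (simp add: Trs_def lasso_in_def lasso_out_def t)
qed

text \<open>Some state recurs after position \<open>n\<close>. Looping between two of its
  occurrences leaves the first \<open>n\<close> letters intact, so lasso runs are dense among all
  runs.\<close>

lemma safe_run_lasso:
  assumes "safe_run (set (fst b)) (Trs b) \<alpha> \<beta> r"
  shows "\<exists>w s. lasso b w s \<and> (\<forall>i<n. lasso_in w s i = \<alpha> i \<and> lasso_out w s i = \<beta> i)"
proof -
  have tr: "(r i, \<alpha> i, \<beta> i, r (Suc i)) \<in> Trs b" for i using assms by (simp add: safe_run_def)
  have "range r \<subseteq> fst ` Trs b" using tr by force
  then have "finite (range r)" using finite_Trs finite_surj by blast
  then have "\<not> inj_on r {n..}" by (meson finite_imageD finite_subset image_mono infinite_Ici subset_UNIV)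
  then obtain i j where ij: "n \<le> i" "i < j" "r i = r j"
    unfolding inj_on_def by (metis atLeast_iff linorder_neqE_nat)
  define w where "w = map (\<lambda>i. (r i, of_bool (\<alpha> i) :: nat, of_bool (\<beta> i) :: nat, r (Suc i))) [0..<j]"
  have len: "length w = j" by (simp add: w_def)
  have at: "hd (drop k w) = (r k, of_bool (\<alpha> k), of_bool (\<beta> k), r (Suc k))" if "k < j" for k
    using that by (simp add: hd_drop_conv_nth len) (simp add: w_def)
  have "lasso b w i"
    unfolding lasso_def len
  proof (intro conjI allI impI)
    show "i < j" by fact
    show "fst (hd w) \<in> set (fst b)" using at[of 0] ij assms by (simp add: safe_run_def)
    fix k assume k: "k < j"
    show "hd (drop k w) \<in> set (snd b)" using tr[of k] by (simp add: at[OF k] Trs_def)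
    show "snd (snd (snd (hd (drop k w)))) = fst (hd (drop (lasso_next w i k) w))"
    proof (cases "Suc k < j")
      case False
      then have "Suc k = j" using k by simp
      then show ?thesis using at[OF k] at[OF ij(2)] ij(3) by (simp add: lasso_next_def len)
    qed (use at[OF k] at[of "Suc k"] in \<open>simp add: lasso_next_def len\<close>)
  qed (simp_all add: at)
  moreover have "lasso_in w i k = \<alpha> k \<and> lasso_out w i k = \<beta> k" if "k < n" for k
    using that ij at[of k] by (simp add: lasso_in_def lasso_out_def lasso_at_def lasso_index_eq len)
  ultimately show ?thesis by blast
qed

text \<open>The numerator of the first \<open>n\<close> digits over \<open>2^n\<close>. The
  truncations form a name of the represented number and serve as oracle.\<close>

definition trunc :: "(nat \<Rightarrow> bool) \<Rightarrow> nat \<Rightarrow> nat" where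
  "trunc \<alpha> n = (\<Sum>i<n. of_bool (\<alpha> i) * 2 ^ (n - Suc i))"

lemma trunc_div: "real (trunc \<alpha> n) / 2 ^ n = (\<Sum>i<n. of_bool (\<alpha> i) / 2 ^ (i + 1))"
proof -
  have "real (of_bool (\<alpha> i) * 2 ^ (n - Suc i)) / 2 ^ n = of_bool (\<alpha> i) / 2 ^ (i + 1)" if "i < n" for i
  proof -
    have "n = n - Suc i + (i + 1)" using that by simp
    then have "(2 :: real) ^ n = 2 ^ (n - Suc i) * 2 ^ (i + 1)" by (metis power_add)
    then show ?thesis by simp
  qed
  then show ?thesis unfolding trunc_def of_nat_sum sum_divide_distrib by (intro sum.cong) auto
qed

lemma cauchy_name_trunc: "cauchy_name (trunc \<alpha>) (bin_val \<alpha>)"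
  unfolding cauchy_name_def
proof
  fix n
  have "bin_val \<alpha> - real (trunc \<alpha> n) / 2 ^ n = bin_val (tail n \<alpha>) / 2 ^ n"
    using bin_val_prefix[of \<alpha> n] by (simp add: trunc_div)
  then show "\<bar>bin_val \<alpha> - real (trunc \<alpha> n) / 2 ^ n\<bar> \<le> 1 / 2 ^ n"
    using bin_val_unit[of "tail n \<alpha>"] by (simp add: divide_right_mono)
qed

section \<open>Decidable tests whose universal validity characterises correctness\<close>

type_synonym test = "nat list \<times> transition list \<times> nat \<times> nat \<times> nat \<times> nat"

text \<open>Nonemptiness for all words yields runs on all inputs. In the second part,
  \<open>m\<close> and the truncated output both lie within one unit of \<open>2^k\<close> times the
  same value if the automaton is right, hence the tolerance 2.\<close>

definition passes :: "nat \<Rightarrow> automaton \<Rightarrow> nat list \<Rightarrow> transition list \<Rightarrow> nat \<Rightarrow> nat \<Rightarrow> nat \<Rightarrow> nat \<Rightarrow> bool" where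
  "passes e b \<sigma> w s k t m \<longleftrightarrow> reachable b \<sigma> \<noteq> [] \<and>
     (lasso b w s \<and> sim_output (oracle_base (trunc (lasso_in w s)) k) (tm_decode e) t m \<longrightarrow>
       trunc (lasso_out w s) k \<le> m + 2 \<and> m \<le> trunc (lasso_out w s) k + 2)"

lemma safe_fun_passes:
  assumes f: "f ` {0..1} \<subseteq> {0..1}" and e: "functional_computes e f"
    and b: "safe_computes (set (fst b)) (Trs b) f"
  shows "passes e b \<sigma> w s k t m"
  unfolding passes_def
proof (intro conjI impI)
  obtain r \<beta> where r: "safe_run (set (fst b)) (Trs b) (\<lambda>i. 0 < \<sigma> ! i) \<beta> r"
    using b unfolding safe_computes_def by blast
  then have "r (length \<sigma>) \<in> set (reachable b \<sigma>)" unfolding set_reachable safe_run_def by blast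
  then show "reachable b \<sigma> \<noteq> []" by auto
next
  let ?\<alpha> = "lasso_in w s" and ?\<beta> = "lasso_out w s"
  assume *: "lasso b w s \<and> sim_output (oracle_base (trunc ?\<alpha>) k) (tm_decode e) t m"
  then have eq: "bin_val ?\<beta> = f (bin_val ?\<alpha>)"
    using b lasso_safe_run unfolding safe_computes_def by blast
  obtain q where q: "cauchy_name q (f (bin_val ?\<alpha>))" "turing_functional e (trunc ?\<alpha>) k (q k)"
    using e bin_val_unit cauchy_name_trunc unfolding functional_computes_def by blast
  then have "turing_functional e (trunc ?\<alpha>) k m" using * unfolding turing_functional_iff by blast
  then have "q k = m" using q(2) turing_functional_unique by blast
  then have "\<bar>bin_val ?\<beta> - real m / 2 ^ k\<bar> \<le> 1 / 2 ^ k" using q(1) unfolding cauchy_name_def eq by metis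
  moreover have "\<bar>bin_val ?\<beta> - real (trunc ?\<beta> k) / 2 ^ k\<bar> \<le> 1 / 2 ^ k"
    using cauchy_name_trunc unfolding cauchy_name_def by blast
  ultimately have "\<bar>real (trunc ?\<beta> k) / 2 ^ k - real m / 2 ^ k\<bar> \<le> 2 / 2 ^ k" by (simp add: abs_le_iff)
  then have "\<bar>real (trunc ?\<beta> k) - real m\<bar> / 2 ^ k \<le> 2 / 2 ^ k"
    by (simp add: abs_divide flip: diff_divide_distrib)
  then have "\<bar>real (trunc ?\<beta> k) - real m\<bar> \<le> 2" by (simp add: divide_le_cancel)
  then show "trunc ?\<beta> k \<le> m + 2" "m \<le> trunc ?\<beta> k + 2" by linarith+
qed

text \<open>The converse rests on compactness and continuity: finite words give infinite runs, and
  correctness on lasso runs passes to their limits.\<close>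

lemma passes_safe_fun:
  assumes e: "functional_computes e f" and p: "\<And>\<sigma> w s k t m. passes e b \<sigma> w s k t m"
  shows "safe_computes (set (fst b)) (Trs b) f"
  unfolding safe_computes_def
proof (intro allI conjI impI)
  fix \<alpha>
  show "\<exists>r \<beta>. safe_run (set (fst b)) (Trs b) \<alpha> \<beta> r"
  proof (rule safe_run_Koenig)
    fix n
    define \<sigma> where "\<sigma> = map (\<lambda>i. of_bool (\<alpha> i) :: nat) [0..<n]"
    have "reachable b \<sigma> \<noteq> []" using p[of \<sigma>] by (simp add: passes_def)
    then obtain q where "q \<in> set (reachable b \<sigma>)" by (metis last_in_set)
    then show "\<exists>\<beta> r. r 0 \<in> set (fst b) \<and> (\<forall>i<n. (r i, \<alpha> i, \<beta> i, r (Suc i)) \<in> Trs b)"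
      unfolding set_reachable by (auto simp: \<sigma>_def)
  qed (simp_all add: finite_Trs)
next
  fix \<alpha> r \<beta>
  assume r: "safe_run (set (fst b)) (Trs b) \<alpha> \<beta> r"
  have lasso: "f (bin_val (lasso_in w s)) = bin_val (lasso_out w s)" if w: "lasso b w s" for w s
  proof -
    let ?x = "f (bin_val (lasso_in w s))" and ?y = "bin_val (lasso_out w s)"
    \<comment> \<open>The tolerance 2 plus one unit of error for each of the two names. A bound
      independent of \<open>k\<close> forces equality of the values.\<close>
    have bound: "\<bar>?x - ?y\<bar> * 2 ^ k \<le> 4" for k
    proof -
      obtain q where q: "cauchy_name q ?x" "turing_functional e (trunc (lasso_in w s)) k (q k)"
        using e bin_val_unit cauchy_name_trunc unfolding functional_computes_def by blast
      then obtain t where "sim_output (oracle_base (trunc (lasso_in w s)) k) (tm_decode e) t (q k)"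
        unfolding turing_functional_iff by blast
      then have "trunc (lasso_out w s) k \<le> q k + 2" "q k \<le> trunc (lasso_out w s) k + 2"
        using p[of "[]" w s k t "q k"] w unfolding passes_def by blast+
      then have "\<bar>real (trunc (lasso_out w s) k) - real (q k)\<bar> \<le> 2" by linarith
      moreover have "\<bar>?x - real (q k) / 2 ^ k\<bar> \<le> 1 / 2 ^ k" "\<bar>?y - real (trunc (lasso_out w s) k) / 2 ^ k\<bar> \<le> 1 / 2 ^ k"
        using q(1) cauchy_name_trunc unfolding cauchy_name_def by blast+
      then have "\<bar>?x * 2 ^ k - real (q k)\<bar> \<le> 1" "\<bar>?y * 2 ^ k - real (trunc (lasso_out w s) k)\<bar> \<le> 1"
        by (simp_all add: abs_le_iff field_simps)
      ultimately have "\<bar>?x * 2 ^ k - ?y * 2 ^ k\<bar> \<le> 4" by linarith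
      then show ?thesis by (simp add: abs_mult flip: left_diff_distrib)
    qed
    have "(\<lambda>k. (?x - ?y) * 2 ^ k) 0 = 0"
      by (rule bounded_doubling[of "\<lambda>k. (?x - ?y) * 2 ^ k" 4]) (use bound in \<open>simp_all add: abs_mult\<close>)
    then show ?thesis by simp
  qed
  \<comment> \<open>A run with a wrong output might not be a lasso itself; it is approximated by
    lassos, whose input-output pairs lie on the closed graph.\<close>
  have "f (bin_val \<alpha>) = bin_val \<beta>"
  proof (rule graph_limit[OF functional_computes_continuous[OF e]])
    fix n
    show "\<exists>\<alpha>' \<beta>'. (\<forall>i<n. \<alpha>' i = \<alpha> i \<and> \<beta>' i = \<beta> i) \<and> f (bin_val \<alpha>') = bin_val \<beta>'"
      using safe_run_lasso[OF r, of n] lasso by blast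
  qed
  then show "bin_val \<beta> = f (bin_val \<alpha>)" by simp
qed

lemma prim_reachable [pr]: "prim f \<Longrightarrow> prim g \<Longrightarrow> prim (\<lambda>x. reachable (f x) (g x))"
proof -
  assume fg: "prim f" "prim g"
  show ?thesis unfolding reachable_def reach_step_def by (intro pr fg prim_comp[OF fg(1)])
qed

lemma prim_lasso_next [pr]: "prim f \<Longrightarrow> prim g \<Longrightarrow> prim h \<Longrightarrow> prim (\<lambda>x. lasso_next (f x) (g x) (h x))"
  unfolding lasso_next_def by (intro pr)

lemma prim_lasso_at [pr]: "prim f \<Longrightarrow> prim g \<Longrightarrow> prim h \<Longrightarrow> prim (\<lambda>x. lasso_at (f x) (g x) (h x))"
proof -
  assume fg: "prim f" "prim g" "prim h"
  show ?thesis unfolding lasso_at_def by (intro pr fg prim_comp[OF fg(1)] prim_comp[OF fg(2)])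
qed

lemma prim_lasso [pr]: "prim f \<Longrightarrow> prim g \<Longrightarrow> prim h \<Longrightarrow> prim (\<lambda>x. lasso (f x) (g x) (h x))"
proof -
  assume fg: "prim f" "prim g" "prim h"
  show ?thesis unfolding lasso_def
    by (intro pr fg prim_comp[OF fg(1)] prim_comp[OF fg(2)] prim_comp[OF fg(3)])
qed

lemma prim_lasso_in [pr]: "prim f \<Longrightarrow> prim g \<Longrightarrow> prim h \<Longrightarrow> prim (\<lambda>x. lasso_in (f x) (g x) (h x))"
  unfolding lasso_in_def by (intro pr)

lemma prim_lasso_out [pr]: "prim f \<Longrightarrow> prim g \<Longrightarrow> prim h \<Longrightarrow> prim (\<lambda>x. lasso_out (f x) (g x) (h x))"
  unfolding lasso_out_def by (intro pr)

lemma prim_trunc_in [pr]: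
  assumes "prim f" "prim g" "prim h" shows "prim (\<lambda>x. trunc (lasso_in (f x) (g x)) (h x))"
  unfolding trunc_def
  by (intro pr assms prim_comp[OF assms(1)] prim_comp[OF assms(2)] prim_comp[OF assms(3)])

lemma prim_trunc_out [pr]:
  assumes "prim f" "prim g" "prim h" shows "prim (\<lambda>x. trunc (lasso_out (f x) (g x)) (h x))"
  unfolding trunc_def
  by (intro pr assms prim_comp[OF assms(1)] prim_comp[OF assms(2)] prim_comp[OF assms(3)])

definition passes_test :: "nat \<Rightarrow> automaton \<Rightarrow> test \<Rightarrow> bool" where
  "passes_test e b y = passes e b (fst y) (fst (snd y)) (fst (snd (snd y))) (fst (snd (snd (snd y))))
     (fst (snd (snd (snd (snd y))))) (snd (snd (snd (snd (snd y)))))"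

lemma prim_passes: "prim (\<lambda>x. passes_test (fst x) (dcd (fst (snd x))) (dcd (snd (snd x))))"
proof -
  \<comment> \<open>The oracle contents depend on the lasso and the input of the functional, which
    are packed into the single parameter \<open>(w, s, k)\<close>.\<close>
  have base: "prim (\<lambda>p. oracle_base (trunc (lasso_in (fst (fst p)) (fst (snd (fst p))))) (snd (snd (fst p)))
      (fst (snd p)) (snd (snd p)))"
    unfolding oracle_base_def by (intro pr)
  have "prim (\<lambda>x. sim_output ((\<lambda>u. oracle_base (trunc (lasso_in (fst u) (fst (snd u)))) (snd (snd u)))
      (w x, s x, k x)) (M x) (t x) (m x))"
    if "prim w" "prim s" "prim k" "prim M" "prim t" "prim m" for w s k M t m
    by (rule prim_sim_output[OF base]) (intro pr that)+
  then have out: "prim (\<lambda>x. sim_output (oracle_base (trunc (lasso_in (w x) (s x))) (k x)) (M x) (t x) (m x))"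
    if "prim w" "prim s" "prim k" "prim M" "prim t" "prim m" for w s k M t m
    using that by simp
  show ?thesis unfolding passes_test_def passes_def by (intro pr out)
qed

text \<open>One existential quantifier over automata followed by universal quantifiers over finite
  data and a decidable matrix. The set is defined for all indices, whether or not they compute a
  function.\<close>

definition regular_indices :: "nat set" where
  "regular_indices = {e. \<exists>b. \<forall>\<sigma> w s k t m. passes e b \<sigma> w s k t m}"

lemma Sigma02_regular_indices: "Sigma02 regular_indices"
proof -
  define R where "R = (\<lambda>e b y. passes_test e (dcd b) (dcd y))"
  define g where "g = (\<lambda>c. of_bool (R (fst (prod_decode c)) (fst (prod_decode (snd (prod_decode c))))
     (snd (prod_decode (snd (prod_decode c))))) :: nat)"
  have "prim (\<lambda>c. (fst (prod_decode c), fst (prod_decode (snd (prod_decode c))), snd (prod_decode (snd (prod_decode c)))))"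
    by (intro pr)
  from prim_comp[OF prim_passes this]
  have "prim (\<lambda>c. R (fst (prod_decode c)) (fst (prod_decode (snd (prod_decode c))))
     (snd (prod_decode (snd (prod_decode c)))))"
    unfolding R_def by simp
  then have "prec g" unfolding prec_iff_prim g_def by (rule prim_of_bool_nat)
  then have "computable_fun g" by (rule computable_fun_prec)
  then have "computable_rel3 R" unfolding computable_rel3_def by (intro exI[of _ g]) (simp add: g_def)
  moreover have "e \<in> regular_indices \<longleftrightarrow> (\<exists>b. \<forall>y. R e b y)" for e
  proof
    assume "e \<in> regular_indices"
    then obtain b where b: "\<And>\<sigma> w s k t m. passes e b \<sigma> w s k t m" unfolding regular_indices_def by blast
    show "\<exists>b. \<forall>y. R e b y"
      unfolding R_def by (rule exI[of _ "enc b"]) (simp add: b passes_test_def)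
  next
    assume "\<exists>b. \<forall>y. R e b y"
    then obtain b where b: "\<And>y. R e b y" by blast
    have "passes e (dcd b) \<sigma> w s k t m" for \<sigma> w s k t m
      using b[of "enc (\<sigma>, w, s, k, t, m)"] by (simp add: R_def passes_test_def)
    then show "e \<in> regular_indices" unfolding regular_indices_def by blast
  qed
  ultimately show ?thesis unfolding Sigma02_def by blast
qed

lemma safe_iff_regular_indices:
  assumes "f ` {0..1} \<subseteq> {0..1}" "functional_computes e f"
  shows "e \<in> regular_indices \<longleftrightarrow> safe_fun f"
proof
  assume "e \<in> regular_indices"
  then obtain b where "safe_computes (set (fst b)) (Trs b) f"
    using passes_safe_fun[OF assms(2)] unfolding regular_indices_def by blast
  then show "safe_fun f" by (rule safe_funI[OF finite_set finite_Trs])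
next
  assume "safe_fun f"
  then obtain I :: "nat set" and Tr where "finite I" "finite Tr" "safe_computes I Tr f"
    unfolding safe_fun_def by blast
  moreover then obtain b where "set (fst b) = I" "Trs b = Tr" using automaton_exists by blast
  ultimately have "safe_computes (set (fst b)) (Trs b) f" by simp
  then show "e \<in> regular_indices"
    using safe_fun_passes[OF assms] unfolding regular_indices_def by blast
qed

lemma safe_iff_transducer: "safe_fun f \<longleftrightarrow> transducer_fun f"
  using safe_fun_transducer transducer_safe_fun by blast

lemma safe_iff_regular:
  "f ` {0..1} \<subseteq> {0..1} \<Longrightarrow> functional_computes e f \<Longrightarrow> safe_fun f \<longleftrightarrow> regular_fun f"
  using safe_fun_regular regular_safe_fun functional_computes_continuous by blast

section \<open>Sums of tents\<close>

definition tent :: "nat \<Rightarrow> real \<Rightarrow> real" where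
  "tent j x = max 0 (min (x - 1 / 2 ^ (j + 1)) (1 / 2 ^ j - x)) / 2 ^ j"

text \<open>At each point at most one term is nonzero, so the supremum is the sum. It avoids
  questions of convergence and inherits bounds and Lipschitz estimates directly from the single
  tents.\<close>

definition tents :: "(nat \<Rightarrow> bool) \<Rightarrow> real \<Rightarrow> real" where
  "tents ev x = (SUP j. if ev j then tent j x else 0)"

lemma tent_nonneg: "0 \<le> tent j x"
  by (simp add: tent_def)

lemma half_power_le: "i \<le> j \<Longrightarrow> 1 / 2 ^ j \<le> (1 / 2 ^ i :: real)"
  by (simp add: frac_le power_increasing)

lemma divide_power2_le: "0 \<le> y \<Longrightarrow> y / 2 ^ j \<le> (y :: real)"
  by (simp add: divide_le_eq mult_le_cancel_left1)

lemma tent_le: "tent j x \<le> 1"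
proof -
  have "max 0 (min (x - a) (b - x)) \<le> b" if "0 \<le> a" "0 \<le> b" for a b :: real
    using that by linarith
  from this[of "1 / 2 ^ (j + 1)" "1 / 2 ^ j"]
  have "max 0 (min (x - 1 / 2 ^ (j + 1)) (1 / 2 ^ j - x)) \<le> 1 / 2 ^ j" by simp
  also have "\<dots> \<le> 1" using half_power_le[of 0 j] by simp
  finally show ?thesis
    unfolding tent_def using order_trans[OF divide_power2_le] by (metis max.cobounded1)
qed

lemma tent_lipschitz: "tent j x \<le> tent j y + \<bar>x - y\<bar>"
proof -
  have "max 0 (min (x - 1 / 2 ^ (j + 1)) (1 / 2 ^ j - x)) \<le>
      max 0 (min (y - 1 / 2 ^ (j + 1)) (1 / 2 ^ j - y)) + \<bar>x - y\<bar>"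
    by linarith
  then have "tent j x \<le> (max 0 (min (y - 1 / 2 ^ (j + 1)) (1 / 2 ^ j - y)) + \<bar>x - y\<bar>) / 2 ^ j"
    unfolding tent_def by (rule divide_right_mono) simp
  also have "\<dots> = tent j y + \<bar>x - y\<bar> / 2 ^ j" by (simp add: tent_def add_divide_distrib)
  also have "\<bar>x - y\<bar> / 2 ^ j \<le> \<bar>x - y\<bar>" by (rule divide_power2_le) simp
  finally show ?thesis by simp
qed

lemma tents_bdd: "bdd_above (range (\<lambda>j. if ev j then tent j x else 0))"
  by (rule bdd_aboveI[of _ 1]) (auto simp: tent_le)

lemma tents_upper: "(if ev j then tent j x else 0) \<le> tents ev x"
  unfolding tents_def by (rule cSUP_upper[OF _ tents_bdd]) simp

lemma tents_least: "(\<And>j. ev j \<Longrightarrow> tent j x \<le> c) \<Longrightarrow> 0 \<le> c \<Longrightarrow> tents ev x \<le> c"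
  unfolding tents_def by (rule cSUP_least) auto

lemma tents_nonneg: "0 \<le> tents ev x"
  using order_trans[OF _ tents_upper[of ev 0 x]] by (simp add: tent_nonneg split: if_splits)

lemma tents_le: "tents ev x \<le> 1"
  by (rule tents_least) (simp_all add: tent_le)

lemma tents_unit: "tents ev ` {0..1} \<subseteq> {0..1}"
  using tents_nonneg tents_le by auto

lemma tents_lipschitz': "tents ev x \<le> tents ev y + \<bar>x - y\<bar>"
proof (rule tents_least)
  fix j assume "ev j"
  then have "tent j y \<le> tents ev y" using tents_upper[of ev j y] by simp
  then show "tent j x \<le> tents ev y + \<bar>x - y\<bar>" using tent_lipschitz[of j x y] by linarith
qed (use tents_nonneg[of ev y] in simp)

lemma tents_lipschitz: "\<bar>tents ev x - tents ev y\<bar> \<le> \<bar>x - y\<bar>"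
  using tents_lipschitz'[of ev x y] tents_lipschitz'[of ev y x] by (simp add: abs_le_iff abs_minus_commute)

lemma lipschitz_unit_tents: "lipschitz_unit (tents ev)"
  unfolding lipschitz_unit_def
  by (intro exI[of _ 1] lipschitz_onI) (simp_all add: dist_real_def tents_lipschitz)

lemma tent_eq_0: "x \<le> 1 / 2 ^ (j + 1) \<or> 1 / 2 ^ j \<le> x \<Longrightarrow> tent j x = 0"
  by (auto simp: tent_def max_def min_def)

lemma tents_eq_0: "(\<And>j. ev j \<Longrightarrow> x \<le> 1 / 2 ^ (j + 1) \<or> 1 / 2 ^ j \<le> x) \<Longrightarrow> tents ev x = 0"
  using tents_least[of ev x 0] tents_nonneg[of ev x] by (simp add: tent_eq_0)

text \<open>Two different supports share at most an endpoint, and tents vanish at the endpoints of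
  their supports.\<close>

lemma tents_on:
  assumes "1 / 2 ^ (j + 1) \<le> x" "x \<le> 1 / 2 ^ j"
  shows "tents ev x = (if ev j then tent j x else 0)"
proof (rule antisym[OF tents_least tents_upper])
  show "0 \<le> (if ev j then tent j x else 0)" by (simp add: tent_nonneg)
  fix i assume i: "ev i"
  show "tent i x \<le> (if ev j then tent j x else 0)"
  proof (cases "i = j")
    case False
    then have "tent i x = 0"
      using assms half_power_le[of "i + 1" j] half_power_le[of "j + 1" i]
      by (intro tent_eq_0) (cases "i < j", auto)
    then show ?thesis by (simp add: tent_nonneg)
  qed (use i in simp)
qed

lemma tents_left:
  assumes "ev j" "1 / 2 ^ (j + 1) \<le> x" "x \<le> 3 / 2 ^ (j + 2)"
  shows "tents ev x = (x - 1 / 2 ^ (j + 1)) / 2 ^ j"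
proof -
  have "x \<le> 1 / 2 ^ j" "x - 1 / 2 ^ (j + 1) \<le> 1 / 2 ^ j - x" using assms(3) by (simp_all add: field_simps)
  then show ?thesis using assms by (simp add: tents_on[of j] tent_def)
qed

lemma tents_right:
  assumes "ev j" "3 / 2 ^ (j + 2) \<le> x" "x \<le> 1 / 2 ^ j"
  shows "tents ev x = (1 / 2 ^ j - x) / 2 ^ j"
proof -
  have "1 / 2 ^ (j + 1) \<le> x" "1 / 2 ^ j - x \<le> x - 1 / 2 ^ (j + 1)" using assms(2) by (simp_all add: field_simps)
  then show ?thesis using assms by (simp add: tents_on[of j] tent_def)
qed

lemma tents_outside: "x \<le> 0 \<or> 1 \<le> x \<Longrightarrow> tents ev x = 0"
proof (rule tents_eq_0)
  fix j assume "x \<le> 0 \<or> 1 \<le> x"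
  moreover have "(0 :: real) \<le> 1 / 2 ^ (j + 1)" by simp
  moreover have "(1 / 2 ^ j :: real) \<le> 1" using half_power_le[of 0 j] by simp
  ultimately show "x \<le> 1 / 2 ^ (j + 1) \<or> 1 / 2 ^ j \<le> x" by linarith
qed

lemma dyadic_block:
  fixes x :: real
  assumes "0 < x" "x \<le> 1"
  obtains j where "1 / 2 ^ (j + 1) < x" "x \<le> 1 / 2 ^ j"
proof -
  have ex: "\<exists>j. 1 / 2 ^ (j + 1) < x"
  proof -
    obtain j where "(1 / 2) ^ j < x" using real_arch_pow_inv[of x "1 / 2"] assms by auto
    then have "1 / 2 ^ (j + 1) < x" using half_power_le[of j "j + 1"] by (simp add: power_divide)
    then show ?thesis ..
  qed
  define j where "j = (LEAST j. 1 / 2 ^ (j + 1) < x)"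
  have "1 / 2 ^ (j + 1) < x" unfolding j_def using ex by (rule LeastI_ex)
  moreover have "x \<le> 1 / 2 ^ j"
  proof (cases j)
    case (Suc i)
    then have "\<not> 1 / 2 ^ (i + 1) < x" using not_less_Least[of i "\<lambda>j. 1 / 2 ^ (j + 1) < x"] by (simp add: j_def)
    then show ?thesis by (simp add: Suc)
  qed (use assms in simp)
  ultimately show thesis by (rule that)
qed

lemma tents_rational: "tents ev ` (\<rat> \<inter> {0..1}) \<subseteq> \<rat>"
proof
  fix y assume "y \<in> tents ev ` (\<rat> \<inter> {0..1})"
  then obtain x where x: "x \<in> \<rat>" "0 \<le> x" "x \<le> 1" "y = tents ev x" by auto
  show "y \<in> \<rat>"
  proof (cases "x = 0")
    case False
    then obtain j where j: "1 / 2 ^ (j + 1) < x" "x \<le> 1 / 2 ^ j" using dyadic_block[of x] x by auto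
    have "tent j x \<in> \<rat>" using x(1) by (simp add: tent_def max_def min_def)
    then show ?thesis using tents_on[of j x ev] j x(4) by simp
  qed (simp add: x tents_outside)
qed

lemma interior_countable_real: assumes "countable (N :: real set)" shows "interior N = {}"
proof (rule ccontr)
  assume "interior N \<noteq> {}"
  then obtain x where "x \<in> interior N" "x \<notin> N" using open_minus_countable[OF assms] by blast
  then show False using interior_subset by blast
qed

text \<open>The exceptional points are the endpoints and peaks of the tents together with their
  limit 0. They form a countable compact set, hence a nowhere dense null set.\<close>

lemma almost_linear_tents: "almost_linear (tents ev)"
  unfolding almost_linear_def
\<comment> \<open>The limit 0 is added to both sequences so that each of the two sets is compact on
  its own.\<close>
proof (intro exI[of _ "insert 0 (range (\<lambda>j. 1 / 2 ^ j)) \<union> insert 0 (range (\<lambda>j. 3 / 2 ^ (j + 2)))"] conjI ballI)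
  let ?N = "insert 0 (range (\<lambda>j. 1 / 2 ^ j)) \<union> insert 0 (range (\<lambda>j. 3 / 2 ^ (j + 2))) :: real set"
  have "(\<lambda>j. 1 / 2 ^ j :: real) \<longlonglongrightarrow> 0"
    using LIMSEQ_realpow_zero[of "1/2 :: real"] by (simp add: power_divide)
  moreover then have "(\<lambda>j. 3 / 4 * (1 / 2 ^ j) :: real) \<longlonglongrightarrow> 3 / 4 * 0" by (intro tendsto_mult_left)
  ultimately have "compact ?N"
    by (intro compact_Un compact_sequence_with_limit) (simp_all add: power_add)
  then have "closure ?N = ?N" by (simp add: compact_imp_closed)
  moreover have c: "countable ?N" by simp
  ultimately show "interior (closure ?N) = {}" by (simp only: interior_countable_real)
  show "?N \<in> null_sets lebesgue" using c by (simp add: countable_imp_null_set_lborel null_sets_completionI)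
  show "?N \<subseteq> {0..1}"
  proof -
    have "(1 / 2 ^ j :: real) \<le> 1" for j using half_power_le[of 0 j] by simp
    moreover have "(3 / 2 ^ (j + 2) :: real) \<le> 1" for j
    proof -
      have "(1 :: real) \<le> 2 ^ j" by simp
      then have "3 \<le> 4 * (2 :: real) ^ j" by linarith
      then show ?thesis by simp
    qed
    ultimately show ?thesis by auto
  qed
  fix x assume x: "x \<in> {0..1} - ?N"
  then have "0 < x" "x \<le> 1" by (auto simp: less_le)
  then obtain j where j: "1 / 2 ^ (j + 1) < x" "x \<le> 1 / 2 ^ j" by (rule dyadic_block)
  have "x \<noteq> 1 / 2 ^ j" "x \<noteq> 3 / 2 ^ (j + 2)" using x by blast+
  with j have j2: "x < 1 / 2 ^ j" by simp
  have near: "\<exists>\<epsilon>>0. \<exists>a b. \<forall>y\<in>ball x \<epsilon> \<inter> {0..1}. tents ev y = a * y + b"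
    if "l < x" "x < u" "\<And>y. l \<le> y \<Longrightarrow> y \<le> u \<Longrightarrow> tents ev y = a * y + b" for l u a b
  proof (rule exI[of _ "min (x - l) (u - x)"], rule conjI[rotated], rule exI[of _ a], rule exI[of _ b], rule ballI)
    fix y assume "y \<in> ball x (min (x - l) (u - x)) \<inter> {0..1}"
    then have "l \<le> y" "y \<le> u" by (auto simp: dist_real_def abs_less_iff)
    then show "tents ev y = a * y + b" by (rule that(3))
  qed (use that(1,2) in simp)
  show "\<exists>\<epsilon>>0. \<exists>a b. \<forall>y\<in>ball x \<epsilon> \<inter> {0..1}. tents ev y = a * y + b"
  proof (cases "ev j")
    case False
    show ?thesis by (rule near[OF j(1) j2, of 0 0]) (simp add: tents_on[of j] False)
  next
    case True
    show ?thesis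
    proof (cases "x < 3 / 2 ^ (j + 2)")
      case left: True
      show ?thesis
        by (rule near[OF j(1) left, of "1 / 2 ^ j" "- (1 / 2 ^ (j + 1)) / 2 ^ j"])
          (simp add: tents_left[of ev j, OF True] diff_divide_distrib)
    next
      case False
      with \<open>x \<noteq> 3 / 2 ^ (j + 2)\<close> have right: "3 / 2 ^ (j + 2) < x" by simp
      show ?thesis
        by (rule near[OF right j2, of "- 1 / 2 ^ j" "1 / 2 ^ j / 2 ^ j"])
          (simp add: tents_right[of ev j, OF True] diff_divide_distrib)
    qed
  qed
qed

subsection \<open>Infinitely many tents are not regular\<close>

lemma bin_val_ones: "bin_val (\<lambda>i. n \<le> i) = 1 / 2 ^ n"
proof -
  have "bin_val (tail n (\<lambda>i. n \<le> i)) = 1"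
    using suminf_half by (simp add: bin_val_def tail_def)
  then show ?thesis using bin_val_prefix[of "\<lambda>i. n \<le> i" n] by simp
qed

text \<open>Among the expansions of the peak the one ending in ones is chosen: after position
  \<open>j + 1\<close> the remaining input is the same for all \<open>j\<close>, which makes runs
  interchangeable.\<close>

lemma bin_val_peak: "bin_val (\<lambda>i. i = j \<or> j + 2 \<le> i) = 3 / 2 ^ (j + 2)"
proof -
  let ?\<alpha> = "\<lambda>i. i = j \<or> j + 2 \<le> i"
  have "tail (j + 2) ?\<alpha> = (\<lambda>i. 0 \<le> i)" by (auto simp: tail_def fun_eq_iff)
  then have "bin_val (tail (j + 2) ?\<alpha>) = 1" using bin_val_ones[of 0] by simp
  moreover have "(\<Sum>s<j + 2. of_bool (?\<alpha> s) / 2 ^ (s + 1) :: real) = 1 / 2 ^ (j + 1)"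
    by (simp add: numeral_2_eq_2)
  ultimately show ?thesis using bin_val_prefix[of ?\<alpha> "j + 2"] by (simp add: field_simps)
qed

lemma tents_peak: assumes "ev j" shows "tents ev (3 / 2 ^ (j + 2)) = 1 / 2 ^ (2 * j + 2)"
proof -
  have d: "3 / 2 ^ (j + 2) - 1 / 2 ^ (j + 1) = (1 / 2 ^ (j + 2) :: real)"
    by (simp add: power_add)
  moreover have "(0 :: real) < 1 / 2 ^ (j + 2)" by simp
  ultimately have le: "(1 / 2 ^ (j + 1) :: real) \<le> 3 / 2 ^ (j + 2)" by linarith
  have e: "j + 2 + j = 2 * j + 2" by simp
  have "tents ev (3 / 2 ^ (j + 2)) = (3 / 2 ^ (j + 2) - 1 / 2 ^ (j + 1)) / 2 ^ j"
    by (rule tents_left[of ev j, OF assms le order_refl])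
  also have "\<dots> = 1 / 2 ^ (j + 2) / 2 ^ j" by (simp only: d)
  also have "\<dots> = 1 / 2 ^ (j + 2 + j)" by (simp only: power_add divide_divide_eq_left)
  finally show ?thesis unfolding e .
qed

text \<open>Two runs meeting in a state can be cut and joined there. Acceptance concerns only the
  second run, from which infinitely many positions remain.\<close>

lemma buchi_splice:
  assumes "r 0 \<in> b_init A" "\<forall>i. (r i, w i, r (Suc i)) \<in> b_trans A"
    and "\<forall>i. (r' i, w' i, r' (Suc i)) \<in> b_trans A" "\<exists>\<^sub>\<infinity>i. r' i \<in> b_acc A" "r m = r' m'"
  shows "buchi_accepts A (\<lambda>i. if i < m then w i else w' (i - m + m'))"
  unfolding buchi_accepts_def
proof (intro exI[of _ "\<lambda>i. if i < m then r i else r' (i - m + m')"] conjI allI)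
  show "(if 0 < m then r 0 else r' (0 - m + m')) \<in> b_init A" using assms(1,5) by auto
  fix i
  show "((if i < m then r i else r' (i - m + m')), (if i < m then w i else w' (i - m + m')),
      (if Suc i < m then r (Suc i) else r' (Suc i - m + m'))) \<in> b_trans A"
  proof (cases "i < m")
    case True
    show ?thesis
    proof (cases "Suc i < m")
      case False
      then have "m = Suc i" using True by simp
      then show ?thesis using spec[OF assms(2), of i] assms(5) by simp
    qed (use assms(2) True in simp)
  next
    case False
    then have "Suc i - m + m' = Suc (i - m + m')" by simp
    then show ?thesis using assms(3) False by simp
  qed
next
  show "\<exists>\<^sub>\<infinity>i. (if i < m then r i else r' (i - m + m')) \<in> b_acc A"
    unfolding INFM_nat_le
  proof
    fix k
    obtain i where "k + m' \<le> i" "r' i \<in> b_acc A" using assms(4) unfolding INFM_nat_le by blast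
    then show "\<exists>i\<ge>k. (if i < m then r i else r' (i - m + m')) \<in> b_acc A"
      by (intro exI[of _ "i - m' + m"]) auto
  qed
qed

text \<open>A pumping argument at the peaks. Once the digits that identify the peak have been read,
  the automaton still owes \<open>j\<close> zeros of the output \<open>2^-(2j+2)\<close>; finitely
  many states cannot remember \<open>j\<close>.\<close>

lemma regular_tents_finite:
  assumes "regular_fun (tents ev)"
  shows "finite {j. ev j}"
proof (rule ccontr)
  assume inf: "infinite {j. ev j}"
  obtain A where A: "buchi_wf A" "\<And>\<alpha> \<beta>. buchi_accepts A (interleave \<alpha> \<beta>) \<longleftrightarrow> tents ev (bin_val \<alpha>) = bin_val \<beta>"
    using assms unfolding regular_fun_def by blast
  define a where "a = (\<lambda>j i. i = j \<or> j + 2 \<le> (i :: nat))"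
  define b where "b = (\<lambda>n i. n \<le> (i :: nat))"
  have "\<exists>r. r 0 \<in> b_init A \<and> (\<forall>i. (r i, interleave (a j) (b (2 * j + 2)) i, r (Suc i)) \<in> b_trans A) \<and>
      (\<exists>\<^sub>\<infinity>i. r i \<in> b_acc A)" if "ev j" for j
  proof -
    have "buchi_accepts A (interleave (a j) (b (2 * j + 2)))"
      unfolding A(2) a_def b_def by (simp only: bin_val_peak bin_val_ones tents_peak[of ev, OF that])
    then show ?thesis unfolding buchi_accepts_def by blast
  qed
  then obtain r where r: "\<And>j. ev j \<Longrightarrow> r j 0 \<in> b_init A"
    "\<And>j. ev j \<Longrightarrow> \<forall>i. (r j i, interleave (a j) (b (2 * j + 2)) i, r j (Suc i)) \<in> b_trans A"
    "\<And>j. ev j \<Longrightarrow> \<exists>\<^sub>\<infinity>i. r j i \<in> b_acc A" by metis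
  \<comment> \<open>The state after \<open>j + 2\<close> pairs of digits, that is after
    \<open>2 * (j + 2)\<close> letters of the interleaved word, when only ones remain in the
    input.\<close>
  have "(\<lambda>j. r j (2 * (j + 2))) ` {j. ev j} \<subseteq> b_states A"
    using r(2) A(1) unfolding buchi_wf_def by blast
  then have "\<not> inj_on (\<lambda>j. r j (2 * (j + 2))) {j. ev j}"
    using A(1) inf finite_imageD finite_subset unfolding buchi_wf_def by metis
  then obtain j k where jk: "ev j" "ev k" "j \<noteq> k" "r j (2 * (j + 2)) = r k (2 * (k + 2))"
    unfolding inj_on_def by blast
  \<comment> \<open>The spliced word has the input of peak \<open>j\<close>, but its output consists
    of \<open>j + 2\<close> zeros from the first run and \<open>k\<close> zeros from the second
    before the ones begin.\<close>
  have "(\<lambda>i. if i < 2 * (j + 2) then interleave (a j) (b (2 * j + 2)) i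
      else interleave (a k) (b (2 * k + 2)) (i - 2 * (j + 2) + 2 * (k + 2))) = interleave (a j) (b (j + k + 2))"
  proof
    fix i
    obtain l where l: "i = 2 * l \<or> i = Suc (2 * l)" by (metis oddE evenE Suc_eq_plus1)
    show "(if i < 2 * (j + 2) then interleave (a j) (b (2 * j + 2)) i
      else interleave (a k) (b (2 * k + 2)) (i - 2 * (j + 2) + 2 * (k + 2))) = interleave (a j) (b (j + k + 2)) i"
    proof (cases "i < 2 * (j + 2)")
      case True
      then show ?thesis using l by (auto simp: b_def)
    next
      case False
      then have "j + 2 \<le> l" using l by auto
      then obtain d where d: "l = j + 2 + d" by (auto simp: le_iff_add)
      from l show ?thesis
      proof
        assume i: "i = 2 * l"
        have e: "i - 2 * (j + 2) + 2 * (k + 2) = 2 * (k + 2 + d)" using i d by simp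
        show ?thesis unfolding e if_not_P[OF False] unfolding i interleave_even by (simp add: a_def d)
      next
        assume i: "i = Suc (2 * l)"
        have e: "i - 2 * (j + 2) + 2 * (k + 2) = Suc (2 * (k + 2 + d))" using i d by simp
        show ?thesis unfolding e if_not_P[OF False] unfolding i interleave_odd by (simp add: b_def d)
      qed
    qed
  qed
  with buchi_splice[OF r(1,2)[OF jk(1)] r(2,3)[OF jk(2)] jk(4)]
  have "buchi_accepts A (interleave (a j) (b (j + k + 2)))" by simp
  then have "(1 / 2 ^ (2 * j + 2) :: real) = 1 / 2 ^ (j + k + 2)"
    unfolding A(2) a_def b_def by (simp only: bin_val_peak bin_val_ones tents_peak[of ev j, OF jk(1)])
  then have "(2 :: real) ^ (2 * j + 2) = 2 ^ (j + k + 2)" by simp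
  then have "2 * j + 2 = j + k + 2" by (rule power_inject_exp[THEN iffD1, rotated]) simp
  with jk(3) show False by simp
qed

subsection \<open>Finitely many tents are computed by a transducer\<close>

lemma abs_mult_bin_val: "\<bar>s * bin_val \<gamma>\<bar> \<le> \<bar>s\<bar>"
  using mult_left_mono[OF bin_val_le_1[of \<gamma>], of "\<bar>s\<bar>"] bin_val_nonneg[of \<gamma>] by (simp add: abs_mult)

text \<open>The automaton guesses the dyadic piece \<open>w\<close> of the input and keeps the integer \<open>c\<close> with
  \<open>2\<^sup>K y = S x + c\<close> for the remaining input \<open>x\<close> and output \<open>y\<close>; it dies as soon as \<open>c\<close> is out of bounds.\<close>

lemma piecewise_affine_safe_fun:
  fixes S A :: "bool list \<Rightarrow> int"
  assumes unit: "f ` {0..1} \<subseteq> {0..1}"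
    and pieces: "\<And>w \<alpha>. length w = D \<Longrightarrow> (\<forall>i<D. \<alpha> i = w ! i) \<Longrightarrow>
      2 ^ K * f (bin_val \<alpha>) = of_int (A w) + of_int (S w) * bin_val \<alpha>"
  shows "safe_fun f"
proof -
  define W where "W = {w :: bool list. length w = D}"
  have fW: "finite W" unfolding W_def using finite_lists_length_eq[of "UNIV :: bool set" D] by simp
  \<comment> \<open>In a correct run \<open>c\<close> is a difference of \<open>2^K y\<close> and
    \<open>S x\<close> with \<open>x\<close> and \<open>y\<close> in the unit interval, so this
    bound excludes no correct run.\<close>
  define B where "B = 2 ^ K + (\<Sum>w\<in>W. \<bar>S w\<bar>)"
  have SB: "\<bar>S w\<bar> \<le> B - 2 ^ K" if "w \<in> W" for w
    unfolding B_def using member_le_sum[OF that, of "\<lambda>w. \<bar>S w\<bar>"] fW by simp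
  define G where "G = {u :: bool list. length u \<le> D} \<times> S ` W \<times> {-B..B}"
  define I where "I = (\<lambda>w. (w, S w, A w)) ` W"
  \<comment> \<open>The update of \<open>c\<close> arises by doubling the equation
    \<open>2^K y = S x + c\<close> and removing the digit \<open>a\<close> from \<open>x\<close> and
    the digit \<open>b\<close> from \<open>y\<close>. The guessed piece is checked until it is used
    up.\<close>
  define Tr where "Tr = {(x, a, b, y). x \<in> G \<and> y \<in> G \<and> (fst x = [] \<or> hd (fst x) = a) \<and>
     fst y = tl (fst x) \<and> fst (snd y) = fst (snd x) \<and>
     snd (snd y) = fst (snd x) * of_bool a + 2 * snd (snd x) - 2 ^ K * of_bool b}"
  have fG: "finite G" unfolding G_def
    using fW finite_lists_length_le[of "UNIV :: bool set" D] by (intro finite_cartesian_product) auto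
  have "finite I" using fW by (simp add: I_def)
  moreover have "finite Tr"
  proof (rule finite_subset)
    show "Tr \<subseteq> G \<times> UNIV \<times> UNIV \<times> G" by (auto simp: Tr_def)
  qed (intro finite_cartesian_product fG finite)
  moreover have "safe_computes I Tr f"
    unfolding safe_computes_def
  proof (intro allI conjI impI)
    fix \<alpha>
    obtain \<beta> where \<beta>: "bin_val \<beta> = f (bin_val \<alpha>)" using bin_val_surj unit bin_val_unit by blast
    define w where "w = map \<alpha> [0..<D]"
    have w: "w \<in> W" "length w = D" by (simp_all add: w_def W_def)
    define c where "c = rec_nat (A w) (\<lambda>n c. S w * of_bool (\<alpha> n) + 2 * c - 2 ^ K * of_bool (\<beta> n))"
    have c0: "c 0 = A w" and cS: "c (Suc n) = S w * of_bool (\<alpha> n) + 2 * c n - 2 ^ K * of_bool (\<beta> n)" for n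
      by (simp_all add: c_def)
    have inv: "2 ^ K * bin_val (tail n \<beta>) = of_int (c n) + of_int (S w) * bin_val (tail n \<alpha>)" for n
    proof (induction n)
      case 0
      show ?case using pieces[of w \<alpha>] w by (simp add: \<beta> c0) (simp add: w_def)
    next
      case (Suc n)
      then show ?case by (simp add: bin_val_tail_Suc cS algebra_simps)
    qed
    have "\<bar>c n\<bar> \<le> B" for n
    proof -
      have "\<bar>2 ^ K * bin_val (tail n \<beta>)\<bar> \<le> 2 ^ K" "\<bar>of_int (S w) * bin_val (tail n \<alpha>)\<bar> \<le> \<bar>of_int (S w)\<bar>"
        using abs_mult_bin_val[of "2 ^ K"] abs_mult_bin_val by simp_all
      then have "\<bar>of_int (c n)\<bar> \<le> 2 ^ K + \<bar>of_int (S w) :: real\<bar>" using inv[of n] by linarith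
      then have "real_of_int \<bar>c n\<bar> \<le> real_of_int (2 ^ K + \<bar>S w\<bar>)" by simp
      then have "\<bar>c n\<bar> \<le> 2 ^ K + \<bar>S w\<bar>" by (simp only: of_int_le_iff)
      then show ?thesis using SB[OF w(1)] by linarith
    qed
    then have G: "(drop n w, S w, c n) \<in> G" for n using w by (auto simp: G_def abs_le_iff minus_le_iff)
    have "((drop n w, S w, c n), \<alpha> n, \<beta> n, (drop (Suc n) w, S w, c (Suc n))) \<in> Tr" for n
    proof -
      have "drop n w = [] \<or> hd (drop n w) = \<alpha> n"
        by (cases "n < D") (simp_all add: hd_drop_conv_nth w(2), simp add: w_def)
      then show ?thesis using G[of n] G[of "Suc n"] by (simp add: Tr_def cS drop_Suc tl_drop)
    qed
    then have "safe_run I Tr \<alpha> \<beta> (\<lambda>n. (drop n w, S w, c n))"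
      using w(1) by (simp add: safe_run_def I_def c0)
    then show "\<exists>r \<beta>. safe_run I Tr \<alpha> \<beta> r" by blast
  next
    fix \<alpha> r \<beta>
    assume r: "safe_run I Tr \<alpha> \<beta> r"
    have tr: "(r n, \<alpha> n, \<beta> n, r (Suc n)) \<in> Tr" for n using r by (simp add: safe_run_def)
    obtain w where w: "w \<in> W" "r 0 = (w, S w, A w)" using r by (auto simp: safe_run_def I_def)
    define c where "c = (\<lambda>n. snd (snd (r n)))"
    have s: "fst (snd (r n)) = S w" for n
      by (induction n) (use w tr in \<open>auto simp: Tr_def\<close>)
    have d: "fst (r n) = drop n w" for n
    proof (induction n)
      case (Suc n)
      then show ?case using tr[of n] by (simp add: Tr_def drop_Suc tl_drop)
    qed (use w in simp)
    have cS: "c (Suc n) = S w * of_bool (\<alpha> n) + 2 * c n - 2 ^ K * of_bool (\<beta> n)" for n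
      using tr[of n] s[of n] by (simp add: Tr_def c_def)
    have "\<alpha> i = w ! i" if "i < D" for i
    proof -
      have "drop i w \<noteq> []" using that w(1) by (simp add: W_def)
      then have "hd (drop i w) = \<alpha> i" using tr[of i] d[of i] by (simp add: Tr_def)
      then show ?thesis using that w(1) by (simp add: hd_drop_conv_nth W_def)
    qed
    then have f: "2 ^ K * f (bin_val \<alpha>) = of_int (A w) + of_int (S w) * bin_val \<alpha>"
      using w(1) by (intro pieces) (auto simp: W_def)
    \<comment> \<open>The error of the invariant doubles in each step. As long as the run survives,
      \<open>c\<close> is bounded and so is the error, which therefore vanishes.\<close>
    have "2 ^ K * bin_val (tail n \<beta>) - of_int (S w) * bin_val (tail n \<alpha>) - of_int (c n) = 0" for n
    proof (rule bounded_doubling)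
      show "2 ^ K * bin_val (tail (Suc n) \<beta>) - of_int (S w) * bin_val (tail (Suc n) \<alpha>) - of_int (c (Suc n)) =
          2 * (2 ^ K * bin_val (tail n \<beta>) - of_int (S w) * bin_val (tail n \<alpha>) - of_int (c n))" for n
        by (simp add: bin_val_tail_Suc cS algebra_simps)
      fix n
      have "\<bar>2 ^ K * bin_val (tail n \<beta>)\<bar> \<le> 2 ^ K" "\<bar>of_int (S w) * bin_val (tail n \<alpha>)\<bar> \<le> \<bar>of_int (S w)\<bar>"
        using abs_mult_bin_val[of "2 ^ K"] abs_mult_bin_val by simp_all
      moreover have "c n \<in> {-B..B}" using tr[of n] by (auto simp: Tr_def G_def c_def)
      then have "\<bar>of_int (c n) :: real\<bar> \<le> of_int B" by (simp add: abs_le_iff)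
      ultimately show "\<bar>2 ^ K * bin_val (tail n \<beta>) - of_int (S w) * bin_val (tail n \<alpha>) - of_int (c n)\<bar> \<le>
          2 ^ K + \<bar>of_int (S w)\<bar> + of_int B" by linarith
    qed
    from this[of 0] have "2 ^ K * bin_val \<beta> = of_int (A w) + of_int (S w) * bin_val \<alpha>"
      using w(2) by (simp add: c_def)
    then have "2 ^ K * bin_val \<beta> = 2 ^ K * f (bin_val \<alpha>)" by (simp only: f)
    then show "bin_val \<beta> = f (bin_val \<alpha>)" by simp
  qed
  ultimately show ?thesis by (rule safe_funI)
qed

lemma power_split: "m \<le> D \<Longrightarrow> (2 :: real) ^ D = 2 ^ (D - m) * 2 ^ m"
  by (simp flip: power_add)

lemma finite_tents_safe_fun:
  assumes N: "\<And>j. ev j \<Longrightarrow> j < N"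
  shows "safe_fun (tents ev)"
proof -
  \<comment> \<open>For \<open>j < N\<close> the endpoints and the peak \<open>3 / 2^(j+2)\<close>
    of a tent are multiples of \<open>2^-D\<close>, so the function is affine on each piece.\<close>
  define D where "D = N + 1"
  \<comment> \<open>The largest denominator among the coefficients is \<open>2^(2j+1)\<close> with
    \<open>j < N\<close>, so multiplication by \<open>2^K\<close> makes all of them
    integers.\<close>
  define K where "K = 2 * N"
  have "\<exists>S A :: int. \<forall>\<alpha>. (\<forall>i<D. \<alpha> i = w ! i) \<longrightarrow>
      2 ^ K * tents ev (bin_val \<alpha>) = of_int A + of_int S * bin_val \<alpha>" for w
  proof -
    \<comment> \<open>The numbers with an expansion extending \<open>w\<close> lie in the closed
      interval from \<open>k / 2^D\<close> to \<open>(k + 1) / 2^D\<close>.\<close>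
    define k where "k = trunc (\<lambda>i. w ! i) D"
    have range: "real k \<le> bin_val \<alpha> * 2 ^ D \<and> bin_val \<alpha> * 2 ^ D \<le> real (k + 1)" if "\<forall>i<D. \<alpha> i = w ! i" for \<alpha>
    proof -
      have "trunc \<alpha> D = k" using that by (simp add: k_def trunc_def)
      then have "bin_val \<alpha> = real k / 2 ^ D + bin_val (tail D \<alpha>) / 2 ^ D"
        using bin_val_prefix[of \<alpha> D] trunc_div[of \<alpha> D] by simp
      then have "bin_val \<alpha> * 2 ^ D = real k + bin_val (tail D \<alpha>)" by (simp add: field_simps)
      then show ?thesis using bin_val_unit[of "tail D \<alpha>"] by simp
    qed
    have lower: "real c / 2 ^ m \<le> x" if "m \<le> D" "c * 2 ^ (D - m) \<le> k" "real k \<le> x * 2 ^ D" for c m x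
    proof -
      have "real (c * 2 ^ (D - m)) \<le> real k" using that(2) by (simp only: of_nat_le_iff)
      then have "real c * 2 ^ (D - m) \<le> real k" by simp
      moreover have "x * 2 ^ D = (x * 2 ^ m) * 2 ^ (D - m)" by (simp add: power_split[OF that(1)])
      ultimately have "real c * 2 ^ (D - m) \<le> (x * 2 ^ m) * 2 ^ (D - m)" using that(3) by linarith
      then show ?thesis by (simp add: divide_le_eq)
    qed
    have upper: "x \<le> real c / 2 ^ m" if "m \<le> D" "k + 1 \<le> c * 2 ^ (D - m)" "x * 2 ^ D \<le> real (k + 1)" for c m x
    proof -
      have "real (k + 1) \<le> real (c * 2 ^ (D - m))" using that(2) by (simp only: of_nat_le_iff)
      then have "real (k + 1) \<le> real c * 2 ^ (D - m)" by simp
      moreover have "x * 2 ^ D = (x * 2 ^ m) * 2 ^ (D - m)" by (simp add: power_split[OF that(1)])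
      ultimately have "(x * 2 ^ m) * 2 ^ (D - m) \<le> real c * 2 ^ (D - m)" using that(3) by linarith
      then show ?thesis by (simp add: le_divide_eq)
    qed
    show ?thesis
    proof (cases "\<exists>j. ev j \<and> 1 * 2 ^ (D - (j + 1)) \<le> k \<and> k + 1 \<le> 1 * 2 ^ (D - j)")
      case True
      then obtain j where j: "ev j" "1 * 2 ^ (D - (j + 1)) \<le> k" "k + 1 \<le> 1 * 2 ^ (D - j)" by blast
      have jN: "j < N" using N j(1) by blast
      have D: "j \<le> D" "j + 1 \<le> D" "j + 2 \<le> D" using jN by (simp_all add: D_def)
      have K1: "(2 :: real) ^ K = 2 ^ (K - j) * 2 ^ j" by (rule power_split) (use jN in \<open>simp add: K_def\<close>)
      have K2: "(2 :: real) ^ K = 2 ^ (K - (2 * j + 1)) * 2 ^ (j + 1) * 2 ^ j"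
      proof -
        have e: "2 * j + 1 = (j + 1) + j" by simp
        have "(2 :: real) ^ K = 2 ^ (K - (2 * j + 1)) * 2 ^ ((j + 1) + j)"
          unfolding e[symmetric] by (rule power_split) (use jN in \<open>simp add: K_def\<close>)
        also have "(2 :: real) ^ ((j + 1) + j) = 2 ^ (j + 1) * 2 ^ j" by (rule power_add)
        finally show ?thesis by (simp only: mult.assoc)
      qed
      have K3: "(2 :: real) ^ K = 2 ^ (K - 2 * j) * 2 ^ j * 2 ^ j"
      proof -
        have "(2 :: real) ^ K = 2 ^ (K - 2 * j) * 2 ^ (2 * j)"
          by (rule power_split) (use jN in \<open>simp add: K_def\<close>)
        also have "(2 :: real) ^ (2 * j) = 2 ^ j * 2 ^ j" unfolding mult_2 by (rule power_add)
        finally show ?thesis by (simp only: mult.assoc)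
      qed
      show ?thesis
      proof (cases "3 * 2 ^ (D - (j + 2)) \<le> k")
        case True
        show ?thesis
        proof (rule exI[of _ "- (2 ^ (K - j))"], rule exI[of _ "2 ^ (K - 2 * j)"], intro allI impI)
          fix \<alpha> assume "\<forall>i<D. \<alpha> i = w ! i"
          note rg = range[OF this]
          have "tents ev (bin_val \<alpha>) = (1 / 2 ^ j - bin_val \<alpha>) / 2 ^ j"
            using lower[OF D(3) True] upper[OF D(1) j(3)] rg by (intro tents_right[of ev j, OF j(1)]) auto
          then have "2 ^ K * tents ev (bin_val \<alpha>) = 2 ^ K / 2 ^ j / 2 ^ j - 2 ^ K / 2 ^ j * bin_val \<alpha>"
            by (simp add: diff_divide_distrib right_diff_distrib)
          also have "(2 :: real) ^ K / 2 ^ j / 2 ^ j = 2 ^ (K - 2 * j)" by (simp add: K3)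
          also have "(2 :: real) ^ K / 2 ^ j = 2 ^ (K - j)" by (simp add: K1)
          finally show "2 ^ K * tents ev (bin_val \<alpha>) =
              of_int (2 ^ (K - 2 * j)) + of_int (- (2 ^ (K - j))) * bin_val \<alpha>" by simp
        qed
      next
        case False
        then have F: "k + 1 \<le> 3 * 2 ^ (D - (j + 2))" by simp
        show ?thesis
        proof (rule exI[of _ "2 ^ (K - j)"], rule exI[of _ "- (2 ^ (K - (2 * j + 1)))"], intro allI impI)
          fix \<alpha> assume "\<forall>i<D. \<alpha> i = w ! i"
          note rg = range[OF this]
          have "tents ev (bin_val \<alpha>) = (bin_val \<alpha> - 1 / 2 ^ (j + 1)) / 2 ^ j"
            using lower[OF D(2) j(2)] upper[OF D(3) F] rg by (intro tents_left[of ev j, OF j(1)]) auto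
          then have "2 ^ K * tents ev (bin_val \<alpha>) = 2 ^ K / 2 ^ j * bin_val \<alpha> - 2 ^ K / 2 ^ (j + 1) / 2 ^ j"
            by (simp add: diff_divide_distrib right_diff_distrib)
          also have "(2 :: real) ^ K / 2 ^ (j + 1) / 2 ^ j = 2 ^ (K - (2 * j + 1))" by (simp only: K2) simp
          also have "(2 :: real) ^ K / 2 ^ j = 2 ^ (K - j)" by (simp add: K1)
          finally show "2 ^ K * tents ev (bin_val \<alpha>) =
              of_int (- (2 ^ (K - (2 * j + 1)))) + of_int (2 ^ (K - j)) * bin_val \<alpha>" by simp
        qed
      qed
    next
      case False
      have "tents ev (bin_val \<alpha>) = 0" if "\<forall>i<D. \<alpha> i = w ! i" for \<alpha>
      proof (rule tents_eq_0)
        note rg = range[OF that]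
        fix j assume j: "ev j"
        have D: "j \<le> D" "j + 1 \<le> D" using N[OF j] by (simp_all add: D_def)
        \<comment> \<open>Both endpoints of a support are multiples of the length of a piece, so a
          piece not contained in the support meets it at most in an endpoint.\<close>
        have "k + 1 \<le> 1 * 2 ^ (D - (j + 1)) \<or> 1 * 2 ^ (D - j) \<le> k" using False j by force
        then show "bin_val \<alpha> \<le> 1 / 2 ^ (j + 1) \<or> 1 / 2 ^ j \<le> bin_val \<alpha>"
          using upper[OF D(2), of 1 "bin_val \<alpha>"] lower[OF D(1), of 1 "bin_val \<alpha>"] rg by auto
      qed
      then show ?thesis by (intro exI[of _ "0 :: int"]) simp
    qed
  qed
  then obtain S A :: "bool list \<Rightarrow> int" where "\<And>w \<alpha>. (\<forall>i<D. \<alpha> i = w ! i) \<Longrightarrow>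
      2 ^ K * tents ev (bin_val \<alpha>) = of_int (A w) + of_int (S w) * bin_val \<alpha>" by metis
  then show ?thesis by (intro piecewise_affine_safe_fun[OF tents_unit, where D = D and K = K and A = A and S = S])
qed

section \<open>Linear-time evaluation at dyadic points\<close>

definition keep :: "nat list \<Rightarrow> (nat \<times> int) list" where
  "keep as = map (\<lambda>a. (a, 0)) as"

definition scan :: "(int \<times> tape) list \<Rightarrow> nat list" where
  "scan xs = map (\<lambda>(h, t). t h) xs"

definition apply_acts :: "(nat \<times> int) list \<Rightarrow> (int \<times> tape) list \<Rightarrow> (int \<times> tape) list" where
  "apply_acts acts xs = map2 (\<lambda>(w, d) (h, t). (h + d, t(h := w))) acts xs"

lemma apply_keep [simp]: "apply_acts (keep (scan xs)) xs = xs"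
  by (induction xs) (auto simp: apply_acts_def keep_def scan_def)

lemma apply_acts_Cons [simp]:
  "apply_acts ((w, d) # acts) ((h, t) # xs) = (h + d, t(h := w)) # apply_acts acts xs"
  by (simp add: apply_acts_def)

lemma set_apply_acts:
  assumes "(h, t) \<in> set (apply_acts acts xs)"
  obtains w d h' t' where "(w, d) \<in> set acts" "(h', t') \<in> set xs" "t = t'(h' := w)"
proof -
  obtain i where i: "i < length acts" "i < length xs" "apply_acts acts xs ! i = (h, t)"
    using assms by (auto simp: in_set_conv_nth apply_acts_def)
  obtain w d where a: "acts ! i = (w, d)" by force
  obtain h' t' where x: "xs ! i = (h', t')" by force
  have "t = t'(h' := w)" using i by (simp add: apply_acts_def a x)
  then show thesis using that nth_mem[OF i(1)] nth_mem[OF i(2)] by (simp add: a x)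
qed

definition action :: "tm \<Rightarrow> nat \<Rightarrow> nat list \<Rightarrow> nat \<times> (nat \<times> int) list" where
  "action M q as = (case map_of (snd M) (q, as) of None \<Rightarrow> (q, keep as) | Some r \<Rightarrow> r)"

lemma tm_step_action:
  "tm_step M (q, xs) = (fst (action M q (scan xs)), apply_acts (snd (action M q (scan xs))) xs)"
proof (cases "map_of (snd M) (q, scan xs)")
  case None
  then show ?thesis by (simp add: tm_step_def tm_lookup_def action_def flip: scan_def)
next
  case (Some r)
  then show ?thesis
    by (cases r) (simp add: tm_step_def tm_lookup_def action_def apply_acts_def flip: scan_def)
qed

text \<open>A partial rule is tabulated over finitely many states and symbols; a combination without
  value gets no row, which makes the machine halt there.\<close>

definition full_table :: "nat \<Rightarrow> nat \<Rightarrow> nat \<Rightarrow> (nat \<Rightarrow> nat list \<Rightarrow> (nat \<times> (nat \<times> int) list) option) \<Rightarrow> tm_table" where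
  "full_table k Q B F = map (\<lambda>p. (p, the (F (fst p) (snd p))))
     (filter (\<lambda>p. F (fst p) (snd p) \<noteq> None) (List.product [0..<Q] (List.n_lists k [0..<B])))"

lemma map_of_full_table:
  assumes "q < Q" "length as = k" "set as \<subseteq> {..<B}"
  shows "map_of (full_table k Q B F) (q, as) = F q as"
proof -
  have m: "map_of (map (\<lambda>p. (p, h p)) ps) p = (if p \<in> set ps then Some (h p) else None)"
    for h :: "nat \<times> nat list \<Rightarrow> nat \<times> (nat \<times> int) list" and ps p
    by (induction ps) auto
  have "(q, as) \<in> set (List.product [0..<Q] (List.n_lists k [0..<B]))"
    using assms by (auto simp: set_n_lists)
  then show ?thesis unfolding full_table_def m by (cases "F q as") auto
qed

text \<open>States \<open>3 q\<close> and \<open>3 q + 1\<close> read a leading zero while the event machine is in state \<open>q\<close>, writing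
  two zeros; the states \<open>2, 5, 8, 11\<close> belong to the phases after the first one has been found.\<close>

definition eval_rule :: "tm \<Rightarrow> nat \<Rightarrow> nat \<Rightarrow> nat list \<Rightarrow> (nat \<times> (nat \<times> int) list) option" where
  "eval_rule M qe s as =
    (let q = s div 3; a = as ! 0; b = as ! 1; c = as ! 2; ms = drop 3 as in
     if s mod 3 = 0 then
       if a = 1 then Some (3 * fst (action M q ms) + 1, (1, 0) # (1, 1) # (c, 0) # snd (action M q ms))
       else if a = 2 \<and> q = qe then Some (2, (2, 1) # (1, 1) # (c, 0) # keep ms)
       else Some (11, (a, 0) # (b, 0) # (1, 0) # keep ms)
     else if s mod 3 = 1 then Some (3 * q, (a, 1) # (1, 1) # (c, 0) # keep ms)
     else if s = 2 then
       if a = 2 then Some (8, (a, 0) # (b, 0) # (2, 0) # keep ms)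
       else if a = 1 then Some (5, (a, 0) # (b, 0) # (1, 0) # keep ms)
       else Some (11, (a, 0) # (b, 0) # (1, 0) # keep ms)
     else if s = 5 then
       if a = 0 then Some (11, keep as) else Some (5, (a, 1) # (a, 1) # (c, 0) # keep ms)
     else if s = 8 then
       if a = 0 then Some (11, keep as) else Some (8, (a, 1) # (3 - a, 1) # (c, 0) # keep ms)
     else None)"

lemma eval_rule_Cons:
  "eval_rule M qe s (a # b # c # ms) =
    (if s mod 3 = 0 then
       if a = 1 then Some (3 * fst (action M (s div 3) ms) + 1, (1, 0) # (1, 1) # (c, 0) # snd (action M (s div 3) ms))
       else if a = 2 \<and> s div 3 = qe then Some (2, (2, 1) # (1, 1) # (c, 0) # keep ms)
       else Some (11, (a, 0) # (b, 0) # (1, 0) # keep ms)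
     else if s mod 3 = 1 then Some (3 * (s div 3), (a, 1) # (1, 1) # (c, 0) # keep ms)
     else if s = 2 then
       if a = 2 then Some (8, (a, 0) # (b, 0) # (2, 0) # keep ms)
       else if a = 1 then Some (5, (a, 0) # (b, 0) # (1, 0) # keep ms)
       else Some (11, (a, 0) # (b, 0) # (1, 0) # keep ms)
     else if s = 5 then
       if a = 0 then Some (11, (a, 0) # (b, 0) # (c, 0) # keep ms) else Some (5, (a, 1) # (a, 1) # (c, 0) # keep ms)
     else if s = 8 then
       if a = 0 then Some (11, (a, 0) # (b, 0) # (c, 0) # keep ms) else Some (8, (a, 1) # (3 - a, 1) # (c, 0) # keep ms)
     else None)"
  by (simp add: eval_rule_def Let_def keep_def)

lemma phase_arith: "Suc (3 * q) div 3 = q" "Suc (3 * q) mod 3 = Suc 0"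
  by presburger+

text \<open>The simulating states are below \<open>3 * Q\<close> and the later phases below 12. The
  phases are all congruent to 2 modulo 3, which separates them from the states \<open>3 q\<close>
  and \<open>3 q + 1\<close>.\<close>

definition eval_tm :: "tm \<Rightarrow> nat \<Rightarrow> nat \<Rightarrow> nat \<Rightarrow> tm" where
  "eval_tm M qe Q B = (fst M + 3, full_table (fst M + 3) (3 * Q + 12) B (eval_rule M qe))"

lemma action_wf:
  assumes "tm_wf M" "length as = fst M"
  shows "length (snd (action M q as)) = fst M" "snd ` set (snd (action M q as)) \<subseteq> {-1, 0, 1}"
proof -
  have "length (snd (action M q as)) = fst M \<and> snd ` set (snd (action M q as)) \<subseteq> {-1, 0, 1}"
  proof (cases "map_of (snd M) (q, as)")
    case None
    then show ?thesis using assms(2) by (auto simp: action_def keep_def)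
  next
    case (Some r)
    obtain q' acts where r: "r = (q', acts)" by force
    have "((q, as), (q', acts)) \<in> set (snd M)" using map_of_SomeD[OF Some] by (simp add: r)
    then have "length acts = fst M \<and> (\<forall>(w, d) \<in> set acts. d \<in> {-1, 0, 1})"
      using assms(1) unfolding tm_wf_def by blast
    then show ?thesis using Some by (fastforce simp: action_def r)
  qed
  then show "length (snd (action M q as)) = fst M" "snd ` set (snd (action M q as)) \<subseteq> {-1, 0, 1}" by blast+
qed

definition acts_ok :: "nat \<Rightarrow> (nat \<times> int) list \<Rightarrow> bool" where
  "acts_ok n acts \<longleftrightarrow> length acts = n \<and> snd ` set acts \<subseteq> {-1, 0, 1}"

lemma acts_ok_Cons: "d \<in> {-1, 0, 1} \<Longrightarrow> acts_ok n acts \<Longrightarrow> acts_ok (Suc n) ((a, d) # acts)"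
  by (simp add: acts_ok_def)

lemma acts_ok_keep: "acts_ok (length as) (keep as)"
  by (auto simp: acts_ok_def keep_def)

lemma eval_rule_wf:
  assumes "tm_wf M" "length as = fst M + 3" "eval_rule M qe s as = Some r"
  shows "acts_ok (Suc (Suc (Suc (fst M)))) (snd r)"
proof -
  have l: "length (drop 3 as) = fst M" using assms(2) by simp
  have a: "acts_ok (fst M) (snd (action M (s div 3) (drop 3 as)))"
    unfolding acts_ok_def using action_wf[OF assms(1) l] by blast
  have k: "acts_ok (fst M) (keep (drop 3 as))" using acts_ok_keep[of "drop 3 as"] unfolding l .
  have "length as = Suc (Suc (Suc (fst M)))" using assms(2) by simp
  then have k': "acts_ok (Suc (Suc (Suc (fst M)))) (keep as)" using acts_ok_keep[of as] by simp
  show ?thesis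
    using assms(3) a k k' unfolding eval_rule_def Let_def
    by (auto split: if_split_asm intro!: acts_ok_Cons)
qed

lemma eval_tm_wf: assumes "tm_wf M" shows "tm_wf (eval_tm M qe Q B)"
  unfolding tm_wf_def
proof (clarify, intro conjI)
  fix q as q' acts
  assume "((q, as), (q', acts)) \<in> set (snd (eval_tm M qe Q B))"
  then have *: "length as = fst M + 3" "eval_rule M qe q as = Some (q', acts)"
    by (auto simp: eval_tm_def full_table_def set_n_lists)
  show "length as = fst (eval_tm M qe Q B)" using * by (simp add: eval_tm_def)
  show "length acts = fst (eval_tm M qe Q B)" "\<forall>(w, d)\<in>set acts. d \<in> {-1, 0, 1}"
    using eval_rule_wf[OF assms *] by (auto simp: eval_tm_def acts_ok_def)
qed

lemma string_tape_snoc: "(string_tape \<tau>)(int (length \<tau>) := bit_sym b) = string_tape (\<tau> @ [b])"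
  by (auto simp: fun_eq_iff string_tape_def nth_append)

lemma string_tape_end: "string_tape \<tau> (int (length \<tau>)) = 0"
  by (simp add: string_tape_def)

lemma string_tape_Nil: "string_tape [] = (\<lambda>_. 0)"
  by (auto simp: string_tape_def)

lemma string_tape_bound: "string_tape \<tau> i < 3"
  by (simp add: string_tape_def bit_sym_def)

definition eval_config :: "bool list \<Rightarrow> nat \<Rightarrow> nat \<Rightarrow> bool list \<Rightarrow> bool list \<Rightarrow> (int \<times> tape) list \<Rightarrow> config" where
  "eval_config \<sigma> s p \<tau> \<eta> xs = (s, (int p, string_tape \<sigma>) # (int (length \<tau>), string_tape \<tau>) # (0, string_tape \<eta>) # xs)"

text \<open>The bounds \<open>Q\<close> on states and \<open>B\<close> on symbols make the table of
  the evaluating machine finite. \<open>Q\<close> has to admit the initial state 0, and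
  \<open>B\<close> the symbols of the two bits.\<close>

locale event_eval =
  fixes M :: tm and qe Q B :: nat
  assumes wf: "tm_wf M" and Q: "0 < Q" "\<And>e. e \<in> set (snd M) \<Longrightarrow> fst (snd e) < Q"
    and B: "3 \<le> B" "\<And>e w. e \<in> set (snd M) \<Longrightarrow> w \<in> set (snd (snd e)) \<Longrightarrow> fst w < B"
begin

abbreviation "L \<equiv> eval_tm M qe Q B"

definition good :: "nat \<Rightarrow> (int \<times> tape) list \<Rightarrow> bool" where
  "good q xs \<longleftrightarrow> q < Q \<and> length xs = fst M \<and> (\<forall>(h, t) \<in> set xs. \<forall>i. t i < B)"

lemma good_step:
  assumes "good q xs"
  shows "good (fst (tm_step M (q, xs))) (snd (tm_step M (q, xs)))"
proof (cases "map_of (snd M) (q, scan xs)")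
  case None
  then show ?thesis using assms by (simp add: tm_step_action action_def)
next
  case (Some r)
  have r: "((q, scan xs), r) \<in> set (snd M)" using map_of_SomeD[OF Some] .
  obtain q' acts where qa: "r = (q', acts)" by force
  have "length (snd r) = fst M" using wf r unfolding tm_wf_def qa by fastforce
  moreover have "t i < B" if "(h, t) \<in> set (apply_acts (snd r) xs)" for h t i
  proof -
    obtain w d h' t' where *: "(w, d) \<in> set (snd r)" "(h', t') \<in> set xs" "t = t'(h' := w)"
      using \<open>(h, t) \<in> set (apply_acts (snd r) xs)\<close> by (rule set_apply_acts)
    have "t' i < B" using assms *(2) unfolding good_def by blast
    moreover have "w < B" using B(2)[OF r, of "(w, d)"] *(1) by simp
    ultimately show ?thesis by (simp add: *(3))
  qed
  moreover have "length (apply_acts (snd r) xs) = fst M"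
    using \<open>length (snd r) = fst M\<close> assms by (simp add: apply_acts_def good_def)
  ultimately show ?thesis using Q(2)[OF r] Some
    unfolding good_def tm_step_action action_def by auto
qed

lemma good_run: "good (fst (tm_run M n (tm_init M []))) (snd (tm_run M n (tm_init M [])))"
proof (induction n)
  case 0
  show ?case using Q(1) B(1) by (auto simp: good_def tm_init_def)
next
  case (Suc n)
  from good_step[OF this] show ?case by (simp add: tm_run_Suc)
qed

lemma eval_step:
  assumes "good q xs" "s < 3 * Q + 12" "length \<eta> \<le> 1"
    and "eval_rule M qe s (string_tape \<sigma> (int p) # 0 # string_tape \<eta> 0 # scan xs) =
      Some (s', (a, d) # (b, d') # (c, d'') # acts)"
  shows "tm_step L (eval_config \<sigma> s p \<tau> \<eta> xs) =
    (s', (int p + d, (string_tape \<sigma>)(int p := a)) # (int (length \<tau>) + d', (string_tape \<tau>)(int (length \<tau>) := b)) #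
      (d'', (string_tape \<eta>)(0 := c)) # apply_acts acts xs)"
proof -
  let ?ys = "(int p, string_tape \<sigma>) # (int (length \<tau>), string_tape \<tau>) # (0, string_tape \<eta>) # xs"
  have sc: "scan ?ys = string_tape \<sigma> (int p) # 0 # string_tape \<eta> 0 # scan xs"
    by (simp add: scan_def string_tape_end)
  have "set (scan ?ys) \<subseteq> {..<B}"
    using assms(1) B(1) string_tape_bound[of \<sigma> "int p"] string_tape_bound[of \<eta> 0]
    unfolding sc by (auto simp: scan_def good_def split: prod.splits)
  moreover have "length (scan ?ys) = fst M + 3" using assms(1) by (simp add: scan_def good_def)
  ultimately have "map_of (snd L) (s, scan ?ys) = eval_rule M qe s (scan ?ys)"
    unfolding eval_tm_def snd_conv by (intro map_of_full_table assms(2))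
  then have "action L s (scan ?ys) = (s', (a, d) # (b, d') # (c, d'') # acts)"
    unfolding action_def using assms(4) by (simp only: sc) simp
  then show ?thesis unfolding eval_config_def by (simp add: tm_step_action)
qed

lemma tape_self: "(string_tape \<sigma>)(i := string_tape \<sigma> i) = string_tape \<sigma>" by simp

lemma step_zero:
  assumes "good q xs" "p < length \<sigma>" "\<not> \<sigma> ! p"
  shows "tm_step L (eval_config \<sigma> (3 * q) p \<tau> [] xs) =
    eval_config \<sigma> (3 * fst (tm_step M (q, xs)) + 1) p (\<tau> @ [False]) [] (snd (tm_step M (q, xs)))"
proof -
  have a: "string_tape \<sigma> (int p) = 1" using assms by (simp add: string_tape_def bit_sym_def)
  have s: "3 * q < 3 * Q + 12" using assms by (simp add: good_def)
  have "tm_step L (eval_config \<sigma> (3 * q) p \<tau> [] xs) = (3 * fst (action M q (scan xs)) + 1,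
      (int p + 0, (string_tape \<sigma>)(int p := 1)) # (int (length \<tau>) + 1, (string_tape \<tau>)(int (length \<tau>) := bit_sym False)) #
      (0, (string_tape [])(0 := string_tape [] 0)) # apply_acts (snd (action M q (scan xs))) xs)"
    by (rule eval_step[OF assms(1) s]) (simp_all add: eval_rule_Cons a bit_sym_def)
  then show ?thesis
    using tape_self[of \<sigma> "int p"] unfolding string_tape_snoc a
    by (simp add: eval_config_def tm_step_action add.commute)
qed

lemma step_zero':
  assumes "good q xs"
  shows "tm_step L (eval_config \<sigma> (3 * q + 1) p \<tau> [] xs) = eval_config \<sigma> (3 * q) (Suc p) (\<tau> @ [False]) [] xs"
proof -
  have s: "3 * q + 1 < 3 * Q + 12" using assms by (simp add: good_def)
  have "tm_step L (eval_config \<sigma> (3 * q + 1) p \<tau> [] xs) = (3 * q,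
      (int p + 1, (string_tape \<sigma>)(int p := string_tape \<sigma> (int p))) #
      (int (length \<tau>) + 1, (string_tape \<tau>)(int (length \<tau>) := bit_sym False)) #
      (0, (string_tape [])(0 := string_tape [] 0)) # apply_acts (keep (scan xs)) xs)"
    by (rule eval_step[OF assms s]) (simp_all add: eval_rule_Cons bit_sym_def phase_arith)
  then show ?thesis unfolding string_tape_snoc by (simp add: eval_config_def add.commute)
qed

lemma step_stop:
  assumes "good q xs" "string_tape \<sigma> (int p) = 0 \<or> string_tape \<sigma> (int p) = 2 \<and> q \<noteq> qe"
  shows "tm_step L (eval_config \<sigma> (3 * q) p \<tau> [] xs) = eval_config \<sigma> 11 p \<tau> [False] xs"
proof -
  have s: "3 * q < 3 * Q + 12" using assms by (simp add: good_def)
  have "tm_step L (eval_config \<sigma> (3 * q) p \<tau> [] xs) = (11,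
      (int p + 0, (string_tape \<sigma>)(int p := string_tape \<sigma> (int p))) #
      (int (length \<tau>) + 0, (string_tape \<tau>)(int (length \<tau>) := 0)) #
      (0, (string_tape [])(int (length ([] :: bool list)) := bit_sym False)) # apply_acts (keep (scan xs)) xs)"
    unfolding list.size of_nat_0
    by (rule eval_step[OF assms(1) s]) (use assms(2) in \<open>auto simp: eval_rule_Cons bit_sym_def\<close>)
  then show ?thesis unfolding string_tape_snoc
    using tape_self[of \<tau> "int (length \<tau>)"] by (simp add: eval_config_def string_tape_end)
qed

lemma step_event:
  assumes "good qe xs" "string_tape \<sigma> (int p) = 2"
  shows "tm_step L (eval_config \<sigma> (3 * qe) p \<tau> [] xs) = eval_config \<sigma> 2 (Suc p) (\<tau> @ [False]) [] xs"
proof -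
  have s: "3 * qe < 3 * Q + 12" using assms by (simp add: good_def)
  have "tm_step L (eval_config \<sigma> (3 * qe) p \<tau> [] xs) = (2,
      (int p + 1, (string_tape \<sigma>)(int p := 2)) #
      (int (length \<tau>) + 1, (string_tape \<tau>)(int (length \<tau>) := bit_sym False)) #
      (0, (string_tape [])(0 := string_tape [] 0)) # apply_acts (keep (scan xs)) xs)"
    by (rule eval_step[OF assms(1) s]) (simp_all add: eval_rule_Cons bit_sym_def assms(2))
  then show ?thesis using tape_self[of \<sigma> "int p"] unfolding string_tape_snoc assms(2)
    by (simp add: eval_config_def add.commute)
qed

lemma step_mode:
  assumes "good q xs"
  shows "tm_step L (eval_config \<sigma> 2 p \<tau> [] xs) =
    eval_config \<sigma> (if string_tape \<sigma> (int p) = 2 then 8 else if string_tape \<sigma> (int p) = 1 then 5 else 11) p \<tau>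
      [string_tape \<sigma> (int p) = 2] xs"
proof -
  have "tm_step L (eval_config \<sigma> 2 p \<tau> [] xs) =
      ((if string_tape \<sigma> (int p) = 2 then 8 else if string_tape \<sigma> (int p) = 1 then 5 else 11),
      (int p + 0, (string_tape \<sigma>)(int p := string_tape \<sigma> (int p))) #
      (int (length \<tau>) + 0, (string_tape \<tau>)(int (length \<tau>) := 0)) #
      (0, (string_tape [])(int (length ([] :: bool list)) := bit_sym (string_tape \<sigma> (int p) = 2))) #
      apply_acts (keep (scan xs)) xs)"
    unfolding list.size of_nat_0
    by (rule eval_step[OF assms]) (auto simp: eval_rule_Cons bit_sym_def)
  then show ?thesis unfolding string_tape_snoc
    using tape_self[of \<tau> "int (length \<tau>)"] by (simp add: eval_config_def string_tape_end)
qed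

lemma step_copy:
  assumes "good q xs" "p < length \<sigma>"
  shows "tm_step L (eval_config \<sigma> (if b then 8 else 5) p \<tau> [c] xs) =
    eval_config \<sigma> (if b then 8 else 5) (Suc p) (\<tau> @ [\<sigma> ! p \<noteq> b]) [c] xs"
proof -
  have a: "string_tape \<sigma> (int p) = bit_sym (\<sigma> ! p)" using assms by (simp add: string_tape_def)
  have "tm_step L (eval_config \<sigma> (if b then 8 else 5) p \<tau> [c] xs) = ((if b then 8 else 5),
      (int p + 1, (string_tape \<sigma>)(int p := string_tape \<sigma> (int p))) #
      (int (length \<tau>) + 1, (string_tape \<tau>)(int (length \<tau>) := bit_sym (\<sigma> ! p \<noteq> b))) #
      (0, (string_tape [c])(0 := string_tape [c] 0)) # apply_acts (keep (scan xs)) xs)"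
    by (rule eval_step[OF assms(1)]) (auto simp: eval_rule_Cons bit_sym_def a)
  then show ?thesis unfolding string_tape_snoc by (simp add: eval_config_def add.commute)
qed

lemma step_end:
  assumes "good q xs" "length \<sigma> \<le> p"
  shows "tm_step L (eval_config \<sigma> (if b then 8 else 5) p \<tau> [c] xs) = eval_config \<sigma> 11 p \<tau> [c] xs"
proof -
  have a: "string_tape \<sigma> (int p) = 0" using assms by (simp add: string_tape_def)
  have "tm_step L (eval_config \<sigma> (if b then 8 else 5) p \<tau> [c] xs) = (11,
      (int p + 0, (string_tape \<sigma>)(int p := 0)) #
      (int (length \<tau>) + 0, (string_tape \<tau>)(int (length \<tau>) := 0)) #
      (0, (string_tape [c])(0 := string_tape [c] 0)) # apply_acts (keep (scan xs)) xs)"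
    by (rule eval_step[OF assms(1)]) (auto simp: eval_rule_Cons bit_sym_def a keep_def)
  then show ?thesis
    using tape_self[of \<tau> "int (length \<tau>)"] tape_self[of \<sigma> "int p"] unfolding a
    by (simp add: eval_config_def string_tape_end)
qed

lemma halted_11:
  assumes "good q xs"
  shows "tm_halted L (eval_config \<sigma> 11 p \<tau> [c] xs)"
proof -
  let ?ys = "(int p, string_tape \<sigma>) # (int (length \<tau>), string_tape \<tau>) # (0, string_tape [c]) # xs"
  have "set (scan ?ys) \<subseteq> {..<B}"
    using assms B(1) string_tape_bound[of \<sigma> "int p"] string_tape_bound[of "[c]" 0] string_tape_bound[of \<tau> "int (length \<tau>)"]
    by (auto simp: scan_def good_def split: prod.splits)
  moreover have "length (scan ?ys) = fst M + 3" using assms by (simp add: scan_def good_def)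
  ultimately have "map_of (snd L) (11, scan ?ys) = eval_rule M qe 11 (scan ?ys)"
    unfolding eval_tm_def snd_conv by (intro map_of_full_table) simp_all
  moreover have "eval_rule M qe 11 (scan ?ys) = None" by (simp add: eval_rule_def)
  ultimately have "map_of (snd L) (11, scan ?ys) = None" by (simp only:)
  then show ?thesis unfolding tm_halted_def tm_lookup_def eval_config_def fst_conv snd_conv scan_def[symmetric] .
qed

definition ev :: "nat \<Rightarrow> bool" where
  "ev n \<longleftrightarrow> fst (tm_run M n (tm_init M [])) = qe"

text \<open>For \<open>x = (1 + v) / 2^(n+1)\<close> the tent has the value
  \<open>v / 2^(2n+1)\<close> on its left half and \<open>(1 - v) / 2^(2n+1)\<close> on its right
  half. The first digit \<open>b\<close> of \<open>v\<close> selects the half: the digits of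
  \<open>v\<close> are copied, or complemented and followed by ones.\<close>

definition eval_out :: "bool list \<Rightarrow> bool list \<times> bool list" where
  "eval_out \<sigma> = (let n = length (takeWhile Not \<sigma>); \<rho> = drop (Suc n) \<sigma> in
     if n < length \<sigma> \<and> ev n then
       let b = (\<rho> \<noteq> [] \<and> hd \<rho>) in (replicate (2 * n + 1) False @ map (\<lambda>a. a \<noteq> b) \<rho>, [b])
     else (replicate (2 * n) False, [False]))"

lemma run_zeros:
  assumes "n \<le> length (takeWhile Not \<sigma>)"
  shows "tm_run L (2 * n) (tm_init L [string_tape \<sigma>]) =
    eval_config \<sigma> (3 * fst (tm_run M n (tm_init M []))) n (replicate (2 * n) False) [] (snd (tm_run M n (tm_init M [])))"
  using assms
proof (induction n)
  case 0
  have "map (\<lambda>i. (0 :: int, if i < length [string_tape \<sigma>] then [string_tape \<sigma>] ! i else (\<lambda>_. 0))) [0..<fst M + 3] =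
      (0, string_tape \<sigma>) # (0, \<lambda>_. 0) # (0, \<lambda>_. 0) # map (\<lambda>i. (0, \<lambda>_. 0)) [0..<fst M]"
    by (rule nth_equalityI) (auto simp: nth_Cons nth_append split: nat.splits)
  then show ?case by (simp add: tm_init_def eval_config_def string_tape_Nil eval_tm_def del: upt_Suc)
next
  case (Suc n)
  let ?c = "tm_run M n (tm_init M [])"
  have n: "n < length (takeWhile Not \<sigma>)" using Suc.prems by simp
  then have p: "n < length \<sigma>" using length_takeWhile_le less_le_trans by blast
  have z: "\<not> \<sigma> ! n" using n nth_mem[OF n] takeWhile_nth[OF n] set_takeWhileD by metis
  have "tm_run L (2 * Suc n) (tm_init L [string_tape \<sigma>]) =
      tm_step L (tm_step L (eval_config \<sigma> (3 * fst ?c) n (replicate (2 * n) False) [] (snd ?c)))"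
    using Suc by (simp add: tm_run_Suc)
  also have "\<dots> = eval_config \<sigma> (3 * fst (tm_step M ?c)) (Suc n) ((replicate (2 * n) False @ [False]) @ [False]) [] (snd (tm_step M ?c))"
    using step_zero[OF good_run p z] step_zero'[OF good_step[OF good_run[of n]]] by simp
  also have "(replicate (2 * n) False @ [False]) @ [False] = replicate (2 * Suc n) False"
    by (simp add: replicate_append_same)
  finally show ?case by (simp add: tm_run_Suc)
qed

lemma run_copy:
  assumes "good q xs" "p + m = length \<sigma>"
  shows "tm_run L m (eval_config \<sigma> (if b then 8 else 5) p \<tau> [c] xs) =
    eval_config \<sigma> (if b then 8 else 5) (length \<sigma>) (\<tau> @ map (\<lambda>a. a \<noteq> b) (drop p \<sigma>)) [c] xs"
  using assms(2)
proof (induction m arbitrary: p \<tau>)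
  case 0
  then show ?case by simp
next
  case (Suc m)
  have p: "p < length \<sigma>" using Suc.prems by simp
  have "tm_run L (Suc m) (eval_config \<sigma> (if b then 8 else 5) p \<tau> [c] xs) =
      tm_run L m (tm_step L (eval_config \<sigma> (if b then 8 else 5) p \<tau> [c] xs))"
    by (simp add: tm_run_def funpow_swap1)
  also have "\<dots> = tm_run L m (eval_config \<sigma> (if b then 8 else 5) (Suc p) (\<tau> @ [\<sigma> ! p \<noteq> b]) [c] xs)"
    using step_copy[OF assms(1) p, of b] by simp
  also have "\<dots> = eval_config \<sigma> (if b then 8 else 5) (length \<sigma>) ((\<tau> @ [\<sigma> ! p \<noteq> b]) @ map (\<lambda>a. a \<noteq> b) (drop (Suc p) \<sigma>)) [c] xs"
    by (rule Suc.IH) (use Suc.prems in simp)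
  finally show ?case by (simp add: Cons_nth_drop_Suc[OF p, symmetric])
qed

text \<open>Two steps for each of the \<open>n\<close> leading zeros, one for each digit after the
  leading one, and at most three steps for the changes of phase.\<close>

lemma eval_run:
  "\<exists>t p q xs. t \<le> 4 * (length \<sigma> + 1) \<and> good q xs \<and>
     tm_run L t (tm_init L [string_tape \<sigma>]) = eval_config \<sigma> 11 p (fst (eval_out \<sigma>)) (snd (eval_out \<sigma>)) xs"
proof -
  define n where "n = length (takeWhile Not \<sigma>)"
  define c where "c = tm_run M n (tm_init M [])"
  define \<rho> where "\<rho> = drop (Suc n) \<sigma>"
  have nl: "n \<le> length \<sigma>" by (simp add: n_def length_takeWhile_le)
  have g: "good (fst c) (snd c)" unfolding c_def by (rule good_run)
  have r: "tm_run L (2 * n) (tm_init L [string_tape \<sigma>]) = eval_config \<sigma> (3 * fst c) n (replicate (2 * n) False) [] (snd c)"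
    unfolding c_def by (rule run_zeros) (simp add: n_def)
  have one: "string_tape \<sigma> (int n) = (if n < length \<sigma> then 2 else 0)"
    using nth_length_takeWhile[of Not \<sigma>] by (auto simp: n_def string_tape_def bit_sym_def)
  show ?thesis
  proof (cases "n < length \<sigma> \<and> ev n")
    case False
    have "tm_step L (eval_config \<sigma> (3 * fst c) n (replicate (2 * n) False) [] (snd c)) =
        eval_config \<sigma> 11 n (replicate (2 * n) False) [False] (snd c)"
      by (rule step_stop[OF g]) (use False one in \<open>auto simp: ev_def c_def\<close>)
    moreover have "eval_out \<sigma> = (replicate (2 * n) False, [False])"
      using False unfolding eval_out_def Let_def n_def by auto
    ultimately show ?thesis using r nl g
      by (intro exI[of _ "Suc (2 * n)"] exI[of _ n] exI[of _ "fst c"] exI[of _ "snd c"]) (auto simp: tm_run_Suc)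
  next
    case True
    define b where "b = (\<rho> \<noteq> [] \<and> hd \<rho>)"
    let ?\<tau> = "replicate (2 * n + 1) False"
    have qe: "fst c = qe" using True by (simp add: ev_def c_def)
    have "tm_step L (eval_config \<sigma> (3 * fst c) n (replicate (2 * n) False) [] (snd c)) =
        eval_config \<sigma> 2 (Suc n) (replicate (2 * n) False @ [False]) [] (snd c)"
      unfolding qe by (rule step_event) (use g qe one True in auto)
    also have "replicate (2 * n) False @ [False] = ?\<tau>" by (simp add: replicate_append_same)
    finally have r1: "tm_run L (Suc (2 * n)) (tm_init L [string_tape \<sigma>]) = eval_config \<sigma> 2 (Suc n) ?\<tau> [] (snd c)"
      using r by (simp add: tm_run_Suc)
    have out: "eval_out \<sigma> = (?\<tau> @ map (\<lambda>a. a \<noteq> b) \<rho>, [b])"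
      using True unfolding eval_out_def Let_def b_def \<rho>_def n_def by simp
    have sym: "string_tape \<sigma> (int (Suc n)) = (if \<rho> = [] then 0 else bit_sym (hd \<rho>))"
      by (auto simp: \<rho>_def string_tape_def hd_drop_conv_nth simp del: of_nat_Suc)
    show ?thesis
    proof (cases "\<rho> = []")
      case empty: True
      have "tm_run L (Suc (Suc (2 * n))) (tm_init L [string_tape \<sigma>]) = eval_config \<sigma> 11 (Suc n) ?\<tau> [b] (snd c)"
        unfolding tm_run_Suc[of _ "Suc (2 * n)"] r1 step_mode[OF g] sym using empty by (simp add: b_def)
      then show ?thesis using nl g out empty
        by (intro exI[of _ "Suc (Suc (2 * n))"] exI[of _ "Suc n"] exI[of _ "fst c"] exI[of _ "snd c"]) auto
    next
      case False
      have "tm_run L (Suc (Suc (2 * n))) (tm_init L [string_tape \<sigma>]) =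
          eval_config \<sigma> (if b then 8 else 5) (Suc n) ?\<tau> [b] (snd c)"
        unfolding tm_run_Suc[of _ "Suc (2 * n)"] r1 step_mode[OF g] sym using False
        by (cases "hd \<rho>") (simp_all add: b_def bit_sym_def)
      moreover have "Suc n + length \<rho> = length \<sigma>" using False by (simp add: \<rho>_def)
      ultimately have "tm_run L (Suc (Suc (2 * n)) + length \<rho>) (tm_init L [string_tape \<sigma>]) =
          eval_config \<sigma> (if b then 8 else 5) (length \<sigma>) (?\<tau> @ map (\<lambda>a. a \<noteq> b) \<rho>) [b] (snd c)"
        unfolding tm_run_add by (simp only: run_copy[OF g] \<rho>_def)
      then have "tm_run L (Suc (Suc (Suc (2 * n)) + length \<rho>)) (tm_init L [string_tape \<sigma>]) =
          eval_config \<sigma> 11 (length \<sigma>) (?\<tau> @ map (\<lambda>a. a \<noteq> b) \<rho>) [b] (snd c)"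
        unfolding tm_run_Suc[of _ "Suc (Suc (2 * n)) + length \<rho>"] by (simp only: step_end[OF g order_refl])
      moreover have "Suc (Suc (Suc (2 * n)) + length \<rho>) \<le> 4 * (length \<sigma> + 1)"
        using nl by (simp add: \<rho>_def)
      ultimately show ?thesis using g out
        by (intro exI[of _ "Suc (Suc (Suc (2 * n)) + length \<rho>)"] exI[of _ "length \<sigma>"] exI[of _ "fst c"] exI[of _ "snd c"]) simp
    qed
  qed
qed

lemma tape_holds_string: "tape_holds (string_tape \<tau>) \<tau>"
  by (simp add: tape_holds_def string_tape_def)

lemma linear_time_eval_out: "linear_time_computable eval_out"
  unfolding linear_time_computable_def Let_def
proof (intro exI[of _ L] exI[of _ 4] conjI allI)
  show "tm_wf L" by (rule eval_tm_wf[OF wf])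
  show "3 \<le> fst L" by (simp add: eval_tm_def)
  fix \<sigma>
  obtain t p q xs where t: "t \<le> 4 * (length \<sigma> + 1)" "good q xs"
     "tm_run L t (tm_init L [string_tape \<sigma>]) = eval_config \<sigma> 11 p (fst (eval_out \<sigma>)) (snd (eval_out \<sigma>)) xs"
    using eval_run by blast
  have "length (snd (eval_out \<sigma>)) = 1" by (simp add: eval_out_def Let_def)
  then obtain c where c: "snd (eval_out \<sigma>) = [c]" by (auto simp: length_Suc_conv)
  have h: "tm_halted L (tm_run L t (tm_init L [string_tape \<sigma>]))"
    unfolding t(3) c by (rule halted_11[OF t(2)])
  have e: "tm_run L (4 * (length \<sigma> + 1)) (tm_init L [string_tape \<sigma>]) = tm_run L t (tm_init L [string_tape \<sigma>])"
    by (rule tm_run_halted[OF h t(1)])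
  show "tm_halted L (tm_run L (4 * (length \<sigma> + 1)) (tm_init L [string_tape \<sigma>]))" unfolding e by (rule h)
  show "tape_holds (snd (snd (tm_run L (4 * (length \<sigma> + 1)) (tm_init L [string_tape \<sigma>])) ! 1)) (fst (eval_out \<sigma>))"
    unfolding e t(3) by (simp add: eval_config_def tape_holds_string)
  show "tape_holds (snd (snd (tm_run L (4 * (length \<sigma> + 1)) (tm_init L [string_tape \<sigma>])) ! 2)) (snd (eval_out \<sigma>))"
    unfolding e t(3) by (simp add: eval_config_def tape_holds_string)
qed

end

subsection \<open>Values at dyadic points\<close>

lemma bin_val_fin_Nil [simp]: "bin_val_fin [] = 0"
  by (simp add: bin_val_fin_def)

lemma bin_val_fin_Cons [simp]: "bin_val_fin (b # xs) = (of_bool b + bin_val_fin xs) / 2"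
  unfolding bin_val_fin_def length_Cons sum.lessThan_Suc_shift
  by (simp add: add_divide_distrib sum_divide_distrib)

lemma bin_val_fin_append: "bin_val_fin (xs @ ys) = bin_val_fin xs + bin_val_fin ys / 2 ^ length xs"
  by (induction xs) (simp_all add: add_divide_distrib)

lemma bin_val_fin_replicate [simp]: "bin_val_fin (replicate n False) = 0"
  by (induction n) simp_all

text \<open>Complementing a finite string falls short of \<open>1 - v\<close> by one unit in the
  last place; the period of ones in the output of \<open>eval_out\<close> supplies exactly this
  unit.\<close>

lemma bin_val_fin_not: "bin_val_fin (map Not xs) = 1 - 1 / 2 ^ length xs - bin_val_fin xs"
proof (induction xs)
  case (Cons a xs)
  have algebra: "(1 - b + (1 - p - v)) / 2 = 1 - p / 2 - (b + v) / 2" for b p v :: real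
    by (simp add: field_simps)
  have e: "(1 :: real) / 2 ^ length (a # xs) = 1 / 2 ^ length xs / 2" by simp
  have n: "(of_bool (\<not> a) :: real) = 1 - of_bool a" by simp
  show ?case unfolding list.map bin_val_fin_Cons Cons.IH n e by (rule algebra)
qed simp

lemma bin_val_fin_nonneg: "0 \<le> bin_val_fin xs"
  by (induction xs) auto

lemma bin_val_fin_le: "bin_val_fin xs \<le> 1"
  by (induction xs) (auto simp: of_bool_def)

lemma bin_val_ev_periodic: "bin_val (ev_periodic \<tau> [b]) = bin_val_fin \<tau> + of_bool b / 2 ^ length \<tau>"
proof -
  have "tail (length \<tau>) (ev_periodic \<tau> [b]) = (\<lambda>_. b)" by (simp add: fun_eq_iff tail_def ev_periodic_def)
  moreover have "bin_val (\<lambda>_. b) = of_bool b"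
    using bin_val_ones[of 0] by (cases b) (simp_all add: bin_val_def)
  moreover have "(\<Sum>s<length \<tau>. of_bool (ev_periodic \<tau> [b] s) / 2 ^ (s + 1)) = bin_val_fin \<tau>"
    unfolding bin_val_fin_def by (rule sum.cong) (auto simp: ev_periodic_def)
  ultimately show ?thesis using bin_val_prefix[of "ev_periodic \<tau> [b]" "length \<tau>"] by simp
qed

lemma (in event_eval) eval_out_correct:
  assumes "eval_out \<sigma> = (\<tau>, \<eta>)"
  shows "\<eta> \<noteq> [] \<and> bin_val (ev_periodic \<tau> \<eta>) = tents ev (bin_val_fin \<sigma>)"
proof -
  define n where "n = length (takeWhile Not \<sigma>)"
  define \<rho> where "\<rho> = drop (Suc n) \<sigma>"
  define v where "v = bin_val_fin \<rho>"
  have "x \<in> set (takeWhile Not \<sigma>) \<Longrightarrow> x = False" for x by (auto dest: set_takeWhileD)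
  then have tw: "takeWhile Not \<sigma> = replicate n False"
    unfolding n_def by (metis replicate_eqI)
  have v01: "0 \<le> v" "v \<le> 1" by (simp_all add: v_def bin_val_fin_nonneg bin_val_fin_le)
  show ?thesis
  proof (cases "n < length \<sigma>")
    case False
    then have "length \<sigma> \<le> n" by simp
    then have "take n \<sigma> = \<sigma>" by (rule take_all)
    then have "\<sigma> = replicate n False" using tw takeWhile_eq_take[of Not \<sigma>, folded n_def] by simp
    then have "bin_val_fin \<sigma> = 0" by (metis bin_val_fin_replicate)
    moreover have "eval_out \<sigma> = (replicate (2 * n) False, [False])"
      using False unfolding eval_out_def Let_def n_def by auto
    ultimately show ?thesis using assms by (auto simp: bin_val_ev_periodic tents_outside)
  next
    case True
    have "\<sigma> ! n" using True nth_length_takeWhile[of Not \<sigma>] by (simp add: n_def)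
    then have \<sigma>: "\<sigma> = replicate n False @ True # \<rho>"
      using tw id_take_nth_drop[OF True] takeWhile_eq_take[of Not \<sigma>, folded n_def] by (simp add: \<rho>_def)
    have x: "bin_val_fin \<sigma> = (1 + v) / 2 ^ (n + 1)"
      by (subst \<sigma>) (simp add: bin_val_fin_append v_def)
    show ?thesis
    proof (cases "ev n")
      case False
      have "tents ev (bin_val_fin \<sigma>) = 0"
        using tents_on[of n "bin_val_fin \<sigma>" ev] v01 False unfolding x by (simp add: field_simps)
      moreover have "eval_out \<sigma> = (replicate (2 * n) False, [False])"
        using False unfolding eval_out_def Let_def n_def by auto
      ultimately show ?thesis using assms by (auto simp: bin_val_ev_periodic)
    next
      case ev: True
      define b where "b = (\<rho> \<noteq> [] \<and> hd \<rho>)"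
      have out: "\<tau> = replicate (2 * n + 1) False @ map (\<lambda>a. a \<noteq> b) \<rho>" "\<eta> = [b]"
        using assms True ev unfolding eval_out_def Let_def b_def \<rho>_def n_def by simp_all
      have l: "length (replicate (2 * n + 1) False) = 2 * n + 1" by simp
      have "2 * n + 1 = (n + 1) + n" by simp
      then have pw: "(2 :: real) ^ (2 * n + 1) = 2 ^ (n + 1) * 2 ^ n" by (simp only: power_add)
      show ?thesis
      proof (cases b)
        case True
        then obtain \<rho>' where "\<rho> = True # \<rho>'" unfolding b_def by (cases \<rho>) auto
        then have v: "1 / 2 \<le> v" using bin_val_fin_nonneg[of \<rho>'] by (simp add: v_def)
        have "tents ev (bin_val_fin \<sigma>) = (1 / 2 ^ n - bin_val_fin \<sigma>) / 2 ^ n"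
          by (rule tents_right[of ev n, OF ev]) (use v v01 in \<open>simp_all add: x field_simps\<close>)
        also have "1 / 2 ^ n - bin_val_fin \<sigma> = (1 - v) / 2 ^ (n + 1)" by (simp add: x field_simps)
        also have "(1 - v) / 2 ^ (n + 1) / 2 ^ n = (1 - v) / 2 ^ (2 * n + 1)" unfolding pw by (rule divide_divide_eq_left)
        finally have t: "tents ev (bin_val_fin \<sigma>) = (1 - v) / 2 ^ (2 * n + 1)" .
        have "map (\<lambda>a. a \<noteq> b) \<rho> = map Not \<rho>" using True by simp
        then have "bin_val (ev_periodic \<tau> \<eta>) = (1 - 1 / 2 ^ length \<rho> - v) / 2 ^ (2 * n + 1) + 1 / 2 ^ (2 * n + 1 + length \<rho>)"
          unfolding out bin_val_ev_periodic bin_val_fin_append bin_val_fin_replicate l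
          using True by (simp only: bin_val_fin_not v_def length_append l length_map) simp
        also have "\<dots> = (1 - v) / 2 ^ (2 * n + 1)"
          unfolding power_add[of _ "2 * n + 1"] by (simp add: diff_divide_distrib mult.commute)
        finally show ?thesis using t out by simp
      next
        case False
        have v: "v \<le> 1 / 2"
        proof (cases \<rho>)
          case (Cons a \<rho>')
          then have "\<not> a" using False by (simp add: b_def)
          then show ?thesis using bin_val_fin_le[of \<rho>'] by (simp add: v_def Cons)
        qed (simp add: v_def)
        have "tents ev (bin_val_fin \<sigma>) = (bin_val_fin \<sigma> - 1 / 2 ^ (n + 1)) / 2 ^ n"
          by (rule tents_left[of ev n, OF ev]) (use v v01 in \<open>simp_all add: x field_simps\<close>)
        also have "bin_val_fin \<sigma> - 1 / 2 ^ (n + 1) = v / 2 ^ (n + 1)" by (simp add: x add_divide_distrib)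
        also have "v / 2 ^ (n + 1) / 2 ^ n = v / 2 ^ (2 * n + 1)" unfolding pw by (rule divide_divide_eq_left)
        finally have t: "tents ev (bin_val_fin \<sigma>) = v / 2 ^ (2 * n + 1)" .
        have "map (\<lambda>a. a \<noteq> b) \<rho> = \<rho>" using False by simp
        then have "bin_val (ev_periodic \<tau> \<eta>) = v / 2 ^ (2 * n + 1)"
          unfolding out bin_val_ev_periodic bin_val_fin_append bin_val_fin_replicate l
          using False by (simp only: v_def) simp
        then show ?thesis using t out by simp
      qed
    qed
  qed
qed

lemma (in event_eval) pointwise_linear_time_tents: "pointwise_linear_time (tents ev)"
  unfolding pointwise_linear_time_def
proof (intro conjI allI impI)
  show "lipschitz_unit (tents ev)" by (rule lipschitz_unit_tents)
  fix k n :: nat assume "k \<le> 2 ^ n"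
  then have "real k \<le> 2 ^ n" by (metis of_nat_le_iff of_nat_numeral of_nat_power)
  then have "real k / 2 ^ n \<in> \<rat> \<inter> {0..1}" by (simp add: divide_le_eq)
  then show "tents ev (real k / 2 ^ n) \<in> \<rat>" using tents_rational by blast
next
  show "\<exists>\<psi>. linear_time_computable \<psi> \<and> (\<forall>\<sigma> \<tau> \<eta>. \<psi> \<sigma> = (\<tau>, \<eta>) \<longrightarrow>
      \<eta> \<noteq> [] \<and> bin_val (ev_periodic \<tau> \<eta>) = tents ev (bin_val_fin \<sigma>))"
    using linear_time_eval_out eval_out_correct by blast
qed

lemma pointwise_linear_time_event_tents:
  assumes "tm_wf M"
  shows "pointwise_linear_time (tents (\<lambda>n. fst (tm_run M n (tm_init M [])) = qe))"
proof -
  \<comment> \<open>A finite table mentions finitely many states and symbols. The initial state 0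
    and, further below, the bit symbol 2 are added because the table might not mention them.\<close>
  have "finite (insert 0 ((\<lambda>e. fst (snd e)) ` set (snd M)))" by simp
  then obtain Q where Q: "\<And>q. q \<in> insert 0 ((\<lambda>e. fst (snd e)) ` set (snd M)) \<Longrightarrow> q < Q"
    by (meson finite_nat_set_iff_bounded)
  have "finite (insert 2 (fst ` (\<Union>e\<in>set (snd M). set (snd (snd e)))))" by simp
  then obtain B where B: "\<And>w. w \<in> insert 2 (fst ` (\<Union>e\<in>set (snd M). set (snd (snd e)))) \<Longrightarrow> w < B"
    by (meson finite_nat_set_iff_bounded)
  interpret event_eval M qe Q B
  proof
    show "3 \<le> B" using B[of 2] by simp
  qed (use assms Q B in auto)
  have "ev = (\<lambda>n. fst (tm_run M n (tm_init M [])) = qe)" by (simp add: fun_eq_iff ev_def)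
  then show ?thesis using pointwise_linear_time_tents by simp
qed

section \<open>Computing the tents from approximations\<close>

text \<open>The tent at \<open>a / 2^k\<close>, multiplied by \<open>2^k * 2^j\<close> to become an
  integer; truncated subtraction plays the part of the maximum with 0.\<close>

definition tent_num :: "nat \<Rightarrow> nat \<Rightarrow> nat \<Rightarrow> nat" where
  "tent_num k a j = min (a - 2 ^ (k - Suc j)) (2 ^ (k - j) - a)"

text \<open>Names may exceed 1, so the numerator is clipped. Passing to the denominator
  \<open>2^n\<close> means dividing by \<open>2^(j+2)\<close>, and adding half of the divisor first
  rounds to the nearest integer.\<close>

definition approx_tents :: "(nat \<Rightarrow> bool) \<Rightarrow> nat \<Rightarrow> nat \<Rightarrow> nat" where
  "approx_tents ev n N = (let k = n + 2; a = min N (2 ^ k) in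
     \<Sum>j<k. if ev j then (tent_num k a j + 2 ^ Suc j) div 2 ^ (j + 2) else 0)"

lemma real_nat_diff: "real (m - n) = max 0 (real m - real n)"
  by (cases "n \<le> m") (auto simp: of_nat_diff)

lemma real_tent_num:
  assumes "j < k"
  shows "real (tent_num k a j) = 2 ^ k * 2 ^ j * tent j (real a / 2 ^ k)"
proof -
  have "(2 :: real) ^ k = 2 ^ (k - Suc j) * 2 ^ (j + 1)" "(2 :: real) ^ k = 2 ^ (k - j) * 2 ^ j"
    using assms by (simp_all flip: power_add del: power_Suc)
  then have e: "(2 :: real) ^ k * (1 / 2 ^ (j + 1)) = 2 ^ (k - Suc j)" "(2 :: real) ^ k * (1 / 2 ^ j) = 2 ^ (k - j)"
    by (simp_all only: times_divide_eq_right mult_1_right nonzero_mult_div_cancel_right power_not_zero) simp_all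
  have mx: "2 ^ k * max 0 y = max 0 (2 ^ k * y)" and mn: "2 ^ k * min y z = min (2 ^ k * y) (2 ^ k * z)" for y z :: real
    by (simp_all add: max_mult_distrib_left min_mult_distrib_left)
  have x: "2 ^ k * (real a / 2 ^ k) = real a" by simp
  have "2 ^ k * 2 ^ j * tent j (real a / 2 ^ k) =
      2 ^ k * max 0 (min (real a / 2 ^ k - 1 / 2 ^ (j + 1)) (1 / 2 ^ j - real a / 2 ^ k))"
    unfolding tent_def by simp
  also have "\<dots> = max 0 (min (real a - 2 ^ (k - Suc j)) (2 ^ (k - j) - real a))"
    unfolding mx mn right_diff_distrib x e ..
  also have "\<dots> = min (max 0 (real a - 2 ^ (k - Suc j))) (max 0 (2 ^ (k - j) - real a))"
    by (rule max_min_distrib2)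
  also have "\<dots> = real (tent_num k a j)"
    unfolding tent_num_def of_nat_min real_nat_diff by simp
  finally show ?thesis ..
qed

lemma nearest_div:
  fixes m d :: nat
  assumes "0 < d"
  shows "\<bar>real m / real (2 * d) - real ((m + d) div (2 * d))\<bar> \<le> 1 / 2"
proof -
  define q where "q = (m + d) div (2 * d)"
  define r where "r = (m + d) mod (2 * d)"
  have "m + d = 2 * d * q + r" unfolding q_def r_def by simp
  then have "real m + real d = 2 * real d * real q + real r" by (metis of_nat_add of_nat_mult of_nat_numeral)
  moreover have "real r < 2 * real d" using mod_less_divisor[of "2 * d" "m + d"] assms unfolding r_def
    by (metis mult_pos_pos of_nat_less_iff of_nat_mult of_nat_numeral pos2)
  ultimately have "\<bar>real m - 2 * real d * real q\<bar> \<le> real d" by (simp add: abs_le_iff)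
  then have "\<bar>real m - 2 * real d * real q\<bar> / (2 * real d) \<le> real d / (2 * real d)"
    by (rule divide_right_mono) simp
  moreover have "real m / real (2 * d) - real q = (real m - 2 * real d * real q) / (2 * real d)"
    using assms by (simp add: diff_divide_distrib)
  ultimately show ?thesis using assms by (simp add: abs_divide flip: q_def)
qed

lemma approx_tents_exact:
  assumes "a \<le> 2 ^ (n + 2)"
  shows "\<bar>tents ev (real a / 2 ^ (n + 2)) * 2 ^ n - real (approx_tents ev n a)\<bar> \<le> 1 / 2"
proof -
  define k where "k = n + 2"
  define x where "x = real a / 2 ^ k"
  let ?t = "\<lambda>j. if ev j then (tent_num k a j + 2 ^ Suc j) div 2 ^ (j + 2) else 0"
  have ap: "approx_tents ev n a = (\<Sum>j<k. ?t j)"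
    unfolding approx_tents_def Let_def k_def by (simp only: min_absorb1[OF assms])
  have zero: "?t j = 0" if "j < k" "tent j x = 0" for j
  proof -
    have "real (tent_num k a j) = 0" using real_tent_num[OF that(1), of a] that(2) by (simp add: x_def)
    then show ?thesis by simp
  qed
  \<comment> \<open>A multiple of \<open>2^-k\<close> is either 0 or at least \<open>2^-k\<close>,
    beyond the support of each tent with index \<open>k\<close> or more. Hence the sum over
    \<open>j < k\<close> is complete.\<close>
  have big: "tent j x = 0" if "k \<le> j" for j
  proof (cases "a = 0")
    case False
    then have "1 / 2 ^ k \<le> x" unfolding x_def by (intro divide_right_mono) simp_all
    then show ?thesis using half_power_le[OF that] by (intro tent_eq_0) linarith
  qed (simp add: x_def tent_eq_0)
  show ?thesis
  proof (cases "\<exists>j. ev j \<and> tent j x \<noteq> 0")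
    case True
    then obtain j where j: "ev j" "tent j x \<noteq> 0" by blast
    have jk: "j < k" using big[of j] j(2) by (meson not_le)
    have I: "1 / 2 ^ (j + 1) \<le> x" "x \<le> 1 / 2 ^ j" using tent_eq_0[of x j] j(2) by linarith+
    have other: "tent i x = 0" if "i \<noteq> j" for i
      using I half_power_le[of "i + 1" j] half_power_le[of "j + 1" i] that
      by (intro tent_eq_0) (cases "i < j", auto)
    have "approx_tents ev n a = ?t j"
      unfolding ap using jk other zero by (subst sum.remove[of _ j]) (auto intro!: sum.neutral)
    then have q: "approx_tents ev n a = (tent_num k a j + 2 ^ Suc j) div (2 * 2 ^ Suc j)"
      using j(1) by simp
    have "tents ev x = tent j x" using tents_on[OF I, of ev] j(1) by simp
    moreover have "tent j x * 2 ^ n = real (tent_num k a j) / real (2 * 2 ^ Suc j)"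
      using real_tent_num[OF jk, of a] by (simp add: x_def k_def)
    ultimately have "tents ev x * 2 ^ n = real (tent_num k a j) / real (2 * 2 ^ Suc j)" by simp
    then show ?thesis using nearest_div[of "2 ^ Suc j" "tent_num k a j"]
      unfolding q x_def[symmetric] k_def[symmetric] by simp
  next
    case False
    have "?t j = 0" if "j < k" for j
    proof (cases "ev j")
      case True
      then have "tent j x = 0" using False by blast
      then show ?thesis by (rule zero[OF that])
    qed simp
    then have "approx_tents ev n a = 0" unfolding ap by (intro sum.neutral) blast
    moreover have "tents ev x \<le> 0" by (rule tents_least) (use False in auto)
    then have "tents ev x = 0" using tents_nonneg[of ev x] by simp
    ultimately show ?thesis by (simp add: x_def k_def)
  qed
qed

text \<open>The error budget in units of \<open>2^-n\<close>: a quarter from the input, by the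
  Lipschitz constant 1 and two extra bits, and a half from rounding.\<close>

lemma approx_tents_name:
  assumes "x \<in> {0..1}" "cauchy_name p x"
  shows "cauchy_name (\<lambda>n. approx_tents ev n (p (n + 2))) (tents ev x)"
  unfolding cauchy_name_def
proof
  fix n :: nat
  define k where "k = n + 2"
  define a where "a = min (p k) (2 ^ k)"
  define y where "y = real a / 2 ^ k"
  let ?q = "approx_tents ev n (p k)"
  have q: "?q = approx_tents ev n a" unfolding approx_tents_def Let_def a_def k_def by (simp only: min.right_idem)
  have "\<bar>x - real (p k) / 2 ^ k\<bar> \<le> 1 / 2 ^ k" using assms(2) unfolding cauchy_name_def by blast
  \<comment> \<open>Clipping at 1 cannot increase the distance to a point of the unit
    interval.\<close>
  moreover have "y = min (real (p k) / 2 ^ k) 1"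
    by (simp add: y_def a_def min_divide_distrib_right of_nat_min)
  moreover have "0 \<le> x" "x \<le> 1" using assms(1) by auto
  ultimately have "\<bar>x - y\<bar> \<le> 1 / 2 ^ k" by linarith
  then have 1: "\<bar>tents ev x - tents ev y\<bar> \<le> 1 / 2 ^ k" using tents_lipschitz[of ev x y] by linarith
  have "\<bar>tents ev y * 2 ^ n - real ?q\<bar> \<le> 1 / 2"
    unfolding q y_def by (rule approx_tents_exact[of a n ev, folded k_def]) (simp add: a_def)
  then have "\<bar>tents ev y * 2 ^ n - real ?q\<bar> / 2 ^ n \<le> 1 / 2 / 2 ^ n" by (rule divide_right_mono) simp
  moreover have "tents ev y - real ?q / 2 ^ n = (tents ev y * 2 ^ n - real ?q) / 2 ^ n"
    by (simp add: diff_divide_distrib)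
  then have "\<bar>tents ev y - real ?q / 2 ^ n\<bar> = \<bar>tents ev y * 2 ^ n - real ?q\<bar> / 2 ^ n"
    by (simp only: abs_divide) simp
  ultimately have 2: "\<bar>tents ev y - real ?q / 2 ^ n\<bar> \<le> 1 / 2 / 2 ^ n" by linarith
  have "1 / 2 ^ k = (1 / 4) / (2 :: real) ^ n" by (simp add: k_def power_add)
  moreover have "(1 / 4) / (2 :: real) ^ n + 1 / 2 / 2 ^ n \<le> 1 / 2 ^ n"
    unfolding add_divide_distrib[symmetric] by (rule divide_right_mono) simp_all
  ultimately show "\<bar>tents ev x - real (approx_tents ev n (p (n + 2))) / 2 ^ n\<bar> \<le> 1 / 2 ^ n"
    using 1 2 unfolding k_def by linarith
qed

definition machine_event :: "nat \<Rightarrow> (nat \<Rightarrow> tm_table) \<Rightarrow> (nat \<Rightarrow> nat) \<Rightarrow> nat \<Rightarrow> nat \<Rightarrow> bool" where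
  "machine_event k T qe z n \<longleftrightarrow> fst (tm_run (k, T z) n (tm_init (k, T z) [])) = qe z"

lemma prim_machine_event:
  assumes "prim T" "prim qe" "prim f" "prim g"
  shows "prim (\<lambda>x. machine_event k T qe (f x) (g x))"
proof -
  have ev: "machine_event k T qe z n \<longleftrightarrow> fst (sim_run (\<lambda>_ _. 0) (k, T z) n) = qe z" for z n
  proof -
    have "abs_config (\<lambda>_ _. 0) (sim_run (\<lambda>_ _. 0) (k, T z) n) = tm_run (k, T z) n (tm_init (k, T z) [])"
      by (rule sim_run) simp
    from arg_cong[OF this, of fst] show ?thesis by (simp add: abs_config_def machine_event_def)
  qed
  have run: "prim (\<lambda>x. sim_run (\<lambda>_ _. 0) (M x) (t x))" if "prim M" "prim t" for M :: "'a \<Rightarrow> tm" and t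
    using prim_sim_run[of "\<lambda>(_ :: nat) _ _. 0", OF prim_const prim_const[of "0 :: nat"] that] .
  show ?thesis unfolding ev
    by (intro pr run assms prim_comp[OF assms(1)] prim_comp[OF assms(2)])
qed

lemma prec_approx_tents:
  assumes "\<And>f g :: nat \<times> nat \<Rightarrow> nat. prim f \<Longrightarrow> prim g \<Longrightarrow> prim (\<lambda>x. E (f x) (g x))"
  shows "prec (\<lambda>c. approx_tents (E (fst (prod_decode c))) (fst (prod_decode (snd (prod_decode c))))
     (snd (prod_decode (snd (prod_decode c)))))"
  unfolding prec_iff_prim approx_tents_def Let_def tent_num_def by (intro pr assms)

section \<open>\<open>\<Sigma>\<^sup>0\<^sub>2\<close>-completeness\<close>

text \<open>One predicate \<open>ev z\<close> connects three facts: bounded simulation makes it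
  primitive recursive, which yields the indices; the machine behind it is run directly by the
  linear-time evaluation; and its infinitude expresses \<open>z \<notin> S\<close>.\<close>

lemma Sigma02_tents:
  assumes "Sigma02 S"
  shows "\<exists>g ev. computable_fun g \<and> (\<forall>z. functional_computes (g z) (tents (ev z)) \<and>
    pointwise_linear_time (tents (ev z)) \<and> (z \<in> S \<longleftrightarrow> finite {n. ev z n}))"
proof -
  obtain E where E: "prec E" "\<And>z. z \<in> S \<longleftrightarrow> \<not> (\<exists>\<^sub>\<infinity>s. E (prod_encode (z, s)) \<noteq> 0)"
    using Sigma02_events[OF assms] by blast
  obtain k T qe where T: "prim T" "prim qe" "\<And>z. tm_wf (k, T z)"
    and inf: "\<And>z. (\<exists>\<^sub>\<infinity>n. fst (tm_run (k, T z) n (tm_init (k, T z) [])) = qe z) \<longleftrightarrow>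
      (\<exists>\<^sub>\<infinity>s. E (prod_encode (z, s)) \<noteq> 0)"
    using event_machine[OF E(1)] by blast
  define ev where "ev = machine_event k T qe"
  have "prec (\<lambda>c. approx_tents (ev (fst (prod_decode c))) (fst (prod_decode (snd (prod_decode c))))
     (snd (prod_decode (snd (prod_decode c)))))"
    unfolding ev_def by (rule prec_approx_tents) (rule prim_machine_event[OF T(1,2)])
  from oracle_machine[OF this]
  obtain g where g: "prec g" "\<And>z p n. turing_functional (g z) p n (approx_tents (ev z) n (p (n + 2)))"
    by auto
  have "functional_computes (g z) (tents (ev z))" for z
    unfolding functional_computes_def using approx_tents_name g(2) by blast
  moreover have "pointwise_linear_time (tents (ev z))" for z
    using pointwise_linear_time_event_tents[OF T(3), of z "qe z"]
    unfolding ev_def machine_event_def[abs_def] by simp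
  moreover have "z \<in> S \<longleftrightarrow> finite {n. ev z n}" for z
    unfolding E(2) inf[symmetric] ev_def machine_event_def by (simp add: INFM_iff_infinite)
  ultimately show ?thesis using computable_fun_prec[OF g(1)] by blast
qed

lemma finite_tents_iff_safe_fun: "finite {n. ev n} \<longleftrightarrow> safe_fun (tents ev)"
proof
  assume "finite {n. ev n}"
  then obtain N where "\<forall>n\<in>{n. ev n}. n < N" using finite_nat_set_iff_bounded by blast
  then show "safe_fun (tents ev)" by (intro finite_tents_safe_fun[where N = N]) blast
next
  assume "safe_fun (tents ev)"
  then show "finite {n. ev n}" by (intro regular_tents_finite safe_fun_regular)
qed

theorem theorem1p3:
  shows "(\<exists>A. Sigma02 A \<and>
            (\<forall>e f. f ` {0..1} \<subseteq> {0..1} \<and> functional_computes e f \<longrightarrow>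
               (e \<in> A \<longleftrightarrow> regular_fun f) \<and> (e \<in> A \<longleftrightarrow> transducer_fun f))) \<and>
         (\<forall>S. Sigma02 S \<longrightarrow>
            (\<exists>g f. computable_fun g \<and>
               (\<forall>z. f z ` {0..1} \<subseteq> {0..1} \<and> functional_computes (g z) (f z) \<and>
                    lipschitz_unit (f z) \<and> almost_linear (f z) \<and> pointwise_linear_time (f z) \<and>
                    f z ` (\<rat> \<inter> {0..1}) \<subseteq> \<rat> \<and>
                    (z \<in> S \<longleftrightarrow> regular_fun (f z)) \<and>
                    (z \<in> S \<longleftrightarrow> transducer_fun (f z)))))"
proof (intro conjI allI impI)
  show "\<exists>A. Sigma02 A \<and> (\<forall>e f. f ` {0..1} \<subseteq> {0..1} \<and> functional_computes e f \<longrightarrow>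
      (e \<in> A \<longleftrightarrow> regular_fun f) \<and> (e \<in> A \<longleftrightarrow> transducer_fun f))"
    using Sigma02_regular_indices safe_iff_regular_indices safe_iff_regular safe_iff_transducer by metis
next
  fix S assume "Sigma02 S"
  then obtain g ev where g: "computable_fun g" "\<And>z. functional_computes (g z) (tents (ev z))"
    "\<And>z. pointwise_linear_time (tents (ev z))" "\<And>z. z \<in> S \<longleftrightarrow> finite {n. ev z n}"
    using Sigma02_tents by metis
  have "z \<in> S \<longleftrightarrow> safe_fun (tents (ev z))" for z
    unfolding g(4) by (rule finite_tents_iff_safe_fun)
  then have "(z \<in> S \<longleftrightarrow> regular_fun (tents (ev z))) \<and> (z \<in> S \<longleftrightarrow> transducer_fun (tents (ev z)))" for z
    using safe_iff_regular[OF tents_unit g(2)] safe_iff_transducer by blast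
  then show "\<exists>g f. computable_fun g \<and>
      (\<forall>z. f z ` {0..1} \<subseteq> {0..1} \<and> functional_computes (g z) (f z) \<and>
        lipschitz_unit (f z) \<and> almost_linear (f z) \<and> pointwise_linear_time (f z) \<and>
        f z ` (\<rat> \<inter> {0..1}) \<subseteq> \<rat> \<and>
        (z \<in> S \<longleftrightarrow> regular_fun (f z)) \<and> (z \<in> S \<longleftrightarrow> transducer_fun (f z)))"
    using g tents_unit lipschitz_unit_tents almost_linear_tents tents_rational
    by (intro exI[of _ g] exI[of _ "\<lambda>z. tents (ev z)"]) blast
qed

end
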